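(* Let $T$ be a Hopf monad on an autonomous category $\mathcal{C}$. Assume that left Hopf $T$-modules and right Hopf $T$-modules admit coinvariants which are preserved by $T$ (such is the case if equalizers exist in $\mathcal{C}$ and are preserved by $T$). Suppose moreover that $T$ is conservative. Then there exist two auto-equivalences $I_l$ and $I_r$ of the category $\mathcal{C}$, a universal $I_l$-valued left integral of $T$, and a universal $I_r$-valued right integral of $T$. Moreover $I_l^{!}$ is quasi-inverse to $I_r$, and ${}^{!}I_r$ is quasi-inverse to $I_l$.
   Context: Conventions: categories are small, monoidal categories $(\mathcal{C},\otimes,\mathbf 1)$ are strict; composition of $f$ followed by $g$ is written $gf$; "functorial morphism" means natural transformation. A functor $F$ is conservative if any morphism $f$ such that $F(f)$ is an isomorphism is itself an isomorphism. Monads: a monad on $\mathcal{C}$ is $(T,\mu\colon T^2\to T,\eta\colon 1_{\mathcal C}\to T)$ with $\mu_XT(\mu_X)=\mu_X\mu_{T(X)}$, $\mu_X\eta_{T(X)}=\mathrm{id}=\mu_XT(\eta_X)$. A $T$-module is $(M,r)$ with $r\colon T(M)\to M$, $rT(r)=r\mu_M$, $r\eta_M=\mathrm{id}_M$. Bimonads: a bimonad on a monoidal category $\mathcal{C}$ is a monad $T$ equipped with natural $T_2(X,Y)\colon T(X\otimes Y)\to T(X)\otimes T(Y)$ and $T_0\colon T(\mathbf 1)\to\mathbf 1$ with $(\mathrm{id}\otimes T_2(Y,Z))T_2(X,Y\otimes Z)=(T_2(X,Y)\otimes \mathrm{id})T_2(X\otimes Y,Z)$, $(\mathrm{id}\otimes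 T_0)T_2(X,\mathbf 1)=\mathrm{id}=(T_0\otimes\mathrm{id})T_2(\mathbf 1,X)$, $T_2(X,Y)\mu_{X\otimes Y}=(\mu_X\otimes\mu_Y)T_2(T(X),T(Y))T(T_2(X,Y))$, $T_0\mu_{\mathbf 1}=T_0T(T_0)$, $T_2(X,Y)\eta_{X\otimes Y}=\eta_X\otimes\eta_Y$, $T_0\eta_{\mathbf 1}=\mathrm{id}_{\mathbf 1}$. Duals: $\mathcal{C}$ is autonomous if each object $X$ has a (chosen) left dual $({}^\vee X,\mathrm{ev}_X\colon{}^\vee X\otimes X\to\mathbf 1,\mathrm{coev}_X\colon\mathbf 1\to X\otimes{}^\vee X)$ and a (chosen) right dual $(X^\vee,\widetilde{\mathrm{ev}}_X\colon X\otimes X^\vee\to\mathbf 1,\widetilde{\mathrm{coev}}_X\colon\mathbf 1\to X^\vee\otimes X)$. For an endofunctor $K$ of $\mathcal{C}$, the endofunctors ${}^{!}K$ and $K^{!}$ are defined by ${}^{!}K(X)={}^\vee K(X^\vee)$, $K^{!}(X)=K({}^\vee X)^\vee$, and similarly on morphisms. Hopf monads: a Hopf monad is a bimonad $T$ on an autonomous category admitting a left antipode and a right antipode. A left antipode is a functorial family $s^l_X\colon T({}^\vee T(X))\to{}^\vee X$ with $T_0T(\mathrm{ev}_X)T({}^\vee\eta_X\otimes\mathrm{id}_X)=\mathrm{ev}_{T(X)}(s^l_{T(X)}T({}^\vee\mu_X)\otimes\mathrm{id}_{T(X)})T_2({}^\vee T(X),X)$ and $(\eta_X\otimes\mathrm{id}_{{}^\vee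 X})\mathrm{coev}_XT_0=(\mu_X\otimes s^l_X)T_2(T(X),{}^\vee T(X))T(\mathrm{coev}_{T(X)})$. A right antipode is a functorial family $s^r_X\colon T(T(X)^\vee)\to X^\vee$ with $T_0T(\widetilde{\mathrm{ev}}_X)T(\mathrm{id}_X\otimes\eta_X^\vee)=\widetilde{\mathrm{ev}}_{T(X)}(\mathrm{id}_{T(X)}\otimes s^r_{T(X)}T(\mu_X^\vee))T_2(X,T(X)^\vee)$ and $(\mathrm{id}_{X^\vee}\otimes\eta_X)\widetilde{\mathrm{coev}}_XT_0=(s^r_X\otimes\mu_X)T_2(T(X)^\vee,T(X))T(\widetilde{\mathrm{coev}}_{T(X)})$. Hopf modules and coinvariants: $T(\mathbf 1)$ is a coalgebra with coproduct $T_2(\mathbf 1,\mathbf 1)$ and counit $T_0$. A right Hopf $T$-module is $(M,r,\rho)$ with $(M,r)$ a $T$-module, $(M,\rho\colon M\to M\otimes T(\mathbf 1))$ a right $T(\mathbf 1)$-comodule and $\rho r=(r\otimes\mu_{\mathbf 1})T_2(M,T(\mathbf 1))T(\rho)$. A left Hopf $T$-module is $(M,r,\rho)$ with $(M,r)$ a $T$-module, $(M,\rho\colon M\to T(\mathbf 1)\otimes M)$ a left $T(\mathbf 1)$-comodule and $\rho r=(\mu_{\mathbf 1}\otimes r)T_2(T(\mathbf 1),M)T(\rho)$. A right (resp. left) Hopf $T$-module admits coinvariants if the pair $(\rho,\mathrm{id}_M\otimes\eta_{\mathbf 1})$ (resp. $(\rho,\eta_{\mathbf 1}\otimes\mathrm{id}_M)$)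 has an equalizer $i$; they are preserved by $T$ if $T(i)$ is an equalizer of the image of that pair under $T$. Integrals: for an endofunctor $K$ of $\mathcal{C}$, a $K$-valued left (resp. right) integral of $T$ is a functorial morphism $c\colon T\to K$ with $(\mathrm{id}_{T(\mathbf 1)}\otimes c_X)T_2(\mathbf 1,X)=\eta_{\mathbf 1}\otimes c_X$ (resp. $(c_X\otimes\mathrm{id}_{T(\mathbf 1)})T_2(X,\mathbf 1)=c_X\otimes\eta_{\mathbf 1}$) for all $X$. A left (resp. right) integral $\lambda\colon T\to I$ is universal if for every left (resp. right) integral $c\colon T\to K$ there is a unique functorial morphism $f\colon I\to K$ with $c=f\lambda$. *)

theory Defs
  imports Main
begin

section \<open>Strict monoidal and autonomous categories\<close>

record ('o, 'm) category_data =
  Ob :: "'o set"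
  Ar :: "'m set"
  Dom :: "'m \<Rightarrow> 'o"
  Cod :: "'m \<Rightarrow> 'o"
  ide :: "'o \<Rightarrow> 'm"
  cmp :: "'m \<Rightarrow> 'm \<Rightarrow> 'm"  (infixr "\<cdot>\<index>" 55)

text \<open>The composite \<open>g \<cdot> f\<close> is \<open>f\<close> followed by \<open>g\<close>.\<close>

definition hom :: "('o, 'm, 'x) category_data_scheme \<Rightarrow> 'o \<Rightarrow> 'o \<Rightarrow> 'm set" where
  "hom C X Y = {f \<in> Ar C. Dom C f = X \<and> Cod C f = Y}"

locale category =
  fixes C :: "('o, 'm, 'x) category_data_scheme" (structure)
  assumes Dom_Ob: "f \<in> Ar C \<Longrightarrow> Dom C f \<in> Ob C"
    and Cod_Ob: "f \<in> Ar C \<Longrightarrow> Cod C f \<in> Ob C"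
    and ide_hom: "X \<in> Ob C \<Longrightarrow> ide C X \<in> hom C X X"
    and cmp_hom: "f \<in> hom C X Y \<Longrightarrow> g \<in> hom C Y Z \<Longrightarrow> g \<cdot> f \<in> hom C X Z"
    and ide_left: "f \<in> hom C X Y \<Longrightarrow> ide C Y \<cdot> f = f"
    and ide_right: "f \<in> hom C X Y \<Longrightarrow> f \<cdot> ide C X = f"
    and cmp_assoc: "f \<in> hom C W X \<Longrightarrow> g \<in> hom C X Y \<Longrightarrow> h \<in> hom C Y Z
      \<Longrightarrow> (h \<cdot> g) \<cdot> f = h \<cdot> (g \<cdot> f)"

context
  fixes C :: "('o, 'm, 'x) category_data_scheme" (structure)
begin

definition iso :: "'m \<Rightarrow> bool" where
  "iso f \<longleftrightarrow> f \<in> Ar C \<and>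
    (\<exists>g \<in> hom C (Cod C f) (Dom C f). g \<cdot> f = ide C (Dom C f) \<and> f \<cdot> g = ide C (Cod C f))"

end

text \<open>\<open>equalizer C E i f g\<close>: the morphism \<open>i\<close> with source \<open>E\<close> is an equalizer of the
  parallel pair \<open>(f, g)\<close>.\<close>

context
  fixes C :: "('o, 'm, 'x) category_data_scheme" (structure)
begin

definition equalizer :: "'o \<Rightarrow> 'm \<Rightarrow> 'm \<Rightarrow> 'm \<Rightarrow> bool" where
  "equalizer E i f g \<longleftrightarrow>
    f \<in> Ar C \<and> g \<in> hom C (Dom C f) (Cod C f) \<and>
    E \<in> Ob C \<and> i \<in> hom C E (Dom C f) \<and> f \<cdot> i = g \<cdot> i \<and>
    (\<forall>Z \<in> Ob C. \<forall>h \<in> hom C Z (Dom C f). f \<cdot> h = g \<cdot> h \<longrightarrow> (\<exists>!k. k \<in> hom C Z E \<and> i \<cdot> k = h))"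

end

definition has_equalizers :: "('o, 'm, 'x) category_data_scheme \<Rightarrow> bool" where
  "has_equalizers C \<longleftrightarrow>
    (\<forall>X \<in> Ob C. \<forall>Y \<in> Ob C. \<forall>f \<in> hom C X Y. \<forall>g \<in> hom C X Y. \<exists>E i. equalizer C E i f g)"

record ('o, 'm) monoidal_data = "('o, 'm) category_data" +
  tensor_ob :: "'o \<Rightarrow> 'o \<Rightarrow> 'o"  (infixr "\<otimes>\<^sub>o\<index>" 70)
  tensor :: "'m \<Rightarrow> 'm \<Rightarrow> 'm"  (infixr "\<otimes>\<index>" 70)
  unit_ob :: 'o  ("\<one>\<index>")

locale monoidal_category = category C
  for C :: "('o, 'm, 'x) monoidal_data_scheme" (structure) +
  assumes unit_Ob: "\<one> \<in> Ob C"
    and tensor_Ob: "X \<in> Ob C \<Longrightarrow> Y \<in> Ob C \<Longrightarrow> X \<otimes>\<^sub>o Y \<in> Ob C"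
    and tensor_hom: "f \<in> hom C X X' \<Longrightarrow> g \<in> hom C Y Y' \<Longrightarrow> f \<otimes> g \<in> hom C (X \<otimes>\<^sub>o Y) (X' \<otimes>\<^sub>o Y')"
    and tensor_ide: "X \<in> Ob C \<Longrightarrow> Y \<in> Ob C \<Longrightarrow> ide C X \<otimes> ide C Y = ide C (X \<otimes>\<^sub>o Y)"
    and interchange: "f \<in> hom C X X' \<Longrightarrow> f' \<in> hom C X' X'' \<Longrightarrow> g \<in> hom C Y Y' \<Longrightarrow> g' \<in> hom C Y' Y''
      \<Longrightarrow> (f' \<cdot> f) \<otimes> (g' \<cdot> g) = (f' \<otimes> g') \<cdot> (f \<otimes> g)"
    and tensor_ob_assoc: "X \<in> Ob C \<Longrightarrow> Y \<in> Ob C \<Longrightarrow> Z \<in> Ob C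
      \<Longrightarrow> (X \<otimes>\<^sub>o Y) \<otimes>\<^sub>o Z = X \<otimes>\<^sub>o (Y \<otimes>\<^sub>o Z)"
    and unit_ob_left: "X \<in> Ob C \<Longrightarrow> \<one> \<otimes>\<^sub>o X = X"
    and unit_ob_right: "X \<in> Ob C \<Longrightarrow> X \<otimes>\<^sub>o \<one> = X"
    and tensor_assoc: "f \<in> Ar C \<Longrightarrow> g \<in> Ar C \<Longrightarrow> h \<in> Ar C \<Longrightarrow> (f \<otimes> g) \<otimes> h = f \<otimes> (g \<otimes> h)"
    and unit_left: "f \<in> Ar C \<Longrightarrow> ide C \<one> \<otimes> f = f"
    and unit_right: "f \<in> Ar C \<Longrightarrow> f \<otimes> ide C \<one> = f"

text \<open>Chosen left duals \<open>(ldual X, evl X, coevl X)\<close> and right duals \<open>(rdual X, evr X, coevr X)\<close>.\<close>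

record ('o, 'm) autonomous_data = "('o, 'm) monoidal_data" +
  ldual :: "'o \<Rightarrow> 'o"
  evl :: "'o \<Rightarrow> 'm"
  coevl :: "'o \<Rightarrow> 'm"
  rdual :: "'o \<Rightarrow> 'o"
  evr :: "'o \<Rightarrow> 'm"
  coevr :: "'o \<Rightarrow> 'm"

locale autonomous_category = monoidal_category C
  for C :: "('o, 'm, 'x) autonomous_data_scheme" (structure) +
  assumes ldual_Ob: "X \<in> Ob C \<Longrightarrow> ldual C X \<in> Ob C"
    and evl_hom: "X \<in> Ob C \<Longrightarrow> evl C X \<in> hom C (ldual C X \<otimes>\<^sub>o X) \<one>"
    and coevl_hom: "X \<in> Ob C \<Longrightarrow> coevl C X \<in> hom C \<one> (X \<otimes>\<^sub>o ldual C X)"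
    and ldual_zigzag1: "X \<in> Ob C
      \<Longrightarrow> (ide C X \<otimes> evl C X) \<cdot> (coevl C X \<otimes> ide C X) = ide C X"
    and ldual_zigzag2: "X \<in> Ob C
      \<Longrightarrow> (evl C X \<otimes> ide C (ldual C X)) \<cdot> (ide C (ldual C X) \<otimes> coevl C X) = ide C (ldual C X)"
    and rdual_Ob: "X \<in> Ob C \<Longrightarrow> rdual C X \<in> Ob C"
    and evr_hom: "X \<in> Ob C \<Longrightarrow> evr C X \<in> hom C (X \<otimes>\<^sub>o rdual C X) \<one>"
    and coevr_hom: "X \<in> Ob C \<Longrightarrow> coevr C X \<in> hom C \<one> (rdual C X \<otimes>\<^sub>o X)"
    and rdual_zigzag1: "X \<in> Ob C
      \<Longrightarrow> (evr C X \<otimes> ide C X) \<cdot> (ide C X \<otimes> coevr C X) = ide C X"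
    and rdual_zigzag2: "X \<in> Ob C
      \<Longrightarrow> (ide C (rdual C X) \<otimes> evr C X) \<cdot> (coevr C X \<otimes> ide C (rdual C X)) = ide C (rdual C X)"

text \<open>The duals of a morphism \<open>f : X \<rightarrow> Y\<close>, going from the dual of \<open>Y\<close> to the dual of \<open>X\<close>.\<close>

context
  fixes C :: "('o, 'm, 'x) autonomous_data_scheme" (structure)
begin

definition ldual_mor :: "'m \<Rightarrow> 'm" where
  "ldual_mor f = (let X = Dom C f; Y = Cod C f in
     (evl C Y \<otimes> ide C (ldual C X)) \<cdot> (ide C (ldual C Y) \<otimes> f \<otimes> ide C (ldual C X))
       \<cdot> (ide C (ldual C Y) \<otimes> coevl C X))"

definition rdual_mor :: "'m \<Rightarrow> 'm" where
  "rdual_mor f = (let X = Dom C f; Y = Cod C f in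
     (ide C (rdual C X) \<otimes> evr C Y) \<cdot> (ide C (rdual C X) \<otimes> f \<otimes> ide C (rdual C Y))
       \<cdot> (coevr C X \<otimes> ide C (rdual C Y)))"

end


section \<open>Endofunctors and natural transformations\<close>

record ('o, 'm) endofunctor_data =
  fob :: "'o \<Rightarrow> 'o"
  fmor :: "'m \<Rightarrow> 'm"

locale endofunctor = category C
  for C :: "('o, 'm, 'x) category_data_scheme" (structure)
    and F :: "('o, 'm, 'y) endofunctor_data_scheme" +
  assumes fob_Ob: "X \<in> Ob C \<Longrightarrow> fob F X \<in> Ob C"
    and fmor_hom: "f \<in> hom C X Y \<Longrightarrow> fmor F f \<in> hom C (fob F X) (fob F Y)"
    and fmor_ide: "X \<in> Ob C \<Longrightarrow> fmor F (ide C X) = ide C (fob F X)"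
    and fmor_cmp: "f \<in> hom C X Y \<Longrightarrow> g \<in> hom C Y Z \<Longrightarrow> fmor F (g \<cdot> f) = fmor F g \<cdot> fmor F f"

definition id_functor :: "('o, 'm) endofunctor_data" where
  "id_functor = \<lparr>fob = (\<lambda>X. X), fmor = (\<lambda>f. f)\<rparr>"

definition comp_functor ::
  "('o, 'm, 'y) endofunctor_data_scheme \<Rightarrow> ('o, 'm, 'z) endofunctor_data_scheme
    \<Rightarrow> ('o, 'm) endofunctor_data" where
  "comp_functor G F = \<lparr>fob = (\<lambda>X. fob G (fob F X)), fmor = (\<lambda>f. fmor G (fmor F f))\<rparr>"

text \<open>Only the components at objects of \<open>C\<close> are meaningful.\<close>

context
  fixes C :: "('o, 'm, 'x) category_data_scheme" (structure)
begin

definition nat_trans ::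
  "('o, 'm, 'y) endofunctor_data_scheme
    \<Rightarrow> ('o, 'm, 'z) endofunctor_data_scheme \<Rightarrow> ('o \<Rightarrow> 'm) \<Rightarrow> bool" where
  "nat_trans F G \<alpha> \<longleftrightarrow>
    (\<forall>X \<in> Ob C. \<alpha> X \<in> hom C (fob F X) (fob G X)) \<and>
    (\<forall>X \<in> Ob C. \<forall>Y \<in> Ob C. \<forall>f \<in> hom C X Y. \<alpha> Y \<cdot> fmor F f = fmor G f \<cdot> \<alpha> X)"

end

definition naturally_isomorphic ::
  "('o, 'm, 'x) category_data_scheme \<Rightarrow> ('o, 'm, 'y) endofunctor_data_scheme
    \<Rightarrow> ('o, 'm, 'z) endofunctor_data_scheme \<Rightarrow> bool" where
  "naturally_isomorphic C F G \<longleftrightarrow> (\<exists>\<alpha>. nat_trans C F G \<alpha> \<and> (\<forall>X \<in> Ob C. iso C (\<alpha> X)))"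

definition quasi_inverse ::
  "('o, 'm, 'x) category_data_scheme \<Rightarrow> ('o, 'm, 'y) endofunctor_data_scheme
    \<Rightarrow> ('o, 'm, 'z) endofunctor_data_scheme \<Rightarrow> bool" where
  "quasi_inverse C F G \<longleftrightarrow> endofunctor C F \<and> endofunctor C G \<and>
    naturally_isomorphic C (comp_functor F G) id_functor \<and>
    naturally_isomorphic C (comp_functor G F) id_functor"

definition auto_equivalence ::
  "('o, 'm, 'x) category_data_scheme \<Rightarrow> ('o, 'm, 'y) endofunctor_data_scheme \<Rightarrow> bool" where
  "auto_equivalence C F \<longleftrightarrow> endofunctor C F \<and> (\<exists>G :: ('o, 'm) endofunctor_data. quasi_inverse C F G)"

definition conservative ::
  "('o, 'm, 'x) category_data_scheme \<Rightarrow> ('o, 'm, 'y) endofunctor_data_scheme \<Rightarrow> bool" where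
  "conservative C F \<longleftrightarrow> (\<forall>f \<in> Ar C. iso C (fmor F f) \<longrightarrow> iso C f)"

definition preserves_equalizers ::
  "('o, 'm, 'x) category_data_scheme \<Rightarrow> ('o, 'm, 'y) endofunctor_data_scheme \<Rightarrow> bool" where
  "preserves_equalizers C F \<longleftrightarrow>
    (\<forall>X \<in> Ob C. \<forall>Y \<in> Ob C. \<forall>f \<in> hom C X Y. \<forall>g \<in> hom C X Y. \<forall>E i.
      equalizer C E i f g \<longrightarrow> equalizer C (fob F E) (fmor F i) (fmor F f) (fmor F g))"

text \<open>\<open>lshriek C K\<close> is \<open>!K\<close>, sending \<open>X\<close> to the left dual of \<open>K\<close> of the right dual of \<open>X\<close>, and
  \<open>rshriek C K\<close> is \<open>K!\<close>, sending \<open>X\<close> to the right dual of \<open>K\<close> of the left dual of \<open>X\<close>.\<close>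

definition lshriek ::
  "('o, 'm, 'x) autonomous_data_scheme \<Rightarrow> ('o, 'm, 'y) endofunctor_data_scheme
    \<Rightarrow> ('o, 'm) endofunctor_data" where
  "lshriek C K = \<lparr>fob = (\<lambda>X. ldual C (fob K (rdual C X))),
                  fmor = (\<lambda>f. ldual_mor C (fmor K (rdual_mor C f)))\<rparr>"

definition rshriek ::
  "('o, 'm, 'x) autonomous_data_scheme \<Rightarrow> ('o, 'm, 'y) endofunctor_data_scheme
    \<Rightarrow> ('o, 'm) endofunctor_data" where
  "rshriek C K = \<lparr>fob = (\<lambda>X. rdual C (fob K (ldual C X))),
                  fmor = (\<lambda>f. rdual_mor C (fmor K (ldual_mor C f)))\<rparr>"


section \<open>Monads, bimonads and Hopf monads\<close>

record ('o, 'm) monad_data = "('o, 'm) endofunctor_data" +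
  mu :: "'o \<Rightarrow> 'm"
  eta :: "'o \<Rightarrow> 'm"

locale monad = endofunctor C T
  for C :: "('o, 'm, 'x) category_data_scheme" (structure)
    and T :: "('o, 'm, 'y) monad_data_scheme" +
  assumes mu_nat: "nat_trans C (comp_functor T T) T (mu T)"
    and eta_nat: "nat_trans C id_functor T (eta T)"
    and mu_assoc: "X \<in> Ob C \<Longrightarrow> mu T X \<cdot> fmor T (mu T X) = mu T X \<cdot> mu T (fob T X)"
    and mu_eta_left: "X \<in> Ob C \<Longrightarrow> mu T X \<cdot> eta T (fob T X) = ide C (fob T X)"
    and mu_eta_right: "X \<in> Ob C \<Longrightarrow> mu T X \<cdot> fmor T (eta T X) = ide C (fob T X)"

context
  fixes C :: "('o, 'm, 'x) category_data_scheme" (structure)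
begin

definition monad_module ::
  "('o, 'm, 'y) monad_data_scheme \<Rightarrow> 'o \<Rightarrow> 'm \<Rightarrow> bool" where
  "monad_module T M r \<longleftrightarrow> M \<in> Ob C \<and> r \<in> hom C (fob T M) M \<and>
    r \<cdot> fmor T r = r \<cdot> mu T M \<and> r \<cdot> eta T M = ide C M"

end

record ('o, 'm) bimonad_data = "('o, 'm) monad_data" +
  T2 :: "'o \<Rightarrow> 'o \<Rightarrow> 'm"
  T0 :: 'm

locale bimonad = monoidal_category C + monad C T
  for C :: "('o, 'm, 'x) monoidal_data_scheme" (structure)
    and T :: "('o, 'm, 'y) bimonad_data_scheme" +
  assumes T2_hom: "X \<in> Ob C \<Longrightarrow> Y \<in> Ob C
      \<Longrightarrow> T2 T X Y \<in> hom C (fob T (X \<otimes>\<^sub>o Y)) (fob T X \<otimes>\<^sub>o fob T Y)"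
    and T2_nat: "f \<in> hom C X X' \<Longrightarrow> g \<in> hom C Y Y'
      \<Longrightarrow> T2 T X' Y' \<cdot> fmor T (f \<otimes> g) = (fmor T f \<otimes> fmor T g) \<cdot> T2 T X Y"
    and T0_hom: "T0 T \<in> hom C (fob T \<one>) \<one>"
    and T2_coassoc: "X \<in> Ob C \<Longrightarrow> Y \<in> Ob C \<Longrightarrow> Z \<in> Ob C
      \<Longrightarrow> (ide C (fob T X) \<otimes> T2 T Y Z) \<cdot> T2 T X (Y \<otimes>\<^sub>o Z)
        = (T2 T X Y \<otimes> ide C (fob T Z)) \<cdot> T2 T (X \<otimes>\<^sub>o Y) Z"
    and T0_right: "X \<in> Ob C \<Longrightarrow> (ide C (fob T X) \<otimes> T0 T) \<cdot> T2 T X \<one> = ide C (fob T X)"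
    and T0_left: "X \<in> Ob C \<Longrightarrow> (T0 T \<otimes> ide C (fob T X)) \<cdot> T2 T \<one> X = ide C (fob T X)"
    and T2_mu: "X \<in> Ob C \<Longrightarrow> Y \<in> Ob C
      \<Longrightarrow> T2 T X Y \<cdot> mu T (X \<otimes>\<^sub>o Y)
        = (mu T X \<otimes> mu T Y) \<cdot> T2 T (fob T X) (fob T Y) \<cdot> fmor T (T2 T X Y)"
    and T0_mu: "T0 T \<cdot> mu T \<one> = T0 T \<cdot> fmor T (T0 T)"
    and T2_eta: "X \<in> Ob C \<Longrightarrow> Y \<in> Ob C \<Longrightarrow> T2 T X Y \<cdot> eta T (X \<otimes>\<^sub>o Y) = eta T X \<otimes> eta T Y"
    and T0_eta: "T0 T \<cdot> eta T \<one> = ide C \<one>"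

text \<open>The first two clauses of each antipode say that \<open>s\<close> is a natural family between
  contravariant functors.\<close>

context
  fixes C :: "('o, 'm, 'x) autonomous_data_scheme" (structure)
begin

definition left_antipode ::
  "('o, 'm, 'y) bimonad_data_scheme \<Rightarrow> ('o \<Rightarrow> 'm) \<Rightarrow> bool" where
  "left_antipode T s \<longleftrightarrow>
    (\<forall>X \<in> Ob C. s X \<in> hom C (fob T (ldual C (fob T X))) (ldual C X)) \<and>
    (\<forall>X \<in> Ob C. \<forall>Y \<in> Ob C. \<forall>f \<in> hom C X Y.
      s X \<cdot> fmor T (ldual_mor C (fmor T f)) = ldual_mor C f \<cdot> s Y) \<and>
    (\<forall>X \<in> Ob C.
      T0 T \<cdot> fmor T (evl C X) \<cdot> fmor T (ldual_mor C (eta T X) \<otimes> ide C X)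
        = evl C (fob T X)
          \<cdot> ((s (fob T X) \<cdot> fmor T (ldual_mor C (mu T X))) \<otimes> ide C (fob T X))
          \<cdot> T2 T (ldual C (fob T X)) X) \<and>
    (\<forall>X \<in> Ob C.
      (eta T X \<otimes> ide C (ldual C X)) \<cdot> coevl C X \<cdot> T0 T
        = (mu T X \<otimes> s X) \<cdot> T2 T (fob T X) (ldual C (fob T X)) \<cdot> fmor T (coevl C (fob T X)))"

definition right_antipode ::
  "('o, 'm, 'y) bimonad_data_scheme \<Rightarrow> ('o \<Rightarrow> 'm) \<Rightarrow> bool" where
  "right_antipode T s \<longleftrightarrow>
    (\<forall>X \<in> Ob C. s X \<in> hom C (fob T (rdual C (fob T X))) (rdual C X)) \<and>
    (\<forall>X \<in> Ob C. \<forall>Y \<in> Ob C. \<forall>f \<in> hom C X Y.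
      s X \<cdot> fmor T (rdual_mor C (fmor T f)) = rdual_mor C f \<cdot> s Y) \<and>
    (\<forall>X \<in> Ob C.
      T0 T \<cdot> fmor T (evr C X) \<cdot> fmor T (ide C X \<otimes> rdual_mor C (eta T X))
        = evr C (fob T X)
          \<cdot> (ide C (fob T X) \<otimes> (s (fob T X) \<cdot> fmor T (rdual_mor C (mu T X))))
          \<cdot> T2 T X (rdual C (fob T X))) \<and>
    (\<forall>X \<in> Ob C.
      (ide C (rdual C X) \<otimes> eta T X) \<cdot> coevr C X \<cdot> T0 T
        = (s X \<otimes> mu T X) \<cdot> T2 T (rdual C (fob T X)) (fob T X) \<cdot> fmor T (coevr C (fob T X)))"

end

locale hopf_monad = autonomous_category C + bimonad C T
  for C :: "('o, 'm, 'x) autonomous_data_scheme" (structure)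
    and T :: "('o, 'm, 'y) bimonad_data_scheme" +
  assumes ex_left_antipode: "\<exists>s. left_antipode C T s"
    and ex_right_antipode: "\<exists>s. right_antipode C T s"


section \<open>Hopf modules and coinvariants\<close>

text \<open>Comodules are over the coalgebra \<open>(T \<one>, T2 \<one> \<one>, T0)\<close>.\<close>

context
  fixes C :: "('o, 'm, 'x) monoidal_data_scheme" (structure)
begin

definition right_comodule ::
  "('o, 'm, 'y) bimonad_data_scheme \<Rightarrow> 'o \<Rightarrow> 'm \<Rightarrow> bool" where
  "right_comodule T M \<rho> \<longleftrightarrow> M \<in> Ob C \<and> \<rho> \<in> hom C M (M \<otimes>\<^sub>o fob T \<one>) \<and>
    (\<rho> \<otimes> ide C (fob T \<one>)) \<cdot> \<rho> = (ide C M \<otimes> T2 T \<one> \<one>) \<cdot> \<rho> \<and>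
    (ide C M \<otimes> T0 T) \<cdot> \<rho> = ide C M"

definition left_comodule ::
  "('o, 'm, 'y) bimonad_data_scheme \<Rightarrow> 'o \<Rightarrow> 'm \<Rightarrow> bool" where
  "left_comodule T M \<rho> \<longleftrightarrow> M \<in> Ob C \<and> \<rho> \<in> hom C M (fob T \<one> \<otimes>\<^sub>o M) \<and>
    (ide C (fob T \<one>) \<otimes> \<rho>) \<cdot> \<rho> = (T2 T \<one> \<one> \<otimes> ide C M) \<cdot> \<rho> \<and>
    (T0 T \<otimes> ide C M) \<cdot> \<rho> = ide C M"

end

context
  fixes C :: "('o, 'm, 'x) monoidal_data_scheme" (structure)
begin

definition right_hopf_module ::
  "('o, 'm, 'y) bimonad_data_scheme \<Rightarrow> 'o \<Rightarrow> 'm \<Rightarrow> 'm \<Rightarrow> bool" where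
  "right_hopf_module T M r \<rho> \<longleftrightarrow> monad_module C T M r \<and> right_comodule C T M \<rho> \<and>
    \<rho> \<cdot> r = (r \<otimes> mu T \<one>) \<cdot> T2 T M (fob T \<one>) \<cdot> fmor T \<rho>"

definition left_hopf_module ::
  "('o, 'm, 'y) bimonad_data_scheme \<Rightarrow> 'o \<Rightarrow> 'm \<Rightarrow> 'm \<Rightarrow> bool" where
  "left_hopf_module T M r \<rho> \<longleftrightarrow> monad_module C T M r \<and> left_comodule C T M \<rho> \<and>
    \<rho> \<cdot> r = (mu T \<one> \<otimes> r) \<cdot> T2 T (fob T \<one>) M \<cdot> fmor T \<rho>"

end

context
  fixes C :: "('o, 'm, 'x) monoidal_data_scheme" (structure)
begin

text \<open>Coinvariants are determined up to isomorphism, so preservation is asked of one choice of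
  the equalizer.\<close>

definition right_hopf_modules_admit_preserved_coinvariants ::
  "('o, 'm, 'y) bimonad_data_scheme \<Rightarrow> bool" where
  "right_hopf_modules_admit_preserved_coinvariants T \<longleftrightarrow>
    (\<forall>M r \<rho>. right_hopf_module C T M r \<rho> \<longrightarrow>
      (\<exists>E i. equalizer C E i \<rho> (ide C M \<otimes> eta T \<one>) \<and>
        equalizer C (fob T E) (fmor T i) (fmor T \<rho>) (fmor T (ide C M \<otimes> eta T \<one>))))"

definition left_hopf_modules_admit_preserved_coinvariants ::
  "('o, 'm, 'y) bimonad_data_scheme \<Rightarrow> bool" where
  "left_hopf_modules_admit_preserved_coinvariants T \<longleftrightarrow>
    (\<forall>M r \<rho>. left_hopf_module C T M r \<rho> \<longrightarrow>
      (\<exists>E i. equalizer C E i \<rho> (eta T \<one> \<otimes> ide C M) \<and>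
        equalizer C (fob T E) (fmor T i) (fmor T \<rho>) (fmor T (eta T \<one> \<otimes> ide C M))))"

end


section \<open>Integrals\<close>

context
  fixes C :: "('o, 'm, 'x) monoidal_data_scheme" (structure)
begin

definition left_integral ::
  "('o, 'm, 'y) bimonad_data_scheme
    \<Rightarrow> ('o, 'm, 'z) endofunctor_data_scheme \<Rightarrow> ('o \<Rightarrow> 'm) \<Rightarrow> bool" where
  "left_integral T K c \<longleftrightarrow> endofunctor C K \<and> nat_trans C T K c \<and>
    (\<forall>X \<in> Ob C. (ide C (fob T \<one>) \<otimes> c X) \<cdot> T2 T \<one> X = eta T \<one> \<otimes> c X)"

definition right_integral ::
  "('o, 'm, 'y) bimonad_data_scheme
    \<Rightarrow> ('o, 'm, 'z) endofunctor_data_scheme \<Rightarrow> ('o \<Rightarrow> 'm) \<Rightarrow> bool" where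
  "right_integral T K c \<longleftrightarrow> endofunctor C K \<and> nat_trans C T K c \<and>
    (\<forall>X \<in> Ob C. (c X \<otimes> ide C (fob T \<one>)) \<cdot> T2 T X \<one> = c X \<otimes> eta T \<one>)"

end

text \<open>\<open>factors_uniquely C I l K c\<close>: there is a unique natural transformation \<open>f : I \<rightarrow> K\<close> with
  \<open>c = f l\<close>, where transformations are compared on the objects of \<open>C\<close>.\<close>

context
  fixes C :: "('o, 'm, 'x) category_data_scheme" (structure)
begin

definition factors_uniquely ::
  "('o, 'm, 'y) endofunctor_data_scheme \<Rightarrow> ('o \<Rightarrow> 'm) \<Rightarrow> ('o, 'm, 'z) endofunctor_data_scheme \<Rightarrow> ('o \<Rightarrow> 'm) \<Rightarrow> bool" where
  "factors_uniquely I l K c \<longleftrightarrow>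
    (\<exists>f. nat_trans C I K f \<and> (\<forall>X \<in> Ob C. c X = f X \<cdot> l X) \<and>
      (\<forall>g. nat_trans C I K g \<and> (\<forall>X \<in> Ob C. c X = g X \<cdot> l X) \<longrightarrow> (\<forall>X \<in> Ob C. g X = f X)))"

end

definition universal_left_integral ::
  "('o, 'm, 'x) monoidal_data_scheme \<Rightarrow> ('o, 'm, 'y) bimonad_data_scheme
    \<Rightarrow> ('o, 'm, 'z) endofunctor_data_scheme \<Rightarrow> ('o \<Rightarrow> 'm) \<Rightarrow> bool" where
  "universal_left_integral C T I l \<longleftrightarrow> left_integral C T I l \<and>
    (\<forall>(K :: ('o, 'm) endofunctor_data) c. left_integral C T K c \<longrightarrow> factors_uniquely C I l K c)"

definition universal_right_integral ::
  "('o, 'm, 'x) monoidal_data_scheme \<Rightarrow> ('o, 'm, 'y) bimonad_data_scheme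
    \<Rightarrow> ('o, 'm, 'z) endofunctor_data_scheme \<Rightarrow> ('o \<Rightarrow> 'm) \<Rightarrow> bool" where
  "universal_right_integral C T I l \<longleftrightarrow> right_integral C T I l \<and>
    (\<forall>(K :: ('o, 'm) endofunctor_data) c. right_integral C T K c \<longrightarrow> factors_uniquely C I l K c)"

end

theory Submission
  imports Defs
begin

text \<open>
  By duality, a left integral \<open>T X \<rightarrow> W\<close> is the same as a coinvariant map from the right dual of \<open>W\<close>
  into the right Hopf module dual to the free left Hopf module \<open>T X\<close>; so its coinvariants \<open>E X\<close> give
  the universal left integral, with value \<open>I\<^sub>l X\<close> the left dual of \<open>E X\<close>. The antipode makes the
  operators \<open>T (M \<otimes> Y) \<rightarrow> M \<otimes> T Y\<close> invertible, and this yields the decomposition of Hopf modules: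
  \<open>T (E X)\<close> is isomorphic, as a Hopf module, to the right dual of \<open>T X\<close>. As \<open>T\<close> is conservative, the
  coinvariants of the free Hopf module \<open>T X\<close> are \<open>X\<close> itself. Combining the two, the universal right
  integral on \<open>E X\<close> takes its values in the right dual of \<open>X\<close>, that is, \<open>I\<^sub>r\<close> undoes \<open>I\<^sub>l\<close> up to duality.
  Reversing the tensor product exchanges left and right.
\<close>

section \<open>Calculus in strict monoidal categories\<close>

text \<open>The obstacle is that linearity of a pairing involves the actions \<open>r\<close> and
  \<open>q\<close> only jointly, in \<open>r \<otimes> q \<cdot> \<tau> M N\<close>, where \<tau>
  need not be cancellable. This composite equals
  \<open>\<langle>M\<rangle> \<otimes> q \<cdot> fuse r M N\<close>, and the operator
  \<open>fuse r M N\<close> is invertible; so identities for \<open>q\<close> alone can be read off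
  after pairing with \<open>M\<close>. The two kinds of Hopf modules cooperate in each comparison:
  coinvariants of right Hopf modules produce the left integrals, and the coinvariants of the free
  left Hopf modules identify the target of the resulting right integral. \<open>I\<^sub>l\<close>
  and \<open>I\<^sub>r\<close> are determined only up to isomorphism, and their quasi-inverses apply
  duals before and after a functor. Duality is therefore expressed by arbitrary dual pairs and by
  mates between them, which avoids canonical isomorphisms with double duals. The left antipode
  enters as the right antipode of the reversed monad.\<close>

text \<open>The rules \<open>interchange_simps\<close> merge tensor products and fold identities of tensor products, while
  \<open>regroup_simps\<close> and the whiskering lemmas below undo this: used together with the former they loop.\<close>

named_theorems typing
named_theorems interchange_simps
named_theorems regroup_simps

context category
begin

abbreviation ide_brackets ("\<langle>_\<rangle>") where "\<langle>X\<rangle> \<equiv> ide C X"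

lemma hom_iff [typing]: "f \<in> hom C X Y \<longleftrightarrow> f \<in> Ar C \<and> Dom C f = X \<and> Cod C f = Y"
  by (simp add: hom_def)

lemma cmp_typ [typing]:
  assumes "f \<in> Ar C" "g \<in> Ar C" "Dom C g = Cod C f"
  shows "g \<cdot> f \<in> Ar C" "Dom C (g \<cdot> f) = Dom C f" "Cod C (g \<cdot> f) = Cod C g"
  using cmp_hom[of f "Dom C f" "Cod C f" g "Cod C g"] assms by (auto simp: hom_def)

lemma ide_typ [typing]:
  assumes "X \<in> Ob C"
  shows "ide C X \<in> Ar C" "Dom C (ide C X) = X" "Cod C (ide C X) = X"
  using ide_hom[OF assms] by (auto simp: hom_def)

lemmas [typing] = Dom_Ob Cod_Ob

lemma cmp_ide [interchange_simps]: "f \<in> Ar C \<Longrightarrow> Dom C f = X \<Longrightarrow> f \<cdot> ide C X = f"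
  using ide_right[of f X "Cod C f"] by (simp add: hom_def)

lemma ide_cmp [interchange_simps]: "f \<in> Ar C \<Longrightarrow> Cod C f = X \<Longrightarrow> ide C X \<cdot> f = f"
  using ide_left[of f "Dom C f" X] by (simp add: hom_def)

lemma cmp_cmp [interchange_simps]:
  "f \<in> Ar C \<Longrightarrow> g \<in> Ar C \<Longrightarrow> h \<in> Ar C \<Longrightarrow> Dom C g = Cod C f \<Longrightarrow> Dom C h = Cod C g
    \<Longrightarrow> (h \<cdot> g) \<cdot> f = h \<cdot> g \<cdot> f"
  using cmp_assoc[of f "Dom C f" "Cod C f" g "Cod C g" h "Cod C h"] by (simp add: hom_def)

lemma rewrite_head:
  "g \<cdot> f = k \<Longrightarrow> f \<in> Ar C \<Longrightarrow> g \<in> Ar C \<Longrightarrow> Dom C g = Cod C f \<Longrightarrow> x \<in> Ar C \<Longrightarrow> Cod C x = Dom C f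
    \<Longrightarrow> g \<cdot> f \<cdot> x = k \<cdot> x"
  by (metis cmp_cmp)

end

context monoidal_category
begin

lemmas [typing] = unit_Ob tensor_Ob tensor_ob_assoc unit_ob_left unit_ob_right

lemma tensor_typ [typing]:
  assumes "f \<in> Ar C" "g \<in> Ar C"
  shows "f \<otimes> g \<in> Ar C" "Dom C (f \<otimes> g) = Dom C f \<otimes>\<^sub>o Dom C g" "Cod C (f \<otimes> g) = Cod C f \<otimes>\<^sub>o Cod C g"
  using tensor_hom[of f "Dom C f" "Cod C f" g "Dom C g" "Cod C g"] assms by (auto simp: hom_def)

lemma cmp_tensor [interchange_simps]:
  assumes "f \<in> Ar C" "g \<in> Ar C" "f' \<in> Ar C" "g' \<in> Ar C" "Dom C f' = Cod C f" "Dom C g' = Cod C g"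
  shows "(f' \<otimes> g') \<cdot> (f \<otimes> g) = (f' \<cdot> f) \<otimes> (g' \<cdot> g)"
  using interchange[of f "Dom C f" "Cod C f" f' "Cod C f'" g "Dom C g" "Cod C g" g' "Cod C g'"] assms
  by (simp add: hom_def)

lemma cmp_tensor_cmp [interchange_simps]:
  assumes "f \<in> Ar C" "g \<in> Ar C" "f' \<in> Ar C" "g' \<in> Ar C" "Dom C f' = Cod C f" "Dom C g' = Cod C g"
    "x \<in> Ar C" "Cod C x = Dom C f \<otimes>\<^sub>o Dom C g"
  shows "(f' \<otimes> g') \<cdot> (f \<otimes> g) \<cdot> x = ((f' \<cdot> f) \<otimes> (g' \<cdot> g)) \<cdot> x"
  using assms by (simp add: cmp_tensor[symmetric] cmp_cmp typing)

lemmas [interchange_simps] = unit_left unit_right tensor_ide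

lemmas [regroup_simps] = tensor_assoc unit_left unit_right

lemma ide_tensor [regroup_simps]: "X \<in> Ob C \<Longrightarrow> Y \<in> Ob C \<Longrightarrow> ide C (X \<otimes>\<^sub>o Y) = ide C X \<otimes> ide C Y"
  by (simp add: tensor_ide)

lemma whisker_left:
  assumes "X \<in> Ob C" "f \<in> Ar C" "g \<in> Ar C" "Dom C g = Cod C f"
  shows "\<langle>X\<rangle> \<otimes> (g \<cdot> f) = \<langle>X\<rangle> \<otimes> g \<cdot> \<langle>X\<rangle> \<otimes> f"
  using assms by (simp add: typing interchange_simps)

lemma whisker_right:
  assumes "X \<in> Ob C" "f \<in> Ar C" "g \<in> Ar C" "Dom C g = Cod C f"
  shows "(g \<cdot> f) \<otimes> \<langle>X\<rangle> = g \<otimes> \<langle>X\<rangle> \<cdot> f \<otimes> \<langle>X\<rangle>"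
  using assms by (simp add: typing interchange_simps)

text \<open>Interchange for a morphism beside a counit or unit, with the strict unit law already
  applied. The unit rules erase the factor \<open>\<langle>\<one>\<rangle>\<close> that interchange
  acts on, so each sliding move is proved with them switched off.\<close>

lemma slide_counit:
  assumes "e \<in> hom C P \<one>" "k \<in> hom C X Y"
  shows "e \<otimes> \<langle>Y\<rangle> \<cdot> \<langle>P\<rangle> \<otimes> k = k \<cdot> e \<otimes> \<langle>X\<rangle>"
proof -
  have "e \<otimes> \<langle>Y\<rangle> \<cdot> \<langle>P\<rangle> \<otimes> k = \<langle>\<one>\<rangle> \<otimes> k \<cdot> e \<otimes> \<langle>X\<rangle>"
    using assms Dom_Ob Cod_Ob by (auto simp: typing interchange_simps simp del: unit_left)
  then show ?thesis using assms by (simp add: typing unit_left)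
qed

lemma slide_counit':
  assumes "e \<in> hom C P \<one>" "k \<in> hom C X Y"
  shows "\<langle>Y\<rangle> \<otimes> e \<cdot> k \<otimes> \<langle>P\<rangle> = k \<cdot> \<langle>X\<rangle> \<otimes> e"
proof -
  have "\<langle>Y\<rangle> \<otimes> e \<cdot> k \<otimes> \<langle>P\<rangle> = k \<otimes> \<langle>\<one>\<rangle> \<cdot> \<langle>X\<rangle> \<otimes> e"
    using assms Dom_Ob Cod_Ob by (auto simp: typing interchange_simps simp del: unit_right)
  then show ?thesis using assms by (simp add: typing unit_right)
qed

lemma slide_unit:
  assumes "c \<in> hom C \<one> P" "k \<in> hom C X Y"
  shows "c \<otimes> \<langle>Y\<rangle> \<cdot> k = \<langle>P\<rangle> \<otimes> k \<cdot> c \<otimes> \<langle>X\<rangle>"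
proof -
  have "c \<otimes> \<langle>Y\<rangle> \<cdot> \<langle>\<one>\<rangle> \<otimes> k = \<langle>P\<rangle> \<otimes> k \<cdot> c \<otimes> \<langle>X\<rangle>"
    using assms Dom_Ob Cod_Ob by (auto simp: typing interchange_simps simp del: unit_left)
  then show ?thesis using assms by (simp add: typing unit_left)
qed

lemma slide_unit':
  assumes "c \<in> hom C \<one> P" "k \<in> hom C X Y"
  shows "\<langle>Y\<rangle> \<otimes> c \<cdot> k = k \<otimes> \<langle>P\<rangle> \<cdot> \<langle>X\<rangle> \<otimes> c"
proof -
  have "\<langle>Y\<rangle> \<otimes> c \<cdot> k \<otimes> \<langle>\<one>\<rangle> = k \<otimes> \<langle>P\<rangle> \<cdot> \<langle>X\<rangle> \<otimes> c"
    using assms Dom_Ob Cod_Ob by (auto simp: typing interchange_simps simp del: unit_right)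
  then show ?thesis using assms by (simp add: typing unit_right)
qed

section \<open>Dual pairs and mates\<close>

text \<open>Here \<open>L\<close> is left dual to \<open>R\<close> and \<open>R\<close> is right
  dual to \<open>L\<close>. Stating this for arbitrary data instead of the chosen duals covers both
  kinds of duals at once, and reversing the tensor product merely exchanges \<open>L\<close> and
  \<open>R\<close>.\<close>

definition dual_pair :: "'o \<Rightarrow> 'o \<Rightarrow> 'm \<Rightarrow> 'm \<Rightarrow> bool" where
  "dual_pair L R e c \<longleftrightarrow> L \<in> Ob C \<and> R \<in> Ob C \<and> e \<in> hom C (L \<otimes>\<^sub>o R) \<one> \<and> c \<in> hom C \<one> (R \<otimes>\<^sub>o L) \<and>
    (e \<otimes> ide C L) \<cdot> (ide C L \<otimes> c) = ide C L \<and> (ide C R \<otimes> e) \<cdot> (c \<otimes> ide C R) = ide C R"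

lemma dual_pair_typ:
  assumes "dual_pair L R e c"
  shows "L \<in> Ob C" "R \<in> Ob C" "e \<in> Ar C" "Dom C e = L \<otimes>\<^sub>o R" "Cod C e = \<one>"
    "c \<in> Ar C" "Dom C c = \<one>" "Cod C c = R \<otimes>\<^sub>o L"
  using assms by (auto simp: dual_pair_def hom_def)

text \<open>This lemma and the next three are the two halves of the bijections between morphisms
  \<open>L \<otimes> Z\<close> to \<open>B\<close> and \<open>Z\<close> to
  \<open>R \<otimes> B\<close>, and between \<open>Z \<otimes> R\<close> to \<open>B\<close> and
  \<open>Z\<close> to \<open>B \<otimes> L\<close>. In each case the given morphism slides past the
  pairing and one zigzag remains.\<close>

lemma pairing_transpose_right:
  assumes d: "dual_pair L R e c" and k: "k \<in> hom C (L \<otimes>\<^sub>o Z) B" and ob: "Z \<in> Ob C"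
  shows "e \<otimes> \<langle>B\<rangle> \<cdot> \<langle>L\<rangle> \<otimes> (\<langle>R\<rangle> \<otimes> k \<cdot> c \<otimes> \<langle>Z\<rangle>) = k"
proof -
  note [simp] = dual_pair_typ[OF d] ob typing
  have [simp]: "k \<in> Ar C" "Dom C k = L \<otimes>\<^sub>o Z" "Cod C k = B" using k by auto
  then have [simp]: "B \<in> Ob C" using Cod_Ob by blast
  have "e \<otimes> \<langle>B\<rangle> \<cdot> \<langle>L\<rangle> \<otimes> (\<langle>R\<rangle> \<otimes> k \<cdot> c \<otimes> \<langle>Z\<rangle>) = (e \<otimes> \<langle>B\<rangle> \<cdot> \<langle>L \<otimes>\<^sub>o R\<rangle> \<otimes> k) \<cdot> \<langle>L\<rangle> \<otimes> c \<otimes> \<langle>Z\<rangle>"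
    by (simp add: whisker_left regroup_simps cmp_cmp)
  also have "e \<otimes> \<langle>B\<rangle> \<cdot> \<langle>L \<otimes>\<^sub>o R\<rangle> \<otimes> k = k \<cdot> e \<otimes> \<langle>L \<otimes>\<^sub>o Z\<rangle>"
    by (rule slide_counit) (use k in auto)
  also have "(k \<cdot> e \<otimes> \<langle>L \<otimes>\<^sub>o Z\<rangle>) \<cdot> \<langle>L\<rangle> \<otimes> c \<otimes> \<langle>Z\<rangle> = k \<cdot> (e \<otimes> \<langle>L\<rangle> \<cdot> \<langle>L\<rangle> \<otimes> c) \<otimes> \<langle>Z\<rangle>"
    by (simp add: whisker_right regroup_simps cmp_cmp)
  also have "\<dots> = k"
    using d by (simp add: dual_pair_def interchange_simps)
  finally show ?thesis .
qed

lemma pairing_transpose_left: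
  assumes d: "dual_pair L R e c" and k: "k \<in> hom C (Z \<otimes>\<^sub>o R) B" and ob: "Z \<in> Ob C"
  shows "\<langle>B\<rangle> \<otimes> e \<cdot> (k \<otimes> \<langle>L\<rangle> \<cdot> \<langle>Z\<rangle> \<otimes> c) \<otimes> \<langle>R\<rangle> = k"
proof -
  note [simp] = dual_pair_typ[OF d] ob typing
  have [simp]: "k \<in> Ar C" "Dom C k = Z \<otimes>\<^sub>o R" "Cod C k = B" using k by auto
  then have [simp]: "B \<in> Ob C" using Cod_Ob by blast
  have "\<langle>B\<rangle> \<otimes> e \<cdot> (k \<otimes> \<langle>L\<rangle> \<cdot> \<langle>Z\<rangle> \<otimes> c) \<otimes> \<langle>R\<rangle> = (\<langle>B\<rangle> \<otimes> e \<cdot> k \<otimes> \<langle>L \<otimes>\<^sub>o R\<rangle>) \<cdot> \<langle>Z\<rangle> \<otimes> c \<otimes> \<langle>R\<rangle>"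
    by (simp add: whisker_right regroup_simps cmp_cmp)
  also have "\<langle>B\<rangle> \<otimes> e \<cdot> k \<otimes> \<langle>L \<otimes>\<^sub>o R\<rangle> = k \<cdot> \<langle>Z \<otimes>\<^sub>o R\<rangle> \<otimes> e"
    by (rule slide_counit') (use k in auto)
  also have "(k \<cdot> \<langle>Z \<otimes>\<^sub>o R\<rangle> \<otimes> e) \<cdot> \<langle>Z\<rangle> \<otimes> c \<otimes> \<langle>R\<rangle> = k \<cdot> \<langle>Z\<rangle> \<otimes> (\<langle>R\<rangle> \<otimes> e \<cdot> c \<otimes> \<langle>R\<rangle>)"
    by (simp add: whisker_left regroup_simps cmp_cmp)
  also have "\<dots> = k"
    using d by (simp add: dual_pair_def interchange_simps)
  finally show ?thesis .
qed

lemma transpose_pairing_right: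
  assumes d: "dual_pair L R e c" and f: "f \<in> hom C Z (R \<otimes>\<^sub>o B)" and ob: "B \<in> Ob C"
  shows "\<langle>R\<rangle> \<otimes> (e \<otimes> \<langle>B\<rangle> \<cdot> \<langle>L\<rangle> \<otimes> f) \<cdot> c \<otimes> \<langle>Z\<rangle> = f"
proof -
  note [simp] = dual_pair_typ[OF d] ob typing
  have [simp]: "f \<in> Ar C" "Dom C f = Z" "Cod C f = R \<otimes>\<^sub>o B" using f by auto
  then have [simp]: "Z \<in> Ob C" using Dom_Ob by blast
  have "\<langle>R\<rangle> \<otimes> (e \<otimes> \<langle>B\<rangle> \<cdot> \<langle>L\<rangle> \<otimes> f) \<cdot> c \<otimes> \<langle>Z\<rangle> = \<langle>R\<rangle> \<otimes> e \<otimes> \<langle>B\<rangle> \<cdot> \<langle>R \<otimes>\<^sub>o L\<rangle> \<otimes> f \<cdot> c \<otimes> \<langle>Z\<rangle>"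
    by (simp add: whisker_left regroup_simps cmp_cmp)
  also have "\<langle>R \<otimes>\<^sub>o L\<rangle> \<otimes> f \<cdot> c \<otimes> \<langle>Z\<rangle> = c \<otimes> \<langle>R \<otimes>\<^sub>o B\<rangle> \<cdot> f"
    by (rule slide_unit[symmetric]) (use f in auto)
  also have "\<langle>R\<rangle> \<otimes> e \<otimes> \<langle>B\<rangle> \<cdot> c \<otimes> \<langle>R \<otimes>\<^sub>o B\<rangle> \<cdot> f = (\<langle>R\<rangle> \<otimes> e \<cdot> c \<otimes> \<langle>R\<rangle>) \<otimes> \<langle>B\<rangle> \<cdot> f"
    by (simp add: whisker_right regroup_simps cmp_cmp)
  also have "\<dots> = f"
    using d by (simp add: dual_pair_def interchange_simps)
  finally show ?thesis .
qed

lemma transpose_pairing_left: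
  assumes d: "dual_pair L R e c" and f: "f \<in> hom C Z (B \<otimes>\<^sub>o L)" and ob: "B \<in> Ob C"
  shows "(\<langle>B\<rangle> \<otimes> e \<cdot> f \<otimes> \<langle>R\<rangle>) \<otimes> \<langle>L\<rangle> \<cdot> \<langle>Z\<rangle> \<otimes> c = f"
proof -
  note [simp] = dual_pair_typ[OF d] ob typing
  have [simp]: "f \<in> Ar C" "Dom C f = Z" "Cod C f = B \<otimes>\<^sub>o L" using f by auto
  then have [simp]: "Z \<in> Ob C" using Dom_Ob by blast
  have "(\<langle>B\<rangle> \<otimes> e \<cdot> f \<otimes> \<langle>R\<rangle>) \<otimes> \<langle>L\<rangle> \<cdot> \<langle>Z\<rangle> \<otimes> c = \<langle>B\<rangle> \<otimes> e \<otimes> \<langle>L\<rangle> \<cdot> f \<otimes> \<langle>R \<otimes>\<^sub>o L\<rangle> \<cdot> \<langle>Z\<rangle> \<otimes> c"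
    by (simp add: whisker_right regroup_simps cmp_cmp)
  also have "f \<otimes> \<langle>R \<otimes>\<^sub>o L\<rangle> \<cdot> \<langle>Z\<rangle> \<otimes> c = \<langle>B \<otimes>\<^sub>o L\<rangle> \<otimes> c \<cdot> f"
    by (rule slide_unit'[symmetric]) (use f in auto)
  also have "\<langle>B\<rangle> \<otimes> e \<otimes> \<langle>L\<rangle> \<cdot> \<langle>B \<otimes>\<^sub>o L\<rangle> \<otimes> c \<cdot> f = \<langle>B\<rangle> \<otimes> (e \<otimes> \<langle>L\<rangle> \<cdot> \<langle>L\<rangle> \<otimes> c) \<cdot> f"
    by (simp add: whisker_left regroup_simps cmp_cmp)
  also have "\<dots> = f"
    using d by (simp add: dual_pair_def interchange_simps)
  finally show ?thesis .
qed

lemma pairing_inject_right: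
  assumes "dual_pair L R e c" "f \<in> hom C Z (R \<otimes>\<^sub>o B)" "g \<in> hom C Z (R \<otimes>\<^sub>o B)" "B \<in> Ob C"
    and "e \<otimes> \<langle>B\<rangle> \<cdot> \<langle>L\<rangle> \<otimes> f = e \<otimes> \<langle>B\<rangle> \<cdot> \<langle>L\<rangle> \<otimes> g"
  shows "f = g"
  using assms transpose_pairing_right by metis

lemma pairing_inject_left:
  assumes "dual_pair L R e c" "f \<in> hom C Z (B \<otimes>\<^sub>o L)" "g \<in> hom C Z (B \<otimes>\<^sub>o L)" "B \<in> Ob C"
    and "\<langle>B\<rangle> \<otimes> e \<cdot> f \<otimes> \<langle>R\<rangle> = \<langle>B\<rangle> \<otimes> e \<cdot> g \<otimes> \<langle>R\<rangle>"
  shows "f = g"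
  using assms transpose_pairing_left by metis

lemma pairing_surject_right:
  assumes d: "dual_pair L R e c" and k: "k \<in> hom C (L \<otimes>\<^sub>o Z) B" and ob: "Z \<in> Ob C"
  obtains f where "f \<in> hom C Z (R \<otimes>\<^sub>o B)" "e \<otimes> \<langle>B\<rangle> \<cdot> \<langle>L\<rangle> \<otimes> f = k"
proof
  show "e \<otimes> \<langle>B\<rangle> \<cdot> \<langle>L\<rangle> \<otimes> (\<langle>R\<rangle> \<otimes> k \<cdot> c \<otimes> \<langle>Z\<rangle>) = k" by (rule pairing_transpose_right[OF assms])
  show "\<langle>R\<rangle> \<otimes> k \<cdot> c \<otimes> \<langle>Z\<rangle> \<in> hom C Z (R \<otimes>\<^sub>o B)"
    using dual_pair_typ[OF d] k ob by (simp add: typing)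
qed

lemma pairing_surject_left:
  assumes d: "dual_pair L R e c" and k: "k \<in> hom C (Z \<otimes>\<^sub>o R) B" and ob: "Z \<in> Ob C"
  obtains f where "f \<in> hom C Z (B \<otimes>\<^sub>o L)" "\<langle>B\<rangle> \<otimes> e \<cdot> f \<otimes> \<langle>R\<rangle> = k"
proof
  show "\<langle>B\<rangle> \<otimes> e \<cdot> (k \<otimes> \<langle>L\<rangle> \<cdot> \<langle>Z\<rangle> \<otimes> c) \<otimes> \<langle>R\<rangle> = k" by (rule pairing_transpose_left[OF assms])
  show "k \<otimes> \<langle>L\<rangle> \<cdot> \<langle>Z\<rangle> \<otimes> c \<in> hom C Z (B \<otimes>\<^sub>o L)"
    using dual_pair_typ[OF d] k ob by (simp add: typing)
qed

lemma pairing_eq_right: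
  assumes "dual_pair L R e c" "f \<in> hom C Z R" "g \<in> hom C Z R" "e \<cdot> \<langle>L\<rangle> \<otimes> f = e \<cdot> \<langle>L\<rangle> \<otimes> g"
  shows "f = g"
  using pairing_inject_right[OF assms(1), of f Z \<one> g] assms dual_pair_typ[OF assms(1)]
  by (simp add: typing interchange_simps)

lemma pairing_eq_left:
  assumes "dual_pair L R e c" "f \<in> hom C Z L" "g \<in> hom C Z L" "e \<cdot> f \<otimes> \<langle>R\<rangle> = e \<cdot> g \<otimes> \<langle>R\<rangle>"
  shows "f = g"
  using pairing_inject_left[OF assms(1), of f Z \<one> g] assms dual_pair_typ[OF assms(1)]
  by (simp add: typing interchange_simps)

section \<open>Mates: morphisms corresponding to each other under two pairings\<close>

lemma mate_right_exists:
  assumes "dual_pair L R e c" "dual_pair L' R' e' c'" "f \<in> hom C L L'"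
  obtains g where "g \<in> hom C R' R" "e \<cdot> \<langle>L\<rangle> \<otimes> g = e' \<cdot> f \<otimes> \<langle>R'\<rangle>"
  using pairing_surject_right[OF assms(1), of "e' \<cdot> f \<otimes> \<langle>R'\<rangle>" R' \<one>] assms(3)
    dual_pair_typ[OF assms(1)] dual_pair_typ[OF assms(2)]
  by (simp add: typing interchange_simps) blast

lemma mate_left_exists:
  assumes "dual_pair L R e c" "dual_pair L' R' e' c'" "g \<in> hom C R' R"
  obtains f where "f \<in> hom C L L'" "e' \<cdot> f \<otimes> \<langle>R'\<rangle> = e \<cdot> \<langle>L\<rangle> \<otimes> g"
  using pairing_surject_left[OF assms(2), of "e \<cdot> \<langle>L\<rangle> \<otimes> g" L \<one>] assms(3)
    dual_pair_typ[OF assms(1)] dual_pair_typ[OF assms(2)]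
  by (simp add: typing interchange_simps) blast

text \<open>Under the pairings \<open>f'\<close> is exchanged for \<open>g'\<close> and then
  \<open>f\<close> for \<open>g\<close>, which is why the order of composition is reversed.\<close>

lemma mate_cmp:
  assumes "dual_pair L R e c" "dual_pair L' R' e' c'" "dual_pair L'' R'' e'' c''"
    and "f \<in> hom C L L'" "f' \<in> hom C L' L''" "g \<in> hom C R' R" "g' \<in> hom C R'' R'"
    and m: "e' \<cdot> f \<otimes> \<langle>R'\<rangle> = e \<cdot> \<langle>L\<rangle> \<otimes> g" and m': "e'' \<cdot> f' \<otimes> \<langle>R''\<rangle> = e' \<cdot> \<langle>L'\<rangle> \<otimes> g'"
  shows "e'' \<cdot> (f' \<cdot> f) \<otimes> \<langle>R''\<rangle> = e \<cdot> \<langle>L\<rangle> \<otimes> (g \<cdot> g')"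
proof -
  note [simp] = dual_pair_typ[OF assms(1)] dual_pair_typ[OF assms(2)] dual_pair_typ[OF assms(3)] typing
  note [simp] = assms(4-7)[unfolded hom_iff, THEN conjunct1]
    assms(4-7)[unfolded hom_iff, THEN conjunct2, THEN conjunct1]
    assms(4-7)[unfolded hom_iff, THEN conjunct2, THEN conjunct2]
  have "e'' \<cdot> (f' \<cdot> f) \<otimes> \<langle>R''\<rangle> = (e'' \<cdot> f' \<otimes> \<langle>R''\<rangle>) \<cdot> f \<otimes> \<langle>R''\<rangle>"
    by (simp add: interchange_simps)
  also have "\<dots> = (e' \<cdot> f \<otimes> \<langle>R'\<rangle>) \<cdot> \<langle>L\<rangle> \<otimes> g'"
    unfolding m' by (simp add: interchange_simps)
  also have "\<dots> = e \<cdot> \<langle>L\<rangle> \<otimes> (g \<cdot> g')"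
    unfolding m by (simp add: interchange_simps)
  finally show ?thesis .
qed

end

section \<open>Bimonads, antipodes and the operator \<open>T (M \<otimes> Y) \<rightarrow> M \<otimes> T Y\<close>\<close>

context bimonad
begin

abbreviation T_ob ("\<T>\<^sub>o") where "\<T>\<^sub>o \<equiv> fob T"
abbreviation T_mor ("\<T>") where "\<T> \<equiv> fmor T"
abbreviation T_mu ("\<mu>") where "\<mu> \<equiv> mu T"
abbreviation T_eta ("\<eta>") where "\<eta> \<equiv> eta T"
abbreviation T_two ("\<tau>") where "\<tau> \<equiv> T2 T"
abbreviation T_zero ("\<epsilon>") where "\<epsilon> \<equiv> T0 T"
abbreviation T_unit ("A") where "A \<equiv> fob T \<one>"

lemmas [typing] = fob_Ob

lemma T_typ [typing]:
  assumes "f \<in> Ar C"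
  shows "\<T> f \<in> Ar C" "Dom C (\<T> f) = \<T>\<^sub>o (Dom C f)" "Cod C (\<T> f) = \<T>\<^sub>o (Cod C f)"
  using fmor_hom[of f "Dom C f" "Cod C f"] assms by (auto simp: hom_def)

lemma mu_typ [typing]:
  assumes "X \<in> Ob C"
  shows "\<mu> X \<in> Ar C" "Dom C (\<mu> X) = \<T>\<^sub>o (\<T>\<^sub>o X)" "Cod C (\<mu> X) = \<T>\<^sub>o X"
  using mu_nat assms by (auto simp: nat_trans_def comp_functor_def hom_def)

lemma eta_typ [typing]:
  assumes "X \<in> Ob C"
  shows "\<eta> X \<in> Ar C" "Dom C (\<eta> X) = X" "Cod C (\<eta> X) = \<T>\<^sub>o X"
  using eta_nat assms by (auto simp: nat_trans_def id_functor_def hom_def)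

lemma T2_typ [typing]:
  assumes "X \<in> Ob C" "Y \<in> Ob C"
  shows "\<tau> X Y \<in> Ar C" "Dom C (\<tau> X Y) = \<T>\<^sub>o (X \<otimes>\<^sub>o Y)" "Cod C (\<tau> X Y) = \<T>\<^sub>o X \<otimes>\<^sub>o \<T>\<^sub>o Y"
  using T2_hom[OF assms] by (auto simp: hom_def)

lemma T0_typ [typing]: "\<epsilon> \<in> Ar C" "Dom C \<epsilon> = A" "Cod C \<epsilon> = \<one>"
  using T0_hom by (auto simp: hom_def)

named_theorems functor_simps

lemmas [functor_simps] = fmor_ide

lemma T_cmp [functor_simps]: "f \<in> Ar C \<Longrightarrow> g \<in> Ar C \<Longrightarrow> Dom C g = Cod C f \<Longrightarrow> \<T> (g \<cdot> f) = \<T> g \<cdot> \<T> f"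
  using fmor_cmp[of f "Dom C f" "Cod C f" g "Cod C g"] by (simp add: hom_def)

lemma mu_natural: "f \<in> Ar C \<Longrightarrow> Dom C f = X \<Longrightarrow> Cod C f = Y \<Longrightarrow> \<mu> Y \<cdot> \<T> (\<T> f) = \<T> f \<cdot> \<mu> X"
  using mu_nat Dom_Ob[of f] Cod_Ob[of f] by (auto simp: nat_trans_def comp_functor_def hom_def)

lemma eta_natural: "f \<in> Ar C \<Longrightarrow> Dom C f = X \<Longrightarrow> Cod C f = Y \<Longrightarrow> \<eta> Y \<cdot> f = \<T> f \<cdot> \<eta> X"
  using eta_nat Dom_Ob[of f] Cod_Ob[of f] by (auto simp: nat_trans_def id_functor_def hom_def)

lemma T2_natural [functor_simps]:
  "f \<in> Ar C \<Longrightarrow> g \<in> Ar C \<Longrightarrow> Cod C f = X \<Longrightarrow> Cod C g = Y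
    \<Longrightarrow> \<tau> X Y \<cdot> \<T> (f \<otimes> g) = \<T> f \<otimes> \<T> g \<cdot> \<tau> (Dom C f) (Dom C g)"
  using T2_nat[of f "Dom C f" X g "Dom C g" Y] by (simp add: hom_def)

lemma T2_natural_cmp [functor_simps]:
  assumes "f \<in> Ar C" "g \<in> Ar C" "Cod C f = X" "Cod C g = Y"
    and "x \<in> Ar C" "Cod C x = \<T>\<^sub>o (Dom C f \<otimes>\<^sub>o Dom C g)"
  shows "\<tau> X Y \<cdot> \<T> (f \<otimes> g) \<cdot> x = \<T> f \<otimes> \<T> g \<cdot> \<tau> (Dom C f) (Dom C g) \<cdot> x"
proof -
  have ob: "X \<in> Ob C" "Y \<in> Ob C" "Dom C f \<in> Ob C" "Dom C g \<in> Ob C"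
    using assms Dom_Ob Cod_Ob by auto
  have "\<tau> X Y \<cdot> \<T> (f \<otimes> g) \<cdot> x = (\<tau> X Y \<cdot> \<T> (f \<otimes> g)) \<cdot> x"
    using assms ob by (simp add: typing cmp_cmp)
  then show ?thesis
    using assms ob by (simp add: typing cmp_cmp T2_natural)
qed

text \<open>For a free module \<open>M\<close> this is a fusion operator of \<open>T\<close>. Its invertibility for all \<open>T\<close>-modules \<open>M\<close> is
  the only form in which the right antipode is used, apart from the existence of dual modules.\<close>

definition fuse :: "'m \<Rightarrow> 'o \<Rightarrow> 'o \<Rightarrow> 'm" where
  "fuse r M Y = r \<otimes> \<langle>\<T>\<^sub>o Y\<rangle> \<cdot> \<tau> M Y"

lemma fuse_typ [typing]:
  assumes "r \<in> hom C (\<T>\<^sub>o M) M" "M \<in> Ob C" "Y \<in> Ob C"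
  shows "fuse r M Y \<in> Ar C" "Dom C (fuse r M Y) = \<T>\<^sub>o (M \<otimes>\<^sub>o Y)" "Cod C (fuse r M Y) = M \<otimes>\<^sub>o \<T>\<^sub>o Y"
  using assms by (simp_all add: fuse_def typing)

lemma fuse_natural:
  assumes "r \<in> hom C (\<T>\<^sub>o M) M" "M \<in> Ob C" "f \<in> hom C X Y"
  shows "fuse r M Y \<cdot> \<T> (\<langle>M\<rangle> \<otimes> f) = \<langle>M\<rangle> \<otimes> \<T> f \<cdot> fuse r M X"
  using assms Dom_Ob[of f] Cod_Ob[of f]
  by (auto simp: fuse_def typing functor_simps cmp_cmp) (simp add: typing interchange_simps cmp_tensor_cmp)

lemma tensor_cmp_ide:
  assumes "f \<in> Ar C" "g \<in> Ar C"
  shows "f \<otimes> \<langle>Cod C g\<rangle> \<cdot> \<langle>Dom C f\<rangle> \<otimes> g = f \<otimes> g" "\<langle>Cod C f\<rangle> \<otimes> g \<cdot> f \<otimes> \<langle>Dom C g\<rangle> = f \<otimes> g"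
  using assms by (simp_all add: typing interchange_simps)

lemma T2_coassoc':
  assumes "X \<in> Ob C" "Y \<in> Ob C" "Z \<in> Ob C" "x \<in> Ar C" "Cod C x = \<T>\<^sub>o (X \<otimes>\<^sub>o Y \<otimes>\<^sub>o Z)"
  shows "\<langle>\<T>\<^sub>o X\<rangle> \<otimes> \<tau> Y Z \<cdot> \<tau> X (Y \<otimes>\<^sub>o Z) \<cdot> x = \<tau> X Y \<otimes> \<langle>\<T>\<^sub>o Z\<rangle> \<cdot> \<tau> (X \<otimes>\<^sub>o Y) Z \<cdot> x"
  using rewrite_head[OF T2_coassoc[OF assms(1-3)], of x] assms by (simp add: typing cmp_cmp)

text \<open>This is coassociativity of \<tau> with the action applied to the first factor. For
  \<open>Y\<close> and \<open>B\<close> equal to the unit object it says that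
  \<open>fuse r M \<one>\<close> is colinear from the free coaction \<open>\<tau> M \<one>\<close>
  to the cofree coaction \<open>\<langle>M\<rangle> \<otimes> \<tau> \<one> \<one>\<close>.\<close>

lemma fuse_T2:
  assumes "r \<in> hom C (\<T>\<^sub>o M) M" "M \<in> Ob C" "Y \<in> Ob C" "B \<in> Ob C"
  shows "\<langle>M\<rangle> \<otimes> \<tau> Y B \<cdot> fuse r M (Y \<otimes>\<^sub>o B) = fuse r M Y \<otimes> \<langle>\<T>\<^sub>o B\<rangle> \<cdot> \<tau> (M \<otimes>\<^sub>o Y) B"
proof -
  note [simp] = assms typing
  have "\<langle>M\<rangle> \<otimes> \<tau> Y B \<cdot> fuse r M (Y \<otimes>\<^sub>o B) = r \<otimes> \<langle>\<T>\<^sub>o Y \<otimes>\<^sub>o \<T>\<^sub>o B\<rangle> \<cdot> \<langle>\<T>\<^sub>o M\<rangle> \<otimes> \<tau> Y B \<cdot> \<tau> M (Y \<otimes>\<^sub>o B)"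
    using assms(1) by (simp add: fuse_def interchange_simps)
  also have "\<dots> = r \<otimes> \<langle>\<T>\<^sub>o Y \<otimes>\<^sub>o \<T>\<^sub>o B\<rangle> \<cdot> \<tau> M Y \<otimes> \<langle>\<T>\<^sub>o B\<rangle> \<cdot> \<tau> (M \<otimes>\<^sub>o Y) B"
    by (simp add: T2_coassoc)
  also have "\<dots> = fuse r M Y \<otimes> \<langle>\<T>\<^sub>o B\<rangle> \<cdot> \<tau> (M \<otimes>\<^sub>o Y) B"
    using assms(1) by (simp add: fuse_def whisker_right regroup_simps cmp_cmp)
  finally show ?thesis .
qed

lemma fuse_eta:
  assumes "monad_module C T M r" "Y \<in> Ob C"
  shows "fuse r M Y \<cdot> \<eta> (M \<otimes>\<^sub>o Y) = \<langle>M\<rangle> \<otimes> \<eta> Y"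
  using assms by (simp add: monad_module_def fuse_def typing interchange_simps T2_eta)

text \<open>Together with \<open>fuse_eta\<close> this makes the operator a lifting datum for
  tensoring with \<open>M\<close> along the monad. Associativity of the action settles the first
  tensor factor, and the compatibility of \<tau> with \<mu> settles the rest.\<close>

lemma fuse_mu:
  assumes "monad_module C T M r" "Y \<in> Ob C"
  shows "\<langle>M\<rangle> \<otimes> \<mu> Y \<cdot> fuse r M (\<T>\<^sub>o Y) \<cdot> \<T> (fuse r M Y) = fuse r M Y \<cdot> \<mu> (M \<otimes>\<^sub>o Y)"
proof -
  note [simp] = assms(2) typing
  have [simp]: "M \<in> Ob C" "r \<in> Ar C" "Dom C r = \<T>\<^sub>o M" "Cod C r = M" and r: "r \<cdot> \<T> r = r \<cdot> \<mu> M"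
    using assms(1) by (auto simp: monad_module_def)
  have "\<langle>M\<rangle> \<otimes> \<mu> Y \<cdot> fuse r M (\<T>\<^sub>o Y) \<cdot> \<T> (fuse r M Y)
      = r \<otimes> \<mu> Y \<cdot> \<T> r \<otimes> \<langle>\<T>\<^sub>o (\<T>\<^sub>o Y)\<rangle> \<cdot> \<tau> (\<T>\<^sub>o M) (\<T>\<^sub>o Y) \<cdot> \<T> (\<tau> M Y)"
    by (simp add: fuse_def interchange_simps functor_simps)
  also have "\<dots> = r \<otimes> \<langle>\<T>\<^sub>o Y\<rangle> \<cdot> \<mu> M \<otimes> \<mu> Y \<cdot> \<tau> (\<T>\<^sub>o M) (\<T>\<^sub>o Y) \<cdot> \<T> (\<tau> M Y)"
    by (simp add: interchange_simps r)
  also have "\<dots> = fuse r M Y \<cdot> \<mu> (M \<otimes>\<^sub>o Y)"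
    by (simp add: fuse_def cmp_cmp T2_mu)
  finally show ?thesis .
qed

section \<open>Free modules and tensor products of modules\<close>

lemma free_module: "X \<in> Ob C \<Longrightarrow> monad_module C T (\<T>\<^sub>o X) (\<mu> X)"
  by (simp add: monad_module_def typing mu_assoc mu_eta_left)

lemma tensor_module:
  assumes "monad_module C T M r" "monad_module C T N q"
  shows "monad_module C T (M \<otimes>\<^sub>o N) (r \<otimes> q \<cdot> \<tau> M N)"
proof -
  note [simp] = typing
  have [simp]: "M \<in> Ob C" "r \<in> Ar C" "Dom C r = \<T>\<^sub>o M" "Cod C r = M"
      "N \<in> Ob C" "q \<in> Ar C" "Dom C q = \<T>\<^sub>o N" "Cod C q = N"
    and r: "r \<cdot> \<T> r = r \<cdot> \<mu> M" "q \<cdot> \<T> q = q \<cdot> \<mu> N" "r \<cdot> \<eta> M = \<langle>M\<rangle>" "q \<cdot> \<eta> N = \<langle>N\<rangle>"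
    using assms by (auto simp: monad_module_def)
  have "(r \<otimes> q \<cdot> \<tau> M N) \<cdot> \<T> (r \<otimes> q \<cdot> \<tau> M N) = (r \<cdot> \<T> r) \<otimes> (q \<cdot> \<T> q) \<cdot> \<tau> (\<T>\<^sub>o M) (\<T>\<^sub>o N) \<cdot> \<T> (\<tau> M N)"
    by (simp add: interchange_simps functor_simps)
  also have "\<dots> = r \<otimes> q \<cdot> \<mu> M \<otimes> \<mu> N \<cdot> \<tau> (\<T>\<^sub>o M) (\<T>\<^sub>o N) \<cdot> \<T> (\<tau> M N)"
    unfolding r by (simp add: interchange_simps)
  also have "\<dots> = (r \<otimes> q \<cdot> \<tau> M N) \<cdot> \<mu> (M \<otimes>\<^sub>o N)"
    by (simp add: T2_mu cmp_cmp)
  finally show ?thesis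
    by (simp add: monad_module_def cmp_cmp T2_eta r interchange_simps)
qed

text \<open>\<open>D1\<close> and \<open>D2\<close> say that evaluation and coevaluation are linear.
  Tensoring with \<open>M\<close> and with \<open>N\<close> are adjoint, and linearity makes the
  mate of the operator of \<open>N\<close> under this adjunction an inverse of the operator of
  \<open>M\<close>.\<close>

lemma fuse_inverse:
  assumes d: "dual_pair M N e c" and r: "r \<in> hom C (\<T>\<^sub>o M) M" and q: "q \<in> hom C (\<T>\<^sub>o N) N"
    and D1: "e \<cdot> r \<otimes> q \<cdot> \<tau> M N = \<epsilon> \<cdot> \<T> e" and D2: "q \<otimes> r \<cdot> \<tau> N M \<cdot> \<T> c = c \<cdot> \<epsilon>"
    and Y: "Y \<in> Ob C"
  obtains k where "k \<in> hom C (M \<otimes>\<^sub>o \<T>\<^sub>o Y) (\<T>\<^sub>o (M \<otimes>\<^sub>o Y))"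
    "fuse r M Y \<cdot> k = \<langle>M \<otimes>\<^sub>o \<T>\<^sub>o Y\<rangle>" "k \<cdot> fuse r M Y = \<langle>\<T>\<^sub>o (M \<otimes>\<^sub>o Y)\<rangle>"
proof
  note [simp] = dual_pair_typ[OF d] Y typing
  have [simp]: "r \<in> Ar C" "Dom C r = \<T>\<^sub>o M" "Cod C r = M" "q \<in> Ar C" "Dom C q = \<T>\<^sub>o N" "Cod C q = N"
    using r q by auto
  have zz: "e \<otimes> \<langle>M\<rangle> \<cdot> \<langle>M\<rangle> \<otimes> c = \<langle>M\<rangle>" using d by (simp add: dual_pair_def)
  define B where "B = \<T>\<^sub>o (M \<otimes>\<^sub>o Y)"
  have [simp]: "B \<in> Ob C" by (simp add: B_def)
  let ?h = "fuse r M Y"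
  \<comment> \<open>\<open>k'\<close> creates \<open>N \<otimes> M\<close> inside \<open>T\<close>
    by the coevaluation and pulls \<open>N\<close> out; in \<open>k\<close> the outer
    \<open>M\<close> then annihilates this \<open>N\<close>.\<close>
  define k' where "k' = fuse q N (M \<otimes>\<^sub>o Y) \<cdot> \<T> (c \<otimes> \<langle>Y\<rangle>)"
  have k' [simp]: "k' \<in> Ar C" "Dom C k' = \<T>\<^sub>o Y" "Cod C k' = N \<otimes>\<^sub>o B"
    by (simp_all add: k'_def B_def)
  define k where "k = e \<otimes> \<langle>B\<rangle> \<cdot> \<langle>M\<rangle> \<otimes> k'"
  show "k \<in> hom C (M \<otimes>\<^sub>o \<T>\<^sub>o Y) (\<T>\<^sub>o (M \<otimes>\<^sub>o Y))"
    by (simp add: k_def) (simp add: B_def)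
  have hB: "?h \<in> hom C B (M \<otimes>\<^sub>o \<T>\<^sub>o Y)" by (simp add: B_def)
  \<comment> \<open>By \<open>D2\<close> the actions on the newly created
    \<open>N \<otimes> M\<close> collapse to the counit \<epsilon>, which the counit law of \<tau>
    absorbs.\<close>
  have *: "\<langle>N\<rangle> \<otimes> ?h \<cdot> k' = c \<otimes> \<langle>\<T>\<^sub>o Y\<rangle>"
  proof -
    have "\<langle>N\<rangle> \<otimes> ?h \<cdot> k'
        = \<langle>N\<rangle> \<otimes> r \<otimes> \<langle>\<T>\<^sub>o Y\<rangle> \<cdot> (\<langle>N\<rangle> \<otimes> \<tau> M Y \<cdot> fuse q N (M \<otimes>\<^sub>o Y)) \<cdot> \<T> (c \<otimes> \<langle>Y\<rangle>)"
      by (simp add: fuse_def[of r] k'_def whisker_left cmp_cmp)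
    also have "\<dots> = \<langle>N\<rangle> \<otimes> r \<otimes> \<langle>\<T>\<^sub>o Y\<rangle> \<cdot> (fuse q N M \<otimes> \<langle>\<T>\<^sub>o Y\<rangle> \<cdot> \<tau> (N \<otimes>\<^sub>o M) Y) \<cdot> \<T> (c \<otimes> \<langle>Y\<rangle>)"
      by (simp add: fuse_T2)
    also have "\<dots> = (\<langle>N\<rangle> \<otimes> r \<cdot> fuse q N M \<cdot> \<T> c) \<otimes> \<langle>\<T>\<^sub>o Y\<rangle> \<cdot> \<tau> \<one> Y"
      by (simp add: whisker_right regroup_simps cmp_cmp functor_simps)
    also have "\<langle>N\<rangle> \<otimes> r \<cdot> fuse q N M \<cdot> \<T> c = c \<cdot> \<epsilon>"
      unfolding D2[symmetric] by (simp add: fuse_def interchange_simps)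
    also have "(c \<cdot> \<epsilon>) \<otimes> \<langle>\<T>\<^sub>o Y\<rangle> \<cdot> \<tau> \<one> Y = c \<otimes> \<langle>\<T>\<^sub>o Y\<rangle>"
      by (simp add: whisker_right cmp_cmp T0_left cmp_ide)
    finally show ?thesis .
  qed
  have "?h \<cdot> k = (?h \<cdot> e \<otimes> \<langle>B\<rangle>) \<cdot> \<langle>M\<rangle> \<otimes> k'"
    using hB by (simp add: k_def cmp_cmp)
  also have "\<dots> = (e \<otimes> \<langle>M \<otimes>\<^sub>o \<T>\<^sub>o Y\<rangle> \<cdot> \<langle>M \<otimes>\<^sub>o N\<rangle> \<otimes> ?h) \<cdot> \<langle>M\<rangle> \<otimes> k'"
    using slide_counit[OF _ hB, of e "M \<otimes>\<^sub>o N"] by simp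
  also have "\<dots> = e \<otimes> \<langle>M \<otimes>\<^sub>o \<T>\<^sub>o Y\<rangle> \<cdot> \<langle>M\<rangle> \<otimes> (\<langle>N\<rangle> \<otimes> ?h \<cdot> k')"
    using hB by (simp add: whisker_left regroup_simps cmp_cmp)
  also have "\<dots> = \<langle>M \<otimes>\<^sub>o \<T>\<^sub>o Y\<rangle>"
    unfolding * using arg_cong[OF zz, of "\<lambda>x. x \<otimes> \<langle>\<T>\<^sub>o Y\<rangle>"] by (simp add: whisker_right regroup_simps)
  finally show "?h \<cdot> k = \<langle>M \<otimes>\<^sub>o \<T>\<^sub>o Y\<rangle>" .
  have "k \<cdot> ?h = e \<otimes> \<langle>B\<rangle> \<cdot> r \<otimes> k' \<cdot> \<tau> M Y"
    by (simp add: k_def fuse_def interchange_simps)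
  also have "\<dots> = e \<otimes> \<langle>B\<rangle> \<cdot> r \<otimes> q \<otimes> \<langle>B\<rangle> \<cdot> \<langle>\<T>\<^sub>o M\<rangle> \<otimes> \<tau> N (M \<otimes>\<^sub>o Y) \<cdot> \<langle>\<T>\<^sub>o M\<rangle> \<otimes> \<T> (c \<otimes> \<langle>Y\<rangle>) \<cdot> \<tau> M Y"
    by (simp add: k'_def fuse_def interchange_simps B_def)
  also have "\<dots> = e \<otimes> \<langle>B\<rangle> \<cdot> r \<otimes> q \<otimes> \<langle>B\<rangle> \<cdot> \<langle>\<T>\<^sub>o M\<rangle> \<otimes> \<tau> N (M \<otimes>\<^sub>o Y) \<cdot> \<tau> M (N \<otimes>\<^sub>o M \<otimes>\<^sub>o Y) \<cdot> \<T> (\<langle>M\<rangle> \<otimes> c \<otimes> \<langle>Y\<rangle>)"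
    by (simp add: functor_simps)
  \<comment> \<open>Coassociativity regroups the factors so that \<open>r\<close> and
    \<open>q\<close> act on \<open>M \<otimes> N\<close> together, the only form in which
    \<open>D1\<close> applies.\<close>
  also have "\<dots> = e \<otimes> \<langle>B\<rangle> \<cdot> r \<otimes> q \<otimes> \<langle>B\<rangle> \<cdot> \<tau> M N \<otimes> \<langle>B\<rangle> \<cdot> \<tau> (M \<otimes>\<^sub>o N) (M \<otimes>\<^sub>o Y) \<cdot> \<T> (\<langle>M\<rangle> \<otimes> c \<otimes> \<langle>Y\<rangle>)"
    by (simp add: T2_coassoc' B_def)
  also have "\<dots> = (e \<cdot> r \<otimes> q \<cdot> \<tau> M N) \<otimes> \<langle>B\<rangle> \<cdot> \<tau> (M \<otimes>\<^sub>o N) (M \<otimes>\<^sub>o Y) \<cdot> \<T> (\<langle>M\<rangle> \<otimes> c \<otimes> \<langle>Y\<rangle>)"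
    by (simp add: whisker_right regroup_simps cmp_cmp B_def)
  also have "\<dots> = (\<epsilon> \<otimes> \<langle>B\<rangle> \<cdot> \<tau> \<one> (M \<otimes>\<^sub>o Y)) \<cdot> \<T> (e \<otimes> \<langle>M \<otimes>\<^sub>o Y\<rangle>) \<cdot> \<T> (\<langle>M\<rangle> \<otimes> c \<otimes> \<langle>Y\<rangle>)"
    unfolding D1 by (simp add: whisker_right cmp_cmp functor_simps B_def)
  also have "\<epsilon> \<otimes> \<langle>B\<rangle> \<cdot> \<tau> \<one> (M \<otimes>\<^sub>o Y) = \<langle>B\<rangle>"
    by (simp add: T0_left B_def)
  also have "\<langle>B\<rangle> \<cdot> \<T> (e \<otimes> \<langle>M \<otimes>\<^sub>o Y\<rangle>) \<cdot> \<T> (\<langle>M\<rangle> \<otimes> c \<otimes> \<langle>Y\<rangle>)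
      = \<T> (e \<otimes> \<langle>M \<otimes>\<^sub>o Y\<rangle> \<cdot> \<langle>M\<rangle> \<otimes> c \<otimes> \<langle>Y\<rangle>)"
    by (simp add: functor_simps interchange_simps B_def)
  also have "e \<otimes> \<langle>M \<otimes>\<^sub>o Y\<rangle> \<cdot> \<langle>M\<rangle> \<otimes> c \<otimes> \<langle>Y\<rangle> = \<langle>M \<otimes>\<^sub>o Y\<rangle>"
    using arg_cong[OF zz, of "\<lambda>x. x \<otimes> \<langle>Y\<rangle>"] by (simp add: whisker_right regroup_simps)
  finally show "k \<cdot> ?h = \<langle>\<T>\<^sub>o (M \<otimes>\<^sub>o Y)\<rangle>" by (simp add: functor_simps)
qed

end

section \<open>Duals of morphisms and the chosen duals\<close>

context monoidal_category
begin

text \<open>Mates are characterized by evaluations, while the second antipode axiom involves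
  coevaluations. The two sides agree because both have transpose \<open>f\<close> under the pairing
  of \<open>L\<close> and \<open>R\<close>.\<close>

lemma mate_coevaluation:
  assumes d: "dual_pair L R e c" and d': "dual_pair L' R' e' c'"
    and f: "f \<in> hom C L L'" and g: "g \<in> hom C R' R" and m: "e \<cdot> \<langle>L\<rangle> \<otimes> g = e' \<cdot> f \<otimes> \<langle>R'\<rangle>"
  shows "g \<otimes> \<langle>L'\<rangle> \<cdot> c' = \<langle>R\<rangle> \<otimes> f \<cdot> c"
proof (rule pairing_inject_right[OF d])
  note [simp] = dual_pair_typ[OF d] dual_pair_typ[OF d'] typing
  have [simp]: "f \<in> Ar C" "Dom C f = L" "Cod C f = L'" "g \<in> Ar C" "Dom C g = R'" "Cod C g = R"
    using f g by auto
  show "g \<otimes> \<langle>L'\<rangle> \<cdot> c' \<in> hom C \<one> (R \<otimes>\<^sub>o L')" "\<langle>R\<rangle> \<otimes> f \<cdot> c \<in> hom C \<one> (R \<otimes>\<^sub>o L')" "L' \<in> Ob C" by auto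
  have "e \<otimes> \<langle>L'\<rangle> \<cdot> \<langle>L\<rangle> \<otimes> (g \<otimes> \<langle>L'\<rangle> \<cdot> c') = (e \<cdot> \<langle>L\<rangle> \<otimes> g) \<otimes> \<langle>L'\<rangle> \<cdot> \<langle>L\<rangle> \<otimes> c'"
    by (simp add: whisker_right whisker_left regroup_simps cmp_cmp)
  also have "\<dots> = e' \<otimes> \<langle>L'\<rangle> \<cdot> f \<otimes> \<langle>R' \<otimes>\<^sub>o L'\<rangle> \<cdot> \<langle>L\<rangle> \<otimes> c'"
    unfolding m by (simp add: whisker_right regroup_simps cmp_cmp)
  also have "f \<otimes> \<langle>R' \<otimes>\<^sub>o L'\<rangle> \<cdot> \<langle>L\<rangle> \<otimes> c' = \<langle>L'\<rangle> \<otimes> c' \<cdot> f"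
    by (rule slide_unit'[symmetric]) (use f in auto)
  also have "e' \<otimes> \<langle>L'\<rangle> \<cdot> \<langle>L'\<rangle> \<otimes> c' \<cdot> f = (e' \<otimes> \<langle>L'\<rangle> \<cdot> \<langle>L'\<rangle> \<otimes> c') \<cdot> f"
    by (simp add: cmp_cmp)
  also have "\<dots> = f \<cdot> e \<otimes> \<langle>L\<rangle> \<cdot> \<langle>L\<rangle> \<otimes> c"
    using d d' by (simp add: dual_pair_def interchange_simps)
  also have "\<dots> = (f \<cdot> e \<otimes> \<langle>L\<rangle>) \<cdot> \<langle>L\<rangle> \<otimes> c"
    by (simp add: cmp_cmp)
  also have "f \<cdot> e \<otimes> \<langle>L\<rangle> = e \<otimes> \<langle>L'\<rangle> \<cdot> \<langle>L \<otimes>\<^sub>o R\<rangle> \<otimes> f"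
    by (rule slide_counit[symmetric]) (use f in auto)
  also have "(e \<otimes> \<langle>L'\<rangle> \<cdot> \<langle>L \<otimes>\<^sub>o R\<rangle> \<otimes> f) \<cdot> \<langle>L\<rangle> \<otimes> c = e \<otimes> \<langle>L'\<rangle> \<cdot> \<langle>L\<rangle> \<otimes> (\<langle>R\<rangle> \<otimes> f \<cdot> c)"
    by (simp add: whisker_left regroup_simps cmp_cmp)
  finally show "e \<otimes> \<langle>L'\<rangle> \<cdot> \<langle>L\<rangle> \<otimes> (g \<otimes> \<langle>L'\<rangle> \<cdot> c') = e \<otimes> \<langle>L'\<rangle> \<cdot> \<langle>L\<rangle> \<otimes> (\<langle>R\<rangle> \<otimes> f \<cdot> c)" .
qed

end

context autonomous_category
begin

lemma rdual_pair: "X \<in> Ob C \<Longrightarrow> dual_pair X (rdual C X) (evr C X) (coevr C X)"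
  by (simp add: dual_pair_def rdual_Ob evr_hom coevr_hom rdual_zigzag1 rdual_zigzag2)

lemma ldual_pair: "X \<in> Ob C \<Longrightarrow> dual_pair (ldual C X) X (evl C X) (coevl C X)"
  by (simp add: dual_pair_def ldual_Ob evl_hom coevl_hom ldual_zigzag1 ldual_zigzag2)

lemmas rdual_typ [typing] = dual_pair_typ(2-)[OF rdual_pair]
lemmas ldual_typ [typing] = dual_pair_typ(1,3-)[OF ldual_pair]

lemma rdual_mor_typ [typing]:
  assumes "f \<in> Ar C"
  shows "rdual_mor C f \<in> Ar C" "Dom C (rdual_mor C f) = rdual C (Cod C f)"
    "Cod C (rdual_mor C f) = rdual C (Dom C f)"
  using assms by (simp_all add: rdual_mor_def Let_def typing)

lemma rdual_mor_pairing:
  assumes "f \<in> hom C X Y"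
  shows "evr C X \<cdot> \<langle>X\<rangle> \<otimes> rdual_mor C f = evr C Y \<cdot> f \<otimes> \<langle>rdual C Y\<rangle>"
proof -
  have ob: "X \<in> Ob C" "Y \<in> Ob C" using assms Dom_Ob Cod_Ob by (auto simp: hom_def)
  have f: "f \<in> Ar C" "Dom C f = X" "Cod C f = Y" using assms by (auto simp: hom_def)
  have "rdual_mor C f = \<langle>rdual C X\<rangle> \<otimes> (evr C Y \<cdot> f \<otimes> \<langle>rdual C Y\<rangle>) \<cdot> coevr C X \<otimes> \<langle>rdual C Y\<rangle>"
    using f ob by (simp add: rdual_mor_def Let_def typing whisker_left cmp_cmp)
  then show ?thesis
    using pairing_transpose_right[OF rdual_pair, of X "evr C Y \<cdot> f \<otimes> \<langle>rdual C Y\<rangle>" "rdual C Y" \<one>] f ob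
    by (simp add: typing unit_right)
qed

lemma rdual_mor_cmp:
  assumes "f \<in> Ar C" "g \<in> Ar C" "Dom C g = Cod C f"
  shows "rdual_mor C (g \<cdot> f) = rdual_mor C f \<cdot> rdual_mor C g"
proof (rule pairing_eq_right[OF rdual_pair])
  show "Dom C f \<in> Ob C" using assms by (simp add: typing)
  show "rdual_mor C (g \<cdot> f) \<in> hom C (rdual C (Cod C g)) (rdual C (Dom C f))"
    "rdual_mor C f \<cdot> rdual_mor C g \<in> hom C (rdual C (Cod C g)) (rdual C (Dom C f))"
    using assms by (simp_all add: typing)
  have "evr C (Dom C f) \<cdot> \<langle>Dom C f\<rangle> \<otimes> rdual_mor C (g \<cdot> f)
      = evr C (Cod C g) \<cdot> (g \<cdot> f) \<otimes> \<langle>rdual C (Cod C g)\<rangle>"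
    using assms by (intro rdual_mor_pairing) (simp add: typing)
  also have "\<dots> = evr C (Dom C f) \<cdot> \<langle>Dom C f\<rangle> \<otimes> (rdual_mor C f \<cdot> rdual_mor C g)"
    using assms
    by (intro mate_cmp[OF rdual_pair rdual_pair rdual_pair, of _ "Cod C f"] rdual_mor_pairing[symmetric])
      (simp_all add: typing)
  finally show "evr C (Dom C f) \<cdot> \<langle>Dom C f\<rangle> \<otimes> rdual_mor C (g \<cdot> f)
      = evr C (Dom C f) \<cdot> \<langle>Dom C f\<rangle> \<otimes> (rdual_mor C f \<cdot> rdual_mor C g)" .
qed

lemma rdual_mor_ide: "X \<in> Ob C \<Longrightarrow> rdual_mor C \<langle>X\<rangle> = \<langle>rdual C X\<rangle>"
  by (rule pairing_eq_right[OF rdual_pair, of X _ "rdual C X"])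
    (simp_all add: typing rdual_mor_pairing[of _ X X])

lemma rdual_mor_coev:
  assumes "f \<in> hom C X Y"
  shows "rdual_mor C f \<otimes> \<langle>Y\<rangle> \<cdot> coevr C Y = \<langle>rdual C X\<rangle> \<otimes> f \<cdot> coevr C X"
  using assms Dom_Ob[of f] Cod_Ob[of f] rdual_mor_pairing[OF assms]
  by (intro mate_coevaluation[OF rdual_pair rdual_pair]) (auto simp: typing)

end

section \<open>Dual modules from the right antipode\<close>

context hopf_monad
begin

text \<open>The action is \<open>s M \<cdot> \<T> (rdual_mor C r)\<close>: the dual of
  \<open>r\<close> leads into the dual of the free module, and the antipode returns to the dual of
  \<open>M\<close>. Linearity of evaluation and of coevaluation come from the first and the second
  antipode axiom, respectively.\<close>

lemma dual_action_exists:
  assumes M: "monad_module C T M r"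
  obtains q where "q \<in> hom C (\<T>\<^sub>o (rdual C M)) (rdual C M)"
    "evr C M \<cdot> r \<otimes> q \<cdot> \<tau> M (rdual C M) = \<epsilon> \<cdot> \<T> (evr C M)"
    "q \<otimes> r \<cdot> \<tau> (rdual C M) M \<cdot> \<T> (coevr C M) = coevr C M \<cdot> \<epsilon>"
proof -
  obtain s where s: "right_antipode C T s" using ex_right_antipode by blast
  note [simp] = typing
  have r [simp]: "M \<in> Ob C" "r \<in> Ar C" "Dom C r = \<T>\<^sub>o M" "Cod C r = M"
    and rr: "r \<cdot> \<T> r = r \<cdot> \<mu> M" and re: "r \<cdot> \<eta> M = \<langle>M\<rangle>"
    using M by (auto simp: monad_module_def)
  let ?M' = "rdual C M" and ?TM' = "rdual C (\<T>\<^sub>o M)"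
  have s_typ [simp]: "s X \<in> Ar C" "Dom C (s X) = \<T>\<^sub>o (rdual C (\<T>\<^sub>o X))" "Cod C (s X) = rdual C X"
    if "X \<in> Ob C" for X
    using s that by (auto simp: right_antipode_def hom_def)
  have snat: "s X \<cdot> \<T> (rdual_mor C (\<T> f)) = rdual_mor C f \<cdot> s Y" if "f \<in> hom C X Y" for f X Y
    using s that Dom_Ob[of f] Cod_Ob[of f] by (auto simp: right_antipode_def hom_def)
  have ax1: "\<epsilon> \<cdot> \<T> (evr C M) \<cdot> \<T> (\<langle>M\<rangle> \<otimes> rdual_mor C (\<eta> M))
      = evr C (\<T>\<^sub>o M) \<cdot> \<langle>\<T>\<^sub>o M\<rangle> \<otimes> (s (\<T>\<^sub>o M) \<cdot> \<T> (rdual_mor C (\<mu> M))) \<cdot> \<tau> M ?TM'"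
    and ax2: "\<langle>?M'\<rangle> \<otimes> \<eta> M \<cdot> coevr C M \<cdot> \<epsilon> = s M \<otimes> \<mu> M \<cdot> \<tau> ?TM' (\<T>\<^sub>o M) \<cdot> \<T> (coevr C (\<T>\<^sub>o M))"
    using s by (auto simp: right_antipode_def)
  define q where "q = s M \<cdot> \<T> (rdual_mor C r)"
  have q: "q \<in> hom C (\<T>\<^sub>o ?M') ?M'" by (simp add: q_def)
  have [simp]: "q \<in> Ar C" "Dom C q = \<T>\<^sub>o ?M'" "Cod C q = ?M'" using q by auto
  \<comment> \<open>Naturality of \<open>s\<close> at the morphism \<open>r\<close>, followed by
    associativity of the action, produces the composite of \<open>s\<close> with the dual of \<mu>
    that occurs in the first antipode axiom.\<close>
  have *: "rdual_mor C r \<cdot> q = s (\<T>\<^sub>o M) \<cdot> \<T> (rdual_mor C (\<mu> M)) \<cdot> \<T> (rdual_mor C r)"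
  proof -
    have "rdual_mor C r \<cdot> q = (rdual_mor C r \<cdot> s M) \<cdot> \<T> (rdual_mor C r)"
      by (simp add: q_def cmp_cmp)
    also have "\<dots> = s (\<T>\<^sub>o M) \<cdot> \<T> (rdual_mor C (r \<cdot> \<T> r))"
      using snat[of r "\<T>\<^sub>o M" M, symmetric] by (simp add: rdual_mor_cmp functor_simps cmp_cmp)
    also have "\<dots> = s (\<T>\<^sub>o M) \<cdot> \<T> (rdual_mor C (\<mu> M)) \<cdot> \<T> (rdual_mor C r)"
      unfolding rr by (simp add: rdual_mor_cmp functor_simps)
    finally show ?thesis .
  qed
  have "evr C M \<cdot> r \<otimes> q \<cdot> \<tau> M ?M' = (evr C M \<cdot> r \<otimes> \<langle>?M'\<rangle>) \<cdot> \<langle>\<T>\<^sub>o M\<rangle> \<otimes> q \<cdot> \<tau> M ?M'"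
    by (simp add: interchange_simps)
  also have "\<dots> = (evr C (\<T>\<^sub>o M) \<cdot> \<langle>\<T>\<^sub>o M\<rangle> \<otimes> rdual_mor C r) \<cdot> \<langle>\<T>\<^sub>o M\<rangle> \<otimes> q \<cdot> \<tau> M ?M'"
    by (simp add: rdual_mor_pairing[of r "\<T>\<^sub>o M" M])
  also have "\<dots> = evr C (\<T>\<^sub>o M) \<cdot> \<langle>\<T>\<^sub>o M\<rangle> \<otimes> (rdual_mor C r \<cdot> q) \<cdot> \<tau> M ?M'"
    by (simp add: interchange_simps)
  also have "\<dots> = (evr C (\<T>\<^sub>o M) \<cdot> \<langle>\<T>\<^sub>o M\<rangle> \<otimes> (s (\<T>\<^sub>o M) \<cdot> \<T> (rdual_mor C (\<mu> M))) \<cdot> \<tau> M ?TM')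
      \<cdot> \<T> (\<langle>M\<rangle> \<otimes> rdual_mor C r)"
    unfolding * by (simp add: cmp_cmp functor_simps whisker_left)
  also have "\<dots> = \<epsilon> \<cdot> \<T> (evr C M \<cdot> \<langle>M\<rangle> \<otimes> rdual_mor C (r \<cdot> \<eta> M))"
    unfolding ax1[symmetric] by (simp add: cmp_cmp functor_simps whisker_left rdual_mor_cmp)
  also have "\<dots> = \<epsilon> \<cdot> \<T> (evr C M)"
    unfolding re by (simp add: rdual_mor_ide interchange_simps)
  finally have D1: "evr C M \<cdot> r \<otimes> q \<cdot> \<tau> M ?M' = \<epsilon> \<cdot> \<T> (evr C M)" .
  have "q \<otimes> r \<cdot> \<tau> ?M' M \<cdot> \<T> (coevr C M) = s M \<otimes> r \<cdot> \<tau> ?TM' M \<cdot> \<T> (rdual_mor C r \<otimes> \<langle>M\<rangle> \<cdot> coevr C M)"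
    by (simp add: q_def functor_simps interchange_simps)
  also have "\<dots> = s M \<otimes> (r \<cdot> \<T> r) \<cdot> \<tau> ?TM' (\<T>\<^sub>o M) \<cdot> \<T> (coevr C (\<T>\<^sub>o M))"
    by (simp add: rdual_mor_coev[of r "\<T>\<^sub>o M" M] functor_simps interchange_simps)
  also have "\<dots> = \<langle>?M'\<rangle> \<otimes> r \<cdot> s M \<otimes> \<mu> M \<cdot> \<tau> ?TM' (\<T>\<^sub>o M) \<cdot> \<T> (coevr C (\<T>\<^sub>o M))"
    unfolding rr by (simp add: interchange_simps)
  also have "\<dots> = \<langle>?M'\<rangle> \<otimes> (r \<cdot> \<eta> M) \<cdot> coevr C M \<cdot> \<epsilon>"
    unfolding ax2[symmetric] by (simp add: interchange_simps)
  also have "\<dots> = coevr C M \<cdot> \<epsilon>"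
    unfolding re by (simp add: interchange_simps)
  finally have D2: "q \<otimes> r \<cdot> \<tau> ?M' M \<cdot> \<T> (coevr C M) = coevr C M \<cdot> \<epsilon>" .
  show thesis using that q D1 D2 by blast
qed

lemma fuse_iso:
  assumes "monad_module C T M r" "Y \<in> Ob C"
  obtains k where "k \<in> hom C (M \<otimes>\<^sub>o \<T>\<^sub>o Y) (\<T>\<^sub>o (M \<otimes>\<^sub>o Y))"
    "fuse r M Y \<cdot> k = \<langle>M \<otimes>\<^sub>o \<T>\<^sub>o Y\<rangle>" "k \<cdot> fuse r M Y = \<langle>\<T>\<^sub>o (M \<otimes>\<^sub>o Y)\<rangle>"
proof -
  have M: "M \<in> Ob C" "r \<in> hom C (\<T>\<^sub>o M) M"
    using assms(1) by (auto simp: monad_module_def)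
  obtain q where "q \<in> hom C (\<T>\<^sub>o (rdual C M)) (rdual C M)"
    "evr C M \<cdot> r \<otimes> q \<cdot> \<tau> M (rdual C M) = \<epsilon> \<cdot> \<T> (evr C M)"
    "q \<otimes> r \<cdot> \<tau> (rdual C M) M \<cdot> \<T> (coevr C M) = coevr C M \<cdot> \<epsilon>"
    using dual_action_exists[OF assms(1)] by blast
  then show thesis
    using fuse_inverse[OF rdual_pair[OF M(1)] M(2) _ _ _ assms(2)] that by blast
qed

end

section \<open>Hopf modules\<close>

context category
begin

lemma right_inverse_cancel:
  assumes "f \<cdot> h = g \<cdot> h" "h \<cdot> k = \<langle>X\<rangle>"
    "h \<in> Ar C" "k \<in> Ar C" "Cod C k = Dom C h" "Cod C h = X" "f \<in> Ar C" "g \<in> Ar C" "Dom C f = X" "Dom C g = X"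
  shows "f = g"
proof -
  have "(f \<cdot> h) \<cdot> k = (g \<cdot> h) \<cdot> k" using assms(1) by simp
  then show ?thesis using assms(2-) by (simp add: cmp_cmp cmp_ide)
qed

lemma left_inverse_cancel:
  assumes "h \<cdot> f = h \<cdot> g" "k \<cdot> h = \<langle>X\<rangle>"
    "h \<in> Ar C" "k \<in> Ar C" "Cod C h = Dom C k" "Dom C h = X" "f \<in> Ar C" "g \<in> Ar C" "Cod C f = X" "Cod C g = X"
  shows "f = g"
proof -
  have "(k \<cdot> h) \<cdot> f = (k \<cdot> h) \<cdot> g" using assms(1,3-) by (simp add: cmp_cmp)
  then show ?thesis using assms by (simp add: ide_cmp)
qed

end

section \<open>The dual of a left Hopf module\<close>

context hopf_monad
begin

text \<open>Linearity of the pairing determines the dual action. After pairing with \<open>M\<close>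
  and composing with the operators, which can be cancelled, the unit and associativity axioms reduce
  to \<open>T0_eta\<close> and \<open>T0_mu\<close>.\<close>

lemma dual_action_module:
  assumes d: "dual_pair M N e c" and M: "monad_module C T M r" and q: "q \<in> hom C (\<T>\<^sub>o N) N"
    and D: "e \<cdot> r \<otimes> q \<cdot> \<tau> M N = \<epsilon> \<cdot> \<T> e"
  shows "monad_module C T N q"
proof -
  note [simp] = typing dual_pair_typ[OF d]
  have r [simp]: "r \<in> Ar C" "Dom C r = \<T>\<^sub>o M" "Cod C r = M"
    using M by (auto simp: monad_module_def)
  have [simp]: "q \<in> Ar C" "Dom C q = \<T>\<^sub>o N" "Cod C q = N" using q by auto
  have D': "e \<cdot> \<langle>M\<rangle> \<otimes> q \<cdot> fuse r M N = \<epsilon> \<cdot> \<T> e"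
    unfolding D[symmetric] by (simp add: fuse_def interchange_simps)
  have "q \<cdot> \<eta> N = \<langle>N\<rangle>"
  proof (rule pairing_eq_right[OF d])
    have "e \<cdot> \<langle>M\<rangle> \<otimes> (q \<cdot> \<eta> N) = (e \<cdot> \<langle>M\<rangle> \<otimes> q \<cdot> fuse r M N) \<cdot> \<eta> (M \<otimes>\<^sub>o N)"
      using fuse_eta[OF M, of N] by (simp add: cmp_cmp whisker_left)
    also have "\<dots> = (\<epsilon> \<cdot> \<eta> \<one>) \<cdot> e"
      unfolding D' using eta_natural[of e] by (simp add: cmp_cmp)
    also have "\<dots> = e" by (simp add: T0_eta interchange_simps)
    finally show "e \<cdot> \<langle>M\<rangle> \<otimes> (q \<cdot> \<eta> N) = e \<cdot> \<langle>M\<rangle> \<otimes> \<langle>N\<rangle>" by (simp add: interchange_simps)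
  qed auto
  moreover have "q \<cdot> \<T> q = q \<cdot> \<mu> N"
  proof (rule pairing_eq_right[OF d])
    obtain k where k: "k \<in> hom C (M \<otimes>\<^sub>o \<T>\<^sub>o N) (\<T>\<^sub>o (M \<otimes>\<^sub>o N))" "fuse r M N \<cdot> k = \<langle>M \<otimes>\<^sub>o \<T>\<^sub>o N\<rangle>"
      using fuse_iso[OF M, of N] by auto
    obtain k' where k': "k' \<in> hom C (M \<otimes>\<^sub>o \<T>\<^sub>o (\<T>\<^sub>o N)) (\<T>\<^sub>o (M \<otimes>\<^sub>o \<T>\<^sub>o N))"
      "fuse r M (\<T>\<^sub>o N) \<cdot> k' = \<langle>M \<otimes>\<^sub>o \<T>\<^sub>o (\<T>\<^sub>o N)\<rangle>"
      using fuse_iso[OF M, of "\<T>\<^sub>o N"] by auto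
    have Tk: "\<T> (fuse r M N) \<cdot> \<T> k = \<langle>\<T>\<^sub>o (M \<otimes>\<^sub>o \<T>\<^sub>o N)\<rangle>"
      using arg_cong[OF k(2), of \<T>] k(1) by (simp add: functor_simps)
    \<comment> \<open>Associativity involves \<open>T\<close> twice, hence two operators are placed
      in front: one for \<open>\<T>\<^sub>o N\<close> and the image under \<open>T\<close> of the
      one for \<open>N\<close>. Both have right inverses.\<close>
    have "(e \<cdot> \<langle>M\<rangle> \<otimes> (q \<cdot> \<T> q)) \<cdot> fuse r M (\<T>\<^sub>o N) \<cdot> \<T> (fuse r M N)
        = e \<cdot> \<langle>M\<rangle> \<otimes> q \<cdot> (\<langle>M\<rangle> \<otimes> \<T> q \<cdot> fuse r M (\<T>\<^sub>o N)) \<cdot> \<T> (fuse r M N)"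
      by (simp add: whisker_left cmp_cmp)
    also have "\<langle>M\<rangle> \<otimes> \<T> q \<cdot> fuse r M (\<T>\<^sub>o N) = fuse r M N \<cdot> \<T> (\<langle>M\<rangle> \<otimes> q)"
      by (simp add: fuse_natural)
    also have "e \<cdot> \<langle>M\<rangle> \<otimes> q \<cdot> (fuse r M N \<cdot> \<T> (\<langle>M\<rangle> \<otimes> q)) \<cdot> \<T> (fuse r M N)
        = (e \<cdot> \<langle>M\<rangle> \<otimes> q \<cdot> fuse r M N) \<cdot> \<T> (\<langle>M\<rangle> \<otimes> q \<cdot> fuse r M N)"
      by (simp add: cmp_cmp functor_simps)
    also have "\<dots> = \<epsilon> \<cdot> \<T> (e \<cdot> \<langle>M\<rangle> \<otimes> q \<cdot> fuse r M N)"
      by (subst D') (simp add: cmp_cmp functor_simps)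
    also have "\<dots> = (\<epsilon> \<cdot> \<T> \<epsilon>) \<cdot> \<T> (\<T> e)"
      unfolding D' by (simp add: functor_simps cmp_cmp)
    also have "\<dots> = \<epsilon> \<cdot> \<T> e \<cdot> \<mu> (M \<otimes>\<^sub>o N)"
      unfolding T0_mu[symmetric] using mu_natural[of e] by (simp add: cmp_cmp)
    also have "\<dots> = (e \<cdot> \<langle>M\<rangle> \<otimes> q \<cdot> fuse r M N) \<cdot> \<mu> (M \<otimes>\<^sub>o N)"
      unfolding D' by (simp add: cmp_cmp)
    also have "\<dots> = (e \<cdot> \<langle>M\<rangle> \<otimes> (q \<cdot> \<mu> N)) \<cdot> fuse r M (\<T>\<^sub>o N) \<cdot> \<T> (fuse r M N)"
      using fuse_mu[OF M, of N] by (simp add: whisker_left cmp_cmp)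
    finally have "((e \<cdot> \<langle>M\<rangle> \<otimes> (q \<cdot> \<T> q)) \<cdot> fuse r M (\<T>\<^sub>o N)) \<cdot> \<T> (fuse r M N)
        = ((e \<cdot> \<langle>M\<rangle> \<otimes> (q \<cdot> \<mu> N)) \<cdot> fuse r M (\<T>\<^sub>o N)) \<cdot> \<T> (fuse r M N)"
      by (simp add: cmp_cmp)
    then have "(e \<cdot> \<langle>M\<rangle> \<otimes> (q \<cdot> \<T> q)) \<cdot> fuse r M (\<T>\<^sub>o N) = (e \<cdot> \<langle>M\<rangle> \<otimes> (q \<cdot> \<mu> N)) \<cdot> fuse r M (\<T>\<^sub>o N)"
      using k(1) by (elim right_inverse_cancel[OF _ Tk]) simp_all
    then show "e \<cdot> \<langle>M\<rangle> \<otimes> (q \<cdot> \<T> q) = e \<cdot> \<langle>M\<rangle> \<otimes> (q \<cdot> \<mu> N)"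
      using k'(1) by (elim right_inverse_cancel[OF _ k'(2)]) simp_all
  qed auto
  ultimately show ?thesis using q by (simp add: monad_module_def)
qed

text \<open>By \<open>R\<close> the coaction \<rho> is the transpose of \<delta>, so its comodule
  axioms are transposes of those of \<delta>. The compatibility of \<rho> with \<open>q\<close> is
  tested in front of the operator, where linearity of the pairing \<open>e\<close> replaces the
  actions by \<epsilon>.\<close>

lemma dual_hopf_module:
  assumes d: "dual_pair M N e c" and M: "left_hopf_module C T M r \<delta>" and q: "q \<in> hom C (\<T>\<^sub>o N) N"
    and D: "e \<cdot> r \<otimes> q \<cdot> \<tau> M N = \<epsilon> \<cdot> \<T> e"
    and \<rho>: "\<rho> \<in> hom C N (N \<otimes>\<^sub>o A)" and R: "e \<otimes> \<langle>A\<rangle> \<cdot> \<langle>M\<rangle> \<otimes> \<rho> = \<langle>A\<rangle> \<otimes> e \<cdot> \<delta> \<otimes> \<langle>N\<rangle>"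
  shows "right_hopf_module C T N q \<rho>"
proof -
  note [simp] = typing dual_pair_typ[OF d]
  have Mm: "monad_module C T M r"
    and r [simp]: "r \<in> Ar C" "Dom C r = \<T>\<^sub>o M" "Cod C r = M"
      "\<delta> \<in> Ar C" "Dom C \<delta> = M" "Cod C \<delta> = A \<otimes>\<^sub>o M"
    and coass: "\<langle>A\<rangle> \<otimes> \<delta> \<cdot> \<delta> = \<tau> \<one> \<one> \<otimes> \<langle>M\<rangle> \<cdot> \<delta>" and coun: "\<epsilon> \<otimes> \<langle>M\<rangle> \<cdot> \<delta> = \<langle>M\<rangle>"
    and comp: "\<delta> \<cdot> r = \<mu> \<one> \<otimes> r \<cdot> \<tau> A M \<cdot> \<T> \<delta>"
    using M by (auto simp: left_hopf_module_def left_comodule_def monad_module_def)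
  have [simp]: "q \<in> Ar C" "Dom C q = \<T>\<^sub>o N" "Cod C q = N" "\<rho> \<in> Ar C" "Dom C \<rho> = N" "Cod C \<rho> = N \<otimes>\<^sub>o A"
    using q \<rho> by auto
  have e: "e \<in> hom C (M \<otimes>\<^sub>o N) \<one>" by simp
  have "\<rho> \<otimes> \<langle>A\<rangle> \<cdot> \<rho> = \<langle>N\<rangle> \<otimes> \<tau> \<one> \<one> \<cdot> \<rho>"
  proof (rule pairing_inject_right[OF d])
    have "e \<otimes> \<langle>A \<otimes>\<^sub>o A\<rangle> \<cdot> \<langle>M\<rangle> \<otimes> (\<rho> \<otimes> \<langle>A\<rangle> \<cdot> \<rho>) = (e \<otimes> \<langle>A\<rangle> \<cdot> \<langle>M\<rangle> \<otimes> \<rho>) \<otimes> \<langle>A\<rangle> \<cdot> \<langle>M\<rangle> \<otimes> \<rho>"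
      by (simp add: whisker_left whisker_right regroup_simps cmp_cmp)
    also have "\<dots> = \<langle>A\<rangle> \<otimes> e \<otimes> \<langle>A\<rangle> \<cdot> \<delta> \<otimes> \<langle>N \<otimes>\<^sub>o A\<rangle> \<cdot> \<langle>M\<rangle> \<otimes> \<rho>"
      unfolding R by (simp add: whisker_right regroup_simps cmp_cmp)
    also have "\<delta> \<otimes> \<langle>N \<otimes>\<^sub>o A\<rangle> \<cdot> \<langle>M\<rangle> \<otimes> \<rho> = \<langle>A \<otimes>\<^sub>o M\<rangle> \<otimes> \<rho> \<cdot> \<delta> \<otimes> \<langle>N\<rangle>"
      by (simp add: interchange_simps)
    also have "\<langle>A\<rangle> \<otimes> e \<otimes> \<langle>A\<rangle> \<cdot> \<langle>A \<otimes>\<^sub>o M\<rangle> \<otimes> \<rho> \<cdot> \<delta> \<otimes> \<langle>N\<rangle> = \<langle>A\<rangle> \<otimes> (e \<otimes> \<langle>A\<rangle> \<cdot> \<langle>M\<rangle> \<otimes> \<rho>) \<cdot> \<delta> \<otimes> \<langle>N\<rangle>"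
      by (simp add: whisker_left regroup_simps cmp_cmp)
    also have "\<dots> = \<langle>A \<otimes>\<^sub>o A\<rangle> \<otimes> e \<cdot> (\<langle>A\<rangle> \<otimes> \<delta> \<cdot> \<delta>) \<otimes> \<langle>N\<rangle>"
      unfolding R by (simp add: whisker_left whisker_right regroup_simps cmp_cmp)
    also have "\<dots> = (\<langle>A \<otimes>\<^sub>o A\<rangle> \<otimes> e \<cdot> \<tau> \<one> \<one> \<otimes> \<langle>M \<otimes>\<^sub>o N\<rangle>) \<cdot> \<delta> \<otimes> \<langle>N\<rangle>"
      unfolding coass by (simp add: whisker_right regroup_simps cmp_cmp)
    also have "\<dots> = \<tau> \<one> \<one> \<cdot> \<langle>A\<rangle> \<otimes> e \<cdot> \<delta> \<otimes> \<langle>N\<rangle>"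
      using slide_counit'[OF e, of "\<tau> \<one> \<one>" A] by (simp add: cmp_cmp)
    also have "\<dots> = (\<tau> \<one> \<one> \<cdot> e \<otimes> \<langle>A\<rangle>) \<cdot> \<langle>M\<rangle> \<otimes> \<rho>"
      unfolding R[symmetric] by (simp add: cmp_cmp)
    also have "\<dots> = e \<otimes> \<langle>A \<otimes>\<^sub>o A\<rangle> \<cdot> \<langle>M\<rangle> \<otimes> (\<langle>N\<rangle> \<otimes> \<tau> \<one> \<one> \<cdot> \<rho>)"
      using slide_counit[OF e, of "\<tau> \<one> \<one>" A, symmetric] by (simp add: cmp_cmp whisker_left regroup_simps)
    finally show "e \<otimes> \<langle>A \<otimes>\<^sub>o A\<rangle> \<cdot> \<langle>M\<rangle> \<otimes> (\<rho> \<otimes> \<langle>A\<rangle> \<cdot> \<rho>) = e \<otimes> \<langle>A \<otimes>\<^sub>o A\<rangle> \<cdot> \<langle>M\<rangle> \<otimes> (\<langle>N\<rangle> \<otimes> \<tau> \<one> \<one> \<cdot> \<rho>)" .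
  qed auto
  moreover have "\<langle>N\<rangle> \<otimes> \<epsilon> \<cdot> \<rho> = \<langle>N\<rangle>"
  proof (rule pairing_eq_right[OF d])
    have "e \<cdot> \<langle>M\<rangle> \<otimes> (\<langle>N\<rangle> \<otimes> \<epsilon> \<cdot> \<rho>) = (e \<cdot> \<langle>M \<otimes>\<^sub>o N\<rangle> \<otimes> \<epsilon>) \<cdot> \<langle>M\<rangle> \<otimes> \<rho>"
      by (simp add: whisker_left regroup_simps cmp_cmp)
    also have "\<dots> = \<epsilon> \<cdot> \<langle>A\<rangle> \<otimes> e \<cdot> \<delta> \<otimes> \<langle>N\<rangle>"
      unfolding R[symmetric] using slide_counit[OF e, of \<epsilon> A] by (simp add: unit_right cmp_cmp)
    also have "\<dots> = e \<cdot> (\<epsilon> \<otimes> \<langle>M\<rangle> \<cdot> \<delta>) \<otimes> \<langle>N\<rangle>"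
      using slide_counit'[OF e, of \<epsilon> A \<one>] by (simp add: whisker_right regroup_simps flip: cmp_cmp)
    finally show "e \<cdot> \<langle>M\<rangle> \<otimes> (\<langle>N\<rangle> \<otimes> \<epsilon> \<cdot> \<rho>) = e \<cdot> \<langle>M\<rangle> \<otimes> \<langle>N\<rangle>"
      unfolding coun .
  qed auto
  moreover have "\<rho> \<cdot> q = q \<otimes> \<mu> \<one> \<cdot> \<tau> N A \<cdot> \<T> \<rho>"
  proof (rule pairing_inject_right[OF d])
    obtain k where k: "k \<in> hom C (M \<otimes>\<^sub>o \<T>\<^sub>o N) (\<T>\<^sub>o (M \<otimes>\<^sub>o N))" "fuse r M N \<cdot> k = \<langle>M \<otimes>\<^sub>o \<T>\<^sub>o N\<rangle>"
      using fuse_iso[OF Mm, of N] by auto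
    have "(e \<otimes> \<langle>A\<rangle> \<cdot> \<langle>M\<rangle> \<otimes> (\<rho> \<cdot> q)) \<cdot> fuse r M N = (e \<otimes> \<langle>A\<rangle> \<cdot> \<langle>M\<rangle> \<otimes> \<rho>) \<cdot> r \<otimes> q \<cdot> \<tau> M N"
      by (simp add: fuse_def interchange_simps)
    also have "\<dots> = \<langle>A\<rangle> \<otimes> e \<cdot> (\<delta> \<cdot> r) \<otimes> q \<cdot> \<tau> M N"
      unfolding R by (simp add: interchange_simps)
    also have "\<dots> = \<langle>A\<rangle> \<otimes> e \<cdot> \<mu> \<one> \<otimes> r \<otimes> q \<cdot> (\<tau> A M \<otimes> \<langle>\<T>\<^sub>o N\<rangle> \<cdot> \<T> \<delta> \<otimes> \<langle>\<T>\<^sub>o N\<rangle> \<cdot> \<tau> M N)"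
    proof -
      have "(\<mu> \<one> \<otimes> r \<cdot> \<tau> A M \<cdot> \<T> \<delta>) \<otimes> q = (\<mu> \<one> \<otimes> r) \<otimes> q \<cdot> \<tau> A M \<otimes> \<langle>\<T>\<^sub>o N\<rangle> \<cdot> \<T> \<delta> \<otimes> \<langle>\<T>\<^sub>o N\<rangle>"
        by (simp add: interchange_simps)
      then show ?thesis unfolding comp by (simp add: cmp_cmp tensor_assoc)
    qed
    also have "\<tau> A M \<otimes> \<langle>\<T>\<^sub>o N\<rangle> \<cdot> \<T> \<delta> \<otimes> \<langle>\<T>\<^sub>o N\<rangle> \<cdot> \<tau> M N
        = \<langle>\<T>\<^sub>o A\<rangle> \<otimes> \<tau> M N \<cdot> \<tau> A (M \<otimes>\<^sub>o N) \<cdot> \<T> (\<delta> \<otimes> \<langle>N\<rangle>)"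
      by (simp add: T2_coassoc' functor_simps)
    also have "\<langle>A\<rangle> \<otimes> e \<cdot> \<mu> \<one> \<otimes> r \<otimes> q \<cdot> \<langle>\<T>\<^sub>o A\<rangle> \<otimes> \<tau> M N \<cdot> \<tau> A (M \<otimes>\<^sub>o N) \<cdot> \<T> (\<delta> \<otimes> \<langle>N\<rangle>)
        = \<mu> \<one> \<otimes> (e \<cdot> r \<otimes> q \<cdot> \<tau> M N) \<cdot> \<tau> A (M \<otimes>\<^sub>o N) \<cdot> \<T> (\<delta> \<otimes> \<langle>N\<rangle>)"
      by (simp add: interchange_simps)
    also have "\<dots> = \<mu> \<one> \<otimes> \<epsilon> \<cdot> \<tau> A \<one> \<cdot> \<T> (\<langle>A\<rangle> \<otimes> e) \<cdot> \<T> (\<delta> \<otimes> \<langle>N\<rangle>)"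
      unfolding D by (simp add: interchange_simps functor_simps)
    also have "\<dots> = \<mu> \<one> \<cdot> (\<langle>\<T>\<^sub>o A\<rangle> \<otimes> \<epsilon> \<cdot> \<tau> A \<one>) \<cdot> \<T> (\<langle>A\<rangle> \<otimes> e \<cdot> \<delta> \<otimes> \<langle>N\<rangle>)"
    proof -
      have "\<mu> \<one> \<otimes> \<epsilon> = \<mu> \<one> \<cdot> \<langle>\<T>\<^sub>o A\<rangle> \<otimes> \<epsilon>"
        using tensor_cmp_ide(1)[of "\<mu> \<one>" \<epsilon>] by (simp add: unit_right)
      then show ?thesis by (simp add: cmp_cmp functor_simps)
    qed
    \<comment> \<open>The turning point from \<delta> to \<rho>: the right and the left counit law
      both give the identity, and under \<open>T\<close> the equation \<open>R\<close> exchanges the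
      two coactions.\<close>
    also have "\<dots> = \<mu> \<one> \<cdot> (\<epsilon> \<otimes> \<langle>\<T>\<^sub>o A\<rangle> \<cdot> \<tau> \<one> A) \<cdot> \<T> (e \<otimes> \<langle>A\<rangle> \<cdot> \<langle>M\<rangle> \<otimes> \<rho>)"
      unfolding R by (simp add: T0_left T0_right)
    also have "\<dots> = \<epsilon> \<otimes> \<mu> \<one> \<cdot> \<tau> \<one> A \<cdot> \<T> (e \<otimes> \<langle>A\<rangle>) \<cdot> \<T> (\<langle>M\<rangle> \<otimes> \<rho>)"
    proof -
      have "\<epsilon> \<otimes> \<mu> \<one> = \<mu> \<one> \<cdot> \<epsilon> \<otimes> \<langle>\<T>\<^sub>o A\<rangle>"
        using tensor_cmp_ide(2)[of \<epsilon> "\<mu> \<one>"] by (simp add: unit_left)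
      then show ?thesis by (simp add: cmp_cmp functor_simps)
    qed
    also have "\<dots> = (\<epsilon> \<cdot> \<T> e) \<otimes> \<mu> \<one> \<cdot> \<tau> (M \<otimes>\<^sub>o N) A \<cdot> \<T> (\<langle>M\<rangle> \<otimes> \<rho>)"
      by (simp add: interchange_simps functor_simps)
    also have "\<dots> = e \<otimes> \<langle>A\<rangle> \<cdot> (r \<otimes> q) \<otimes> \<mu> \<one> \<cdot> \<tau> M N \<otimes> \<langle>\<T>\<^sub>o A\<rangle> \<cdot> \<tau> (M \<otimes>\<^sub>o N) A \<cdot> \<T> (\<langle>M\<rangle> \<otimes> \<rho>)"
      unfolding D[symmetric] by (simp add: interchange_simps)
    also have "\<dots> = e \<otimes> \<langle>A\<rangle> \<cdot> (r \<otimes> q \<otimes> \<mu> \<one>) \<cdot> \<langle>\<T>\<^sub>o M\<rangle> \<otimes> \<tau> N A \<cdot> \<langle>\<T>\<^sub>o M\<rangle> \<otimes> \<T> \<rho> \<cdot> \<tau> M N"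
      by (simp add: tensor_assoc functor_simps T2_coassoc'[symmetric])
    also have "\<dots> = (e \<otimes> \<langle>A\<rangle> \<cdot> \<langle>M\<rangle> \<otimes> (q \<otimes> \<mu> \<one> \<cdot> \<tau> N A \<cdot> \<T> \<rho>)) \<cdot> fuse r M N"
      by (simp add: fuse_def interchange_simps)
    finally have "(e \<otimes> \<langle>A\<rangle> \<cdot> \<langle>M\<rangle> \<otimes> (\<rho> \<cdot> q)) \<cdot> fuse r M N
        = (e \<otimes> \<langle>A\<rangle> \<cdot> \<langle>M\<rangle> \<otimes> (q \<otimes> \<mu> \<one> \<cdot> \<tau> N A \<cdot> \<T> \<rho>)) \<cdot> fuse r M N" .
    then show "e \<otimes> \<langle>A\<rangle> \<cdot> \<langle>M\<rangle> \<otimes> (\<rho> \<cdot> q) = e \<otimes> \<langle>A\<rangle> \<cdot> \<langle>M\<rangle> \<otimes> (q \<otimes> \<mu> \<one> \<cdot> \<tau> N A \<cdot> \<T> \<rho>)"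
      using k(1) by (elim right_inverse_cancel[OF _ k(2)]) simp_all
  qed auto
  ultimately show ?thesis
    using dual_action_module[OF d Mm q D]
    by (simp add: right_hopf_module_def right_comodule_def)
qed

section \<open>The decomposition of right Hopf modules\<close>

lemma hopf_action_coinvariant:
  assumes "right_hopf_module C T M r \<rho>" and "i \<in> hom C E M" and "\<rho> \<cdot> i = \<langle>M\<rangle> \<otimes> \<eta> \<one> \<cdot> i"
  shows "\<rho> \<cdot> r \<cdot> \<T> i = fuse r M \<one> \<cdot> \<T> i" "\<rho> \<cdot> r \<cdot> \<T> i = (r \<cdot> \<T> i) \<otimes> \<langle>A\<rangle> \<cdot> \<tau> E \<one>"
proof -
  note [simp] = typing
  have [simp]: "M \<in> Ob C" "r \<in> Ar C" "Dom C r = \<T>\<^sub>o M" "Cod C r = M"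
      "\<rho> \<in> Ar C" "Dom C \<rho> = M" "Cod C \<rho> = M \<otimes>\<^sub>o A"
    and comp: "\<rho> \<cdot> r = r \<otimes> \<mu> \<one> \<cdot> \<tau> M A \<cdot> \<T> \<rho>"
    using assms(1) by (auto simp: right_hopf_module_def right_comodule_def monad_module_def)
  have [simp]: "i \<in> Ar C" "Dom C i = E" "Cod C i = M" using assms(2) by auto
  then have [simp]: "E \<in> Ob C" using Dom_Ob by blast
  have n: "\<tau> M \<one> \<cdot> \<T> i = \<T> i \<otimes> \<langle>A\<rangle> \<cdot> \<tau> E \<one>"
    using T2_natural[of i "\<langle>\<one>\<rangle>" M \<one>] by (simp add: unit_right functor_simps)
  have "\<rho> \<cdot> r \<cdot> \<T> i = (\<rho> \<cdot> r) \<cdot> \<T> i" by (simp add: cmp_cmp)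
  also have "\<dots> = r \<otimes> \<mu> \<one> \<cdot> \<tau> M A \<cdot> \<T> (\<rho> \<cdot> i)"
    unfolding comp by (simp add: cmp_cmp functor_simps)
  \<comment> \<open>Coinvariance turns \<rho> into an insertion of the unit, which \<mu>
    absorbs.\<close>
  also have "\<dots> = r \<otimes> (\<mu> \<one> \<cdot> \<T> (\<eta> \<one>)) \<cdot> \<tau> M \<one> \<cdot> \<T> i"
    unfolding assms(3) by (simp add: functor_simps interchange_simps)
  finally show *: "\<rho> \<cdot> r \<cdot> \<T> i = fuse r M \<one> \<cdot> \<T> i"
    by (simp add: mu_eta_right fuse_def cmp_cmp)
  show "\<rho> \<cdot> r \<cdot> \<T> i = (r \<cdot> \<T> i) \<otimes> \<langle>A\<rangle> \<cdot> \<tau> E \<one>"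
    unfolding * by (simp add: fuse_def cmp_cmp n) (simp add: interchange_simps)
qed

text \<open>On the image of \<open>\<T> i\<close> the composite \<open>\<rho> \<cdot> r\<close>
  agrees with the invertible operator \<open>fuse r M \<one>\<close>. Hence the inverse operator
  after \<rho> recovers \<open>\<T> i\<close> from \<open>r \<cdot> \<T> i\<close>, and it only has
  to be factored through \<open>\<T> i\<close>.\<close>

theorem hopf_module_decomposition:
  assumes M: "right_hopf_module C T M r \<rho>"
    and eq: "equalizer C E i \<rho> (\<langle>M\<rangle> \<otimes> \<eta> \<one>)"
    and Teq: "equalizer C (\<T>\<^sub>o E) (\<T> i) (\<T> \<rho>) (\<T> (\<langle>M\<rangle> \<otimes> \<eta> \<one>))"
  obtains \<psi> where "\<psi> \<in> hom C M (\<T>\<^sub>o E)" "(r \<cdot> \<T> i) \<cdot> \<psi> = \<langle>M\<rangle>" "\<psi> \<cdot> (r \<cdot> \<T> i) = \<langle>\<T>\<^sub>o E\<rangle>"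
proof -
  note [simp] = typing
  have [simp]: "M \<in> Ob C" "r \<in> Ar C" "Dom C r = \<T>\<^sub>o M" "Cod C r = M"
      "\<rho> \<in> Ar C" "Dom C \<rho> = M" "Cod C \<rho> = M \<otimes>\<^sub>o A"
    and comp: "\<rho> \<cdot> r = r \<otimes> \<mu> \<one> \<cdot> \<tau> M A \<cdot> \<T> \<rho>"
    and coass: "\<rho> \<otimes> \<langle>A\<rangle> \<cdot> \<rho> = \<langle>M\<rangle> \<otimes> \<tau> \<one> \<one> \<cdot> \<rho>" and coun: "\<langle>M\<rangle> \<otimes> \<epsilon> \<cdot> \<rho> = \<langle>M\<rangle>"
    and Mm: "monad_module C T M r"
    using M by (auto simp: right_hopf_module_def right_comodule_def monad_module_def)
  have i: "i \<in> hom C E M" and [simp]: "E \<in> Ob C" and ieq: "\<rho> \<cdot> i = \<langle>M\<rangle> \<otimes> \<eta> \<one> \<cdot> i"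
    using eq by (auto simp: equalizer_def)
  have [simp]: "i \<in> Ar C" "Dom C i = E" "Cod C i = M" using i by auto
  let ?h = "fuse r M \<one>"
  obtain k where k: "k \<in> hom C (M \<otimes>\<^sub>o A) (\<T>\<^sub>o M)"
    and hk: "?h \<cdot> k = \<langle>M \<otimes>\<^sub>o A\<rangle>" and kh: "k \<cdot> ?h = \<langle>\<T>\<^sub>o M\<rangle>"
    using fuse_iso[OF Mm, of \<one>] by auto
  have [simp]: "k \<in> Ar C" "Dom C k = M \<otimes>\<^sub>o A" "Cod C k = \<T>\<^sub>o M" using k by auto
  let ?r' = "r \<otimes> \<mu> \<one> \<cdot> \<tau> M A" and ?M' = "M \<otimes>\<^sub>o A"
  have M': "monad_module C T ?M' ?r'"
    by (intro tensor_module Mm free_module) simp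
  have r': "?r' \<in> hom C (\<T>\<^sub>o ?M') ?M'" by simp
  have [simp]: "fuse ?r' ?M' \<one> \<in> Ar C" "Dom C (fuse ?r' ?M' \<one>) = \<T>\<^sub>o ?M'" "Cod C (fuse ?r' ?M' \<one>) = ?M' \<otimes>\<^sub>o A"
    using fuse_typ[OF r', of \<one>] by auto
  obtain k' where k': "k' \<in> hom C (?M' \<otimes>\<^sub>o A) (\<T>\<^sub>o ?M')" and k'h: "k' \<cdot> fuse ?r' ?M' \<one> = \<langle>\<T>\<^sub>o ?M'\<rangle>"
    using fuse_iso[OF M', of \<one>] by auto
  have nat: "\<tau> ?M' \<one> \<cdot> \<T> f = \<T> f \<otimes> \<langle>A\<rangle> \<cdot> \<tau> M \<one>" if "f \<in> hom C M ?M'" for f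
    using T2_natural[of f "\<langle>\<one>\<rangle>" ?M' \<one>] that by (simp add: unit_right functor_simps)
  have fuse': "fuse ?r' ?M' \<one> \<cdot> \<T> f = (?r' \<cdot> \<T> f) \<otimes> \<langle>A\<rangle> \<cdot> \<tau> M \<one>" if "f \<in> hom C M ?M'" for f
  proof -
    have [simp]: "f \<in> Ar C" "Dom C f = M" "Cod C f = ?M'" using that by auto
    have "fuse ?r' ?M' \<one> \<cdot> \<T> f = ?r' \<otimes> \<langle>A\<rangle> \<cdot> \<tau> ?M' \<one> \<cdot> \<T> f"
      by (simp add: fuse_def[of ?r'] cmp_cmp)
    also have "\<dots> = (?r' \<cdot> \<T> f) \<otimes> \<langle>A\<rangle> \<cdot> \<tau> M \<one>"
      unfolding nat[OF that] by (simp add: interchange_simps)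
    finally show ?thesis .
  qed
  txt \<open>The inverse of \<open>r \<cdot> T i\<close> is the factorization of \<open>\<theta>\<close> through the equalizer \<open>T i\<close>. That \<open>\<theta>\<close> equalizes
    the pair is checked after composing with the operator of the module \<open>M \<otimes> T \<one>\<close>, where it becomes the
    coassociativity of \<open>\<rho>\<close>.\<close>
  define \<theta> where "\<theta> = k \<cdot> \<rho>"
  have [simp]: "\<theta> \<in> Ar C" "Dom C \<theta> = M" "Cod C \<theta> = \<T>\<^sub>o M" by (simp_all add: \<theta>_def)
  have h\<theta>: "?h \<cdot> \<theta> = \<rho>"
  proof -
    have "?h \<cdot> \<theta> = (?h \<cdot> k) \<cdot> \<rho>" by (simp add: \<theta>_def cmp_cmp)
    then show ?thesis unfolding hk by (simp add: interchange_simps)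
  qed
  have "fuse ?r' ?M' \<one> \<cdot> \<T> \<rho> \<cdot> \<theta> = ((?r' \<cdot> \<T> \<rho>) \<otimes> \<langle>A\<rangle> \<cdot> \<tau> M \<one>) \<cdot> \<theta>"
    using fuse'[of \<rho>] by (simp flip: cmp_cmp)
  also have "\<dots> = ((\<rho> \<cdot> r) \<otimes> \<langle>A\<rangle> \<cdot> \<tau> M \<one>) \<cdot> \<theta>"
    unfolding comp by (simp add: cmp_cmp)
  also have "\<dots> = \<rho> \<otimes> \<langle>A\<rangle> \<cdot> ?h \<cdot> \<theta>"
    by (simp add: fuse_def interchange_simps)
  also have "\<dots> = \<langle>M\<rangle> \<otimes> \<tau> \<one> \<one> \<cdot> ?h \<cdot> \<theta>"
    unfolding h\<theta> coass ..
  also have "\<dots> = (\<langle>M\<rangle> \<otimes> \<tau> \<one> \<one> \<cdot> fuse r M (\<one> \<otimes>\<^sub>o \<one>)) \<cdot> \<theta>"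
    by (simp add: cmp_cmp)
  also have "\<dots> = (?h \<otimes> \<langle>A\<rangle> \<cdot> \<tau> M \<one>) \<cdot> \<theta>"
    by (subst fuse_T2) simp_all
  \<comment> \<open>Since \<mu> absorbs the unit, inserting \<eta> and then acting diagonally gives
    back the operator of \<open>M\<close>. In this form the expression is the operator of
    \<open>?M'\<close> after the second map of the pair.\<close>
  also have "?h = ?r' \<cdot> \<T> (\<langle>M\<rangle> \<otimes> \<eta> \<one>)"
    by (simp add: fuse_def cmp_cmp functor_simps) (simp add: interchange_simps mu_eta_right)
  also have "((?r' \<cdot> \<T> (\<langle>M\<rangle> \<otimes> \<eta> \<one>)) \<otimes> \<langle>A\<rangle> \<cdot> \<tau> M \<one>) \<cdot> \<theta> = fuse ?r' ?M' \<one> \<cdot> \<T> (\<langle>M\<rangle> \<otimes> \<eta> \<one>) \<cdot> \<theta>"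
    using fuse'[of "\<langle>M\<rangle> \<otimes> \<eta> \<one>"] by (simp flip: cmp_cmp)
  finally have "\<T> \<rho> \<cdot> \<theta> = \<T> (\<langle>M\<rangle> \<otimes> \<eta> \<one>) \<cdot> \<theta>"
    using k' by (elim left_inverse_cancel[OF _ k'h]) simp_all
  moreover have "\<theta> \<in> hom C M (Dom C (\<T> \<rho>))" by simp
  ultimately obtain \<psi> where \<psi>: "\<psi> \<in> hom C M (\<T>\<^sub>o E)" "\<T> i \<cdot> \<psi> = \<theta>"
    using Teq \<open>M \<in> Ob C\<close> unfolding equalizer_def by metis
  have [simp]: "\<psi> \<in> Ar C" "Dom C \<psi> = M" "Cod C \<psi> = \<T>\<^sub>o E" using \<psi>(1) by auto
  \<comment> \<open>Applying the counit recovers the action from the operator; the counit law of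
    \<rho> then shows that \<open>r\<close> after \<theta> is the identity.\<close>
  have "\<langle>M\<rangle> \<otimes> \<epsilon> \<cdot> ?h = r \<cdot> (\<langle>\<T>\<^sub>o M\<rangle> \<otimes> \<epsilon> \<cdot> \<tau> M \<one>)"
  proof -
    have "\<langle>M\<rangle> \<otimes> \<epsilon> \<cdot> r \<otimes> \<langle>A\<rangle> = r \<cdot> \<langle>\<T>\<^sub>o M\<rangle> \<otimes> \<epsilon>"
      by (rule slide_counit') simp_all
    then show ?thesis by (simp add: fuse_def flip: cmp_cmp)
  qed
  then have r_eq: "\<langle>M\<rangle> \<otimes> \<epsilon> \<cdot> ?h = r" by (simp add: T0_right interchange_simps)
  have "(r \<cdot> \<T> i) \<cdot> \<psi> = r \<cdot> \<theta>" using \<psi>(2) by (simp add: cmp_cmp)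
  also have "\<dots> = \<langle>M\<rangle> \<otimes> \<epsilon> \<cdot> ?h \<cdot> \<theta>"
    by (subst r_eq[symmetric]) (simp add: cmp_cmp)
  also have "\<dots> = \<langle>M\<rangle>" unfolding h\<theta> coun ..
  finally have 1: "(r \<cdot> \<T> i) \<cdot> \<psi> = \<langle>M\<rangle>" .
  have "\<T> i \<cdot> \<psi> \<cdot> r \<cdot> \<T> i = k \<cdot> \<rho> \<cdot> r \<cdot> \<T> i"
    using arg_cong[OF \<psi>(2), of "\<lambda>x. x \<cdot> r \<cdot> \<T> i"] by (simp add: cmp_cmp \<theta>_def)
  also have "\<dots> = (k \<cdot> ?h) \<cdot> \<T> i"
    unfolding hopf_action_coinvariant(1)[OF M i ieq] by (simp add: cmp_cmp)
  finally have 2: "\<T> i \<cdot> \<psi> \<cdot> r \<cdot> \<T> i = \<T> i" unfolding kh by (simp add: interchange_simps)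
  \<comment> \<open>The equation \<open>2\<close> suffices because \<open>\<T> i\<close>, being an
    equalizer, is monic.\<close>
  have "\<psi> \<cdot> r \<cdot> \<T> i = \<langle>\<T>\<^sub>o E\<rangle>"
  proof -
    have "\<T> i \<in> hom C (\<T>\<^sub>o E) (Dom C (\<T> \<rho>))" "\<T> \<rho> \<cdot> \<T> i = \<T> (\<langle>M\<rangle> \<otimes> \<eta> \<one>) \<cdot> \<T> i" "\<T>\<^sub>o E \<in> Ob C"
      using Teq by (auto simp: equalizer_def)
    then have "\<exists>!x. x \<in> hom C (\<T>\<^sub>o E) (\<T>\<^sub>o E) \<and> \<T> i \<cdot> x = \<T> i"
      using Teq unfolding equalizer_def by blast
    moreover have "\<psi> \<cdot> r \<cdot> \<T> i \<in> hom C (\<T>\<^sub>o E) (\<T>\<^sub>o E)" "\<langle>\<T>\<^sub>o E\<rangle> \<in> hom C (\<T>\<^sub>o E) (\<T>\<^sub>o E)" by simp_all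
    moreover have "\<T> i \<cdot> \<langle>\<T>\<^sub>o E\<rangle> = \<T> i" by (simp add: interchange_simps)
    ultimately show ?thesis using 2 by metis
  qed
  then show thesis using that[OF \<psi>(1) 1] by simp
qed

lemma free_hopf_module:
  assumes "X \<in> Ob C"
  shows "right_hopf_module C T (\<T>\<^sub>o X) (\<mu> X) (\<tau> X \<one>)" "left_hopf_module C T (\<T>\<^sub>o X) (\<mu> X) (\<tau> \<one> X)"
proof -
  note [simp] = typing assms
  show "right_hopf_module C T (\<T>\<^sub>o X) (\<mu> X) (\<tau> X \<one>)"
    using free_module[OF assms] T2_coassoc[of X \<one> \<one>] T0_right[of X] T2_mu[of X \<one>]
    by (simp add: right_hopf_module_def right_comodule_def)
  show "left_hopf_module C T (\<T>\<^sub>o X) (\<mu> X) (\<tau> \<one> X)"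
    using free_module[OF assms] T2_coassoc[of \<one> \<one> X] T0_left[of X] T2_mu[of \<one> X]
    by (simp add: left_hopf_module_def left_comodule_def)
qed

end

section \<open>Coinvariants and integrals\<close>

context category
begin

lemma equalizer_transport:
  assumes eq: "equalizer C E i f g" and j: "j \<in> hom C X E" "iso C j"
  shows "equalizer C X (i \<cdot> j) f g"
proof -
  note [simp] = typing
  have fg [simp]: "f \<in> Ar C" "g \<in> Ar C" "Dom C g = Dom C f" "Cod C g = Cod C f" "E \<in> Ob C"
    "i \<in> Ar C" "Dom C i = E" "Cod C i = Dom C f" and ieq: "f \<cdot> i = g \<cdot> i"
    and uni: "\<And>Z h. Z \<in> Ob C \<Longrightarrow> h \<in> hom C Z (Dom C f) \<Longrightarrow> f \<cdot> h = g \<cdot> h \<Longrightarrow> \<exists>!k. k \<in> hom C Z E \<and> i \<cdot> k = h"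
    using eq by (auto simp: equalizer_def)
  have [simp]: "j \<in> Ar C" "Dom C j = X" "Cod C j = E" using j by auto
  obtain k where k: "k \<in> hom C E X" and kj: "k \<cdot> j = \<langle>X\<rangle>" "j \<cdot> k = \<langle>E\<rangle>"
    using j by (auto simp: iso_def)
  have [simp]: "k \<in> Ar C" "Dom C k = E" "Cod C k = X" "X \<in> Ob C" using k j Dom_Ob[of j] by auto
  show ?thesis unfolding equalizer_def
  proof (intro conjI ballI impI)
    show "f \<cdot> i \<cdot> j = g \<cdot> i \<cdot> j" using ieq by (simp flip: cmp_cmp)
    fix Z h assume Z: "Z \<in> Ob C" and h: "h \<in> hom C Z (Dom C f)" and "f \<cdot> h = g \<cdot> h"
    then obtain m where m: "m \<in> hom C Z E" "i \<cdot> m = h" and u: "\<And>m'. m' \<in> hom C Z E \<Longrightarrow> i \<cdot> m' = h \<Longrightarrow> m' = m"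
      using uni by metis
    have [simp]: "m \<in> Ar C" "Dom C m = Z" "Cod C m = E" using m by auto
    show "\<exists>!n. n \<in> hom C Z X \<and> (i \<cdot> j) \<cdot> n = h"
    proof (rule ex1I)
      have "(i \<cdot> j) \<cdot> k \<cdot> m = i \<cdot> (j \<cdot> k) \<cdot> m" by (simp add: cmp_cmp)
      then show "k \<cdot> m \<in> hom C Z X \<and> (i \<cdot> j) \<cdot> k \<cdot> m = h" using m kj by (simp add: ide_cmp)
      fix n assume n: "n \<in> hom C Z X \<and> (i \<cdot> j) \<cdot> n = h"
      then have [simp]: "n \<in> Ar C" "Dom C n = Z" "Cod C n = X" by auto
      have "j \<cdot> n = m" using n u[of "j \<cdot> n"] by (simp add: cmp_cmp)
      moreover have "(k \<cdot> j) \<cdot> n = k \<cdot> j \<cdot> n" by (simp add: cmp_cmp)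
      ultimately show "n = k \<cdot> m" using kj by (simp add: ide_cmp)
    qed
  qed simp_all
qed

end

section \<open>Bundled dual pairs and the calculus of mates\<close>

type_synonym ('o, 'm) pair = "'o \<times> 'o \<times> 'm \<times> 'm"

abbreviation lt :: "('o, 'm) pair \<Rightarrow> 'o" where "lt P \<equiv> fst P"
abbreviation rt :: "('o, 'm) pair \<Rightarrow> 'o" where "rt P \<equiv> fst (snd P)"
abbreviation pev :: "('o, 'm) pair \<Rightarrow> 'm" where "pev P \<equiv> fst (snd (snd P))"
abbreviation pcoev :: "('o, 'm) pair \<Rightarrow> 'm" where "pcoev P \<equiv> snd (snd (snd P))"

context monoidal_category
begin

abbreviation dpair :: "('o, 'm) pair \<Rightarrow> bool" where
  "dpair P \<equiv> dual_pair (lt P) (rt P) (pev P) (pcoev P)"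

text \<open>A relation takes the place of a duality functor: once the two pairs are fixed, either
  morphism determines the other, so an argument can move to whichever side is convenient without
  comparing different choices of duals.\<close>

definition mates :: "('o, 'm) pair \<Rightarrow> ('o, 'm) pair \<Rightarrow> 'm \<Rightarrow> 'm \<Rightarrow> bool" where
  "mates P Q f g \<longleftrightarrow> f \<in> hom C (lt P) (lt Q) \<and> g \<in> hom C (rt Q) (rt P) \<and>
    pev Q \<cdot> f \<otimes> \<langle>rt Q\<rangle> = pev P \<cdot> \<langle>lt P\<rangle> \<otimes> g"

lemma mates_typ:
  assumes "mates P Q f g"
  shows "f \<in> Ar C" "Dom C f = lt P" "Cod C f = lt Q" "g \<in> Ar C" "Dom C g = rt Q" "Cod C g = rt P"
  using assms by (auto simp: mates_def hom_def)

lemma mates_left: "dpair P \<Longrightarrow> dpair Q \<Longrightarrow> g \<in> hom C (rt Q) (rt P) \<Longrightarrow> \<exists>f. mates P Q f g"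
  using mate_left_exists[of "lt P" "rt P" "pev P" "pcoev P" "lt Q" "rt Q" "pev Q" "pcoev Q" g]
  unfolding mates_def by metis

lemma mates_right: "dpair P \<Longrightarrow> dpair Q \<Longrightarrow> f \<in> hom C (lt P) (lt Q) \<Longrightarrow> \<exists>g. mates P Q f g"
  using mate_right_exists[of "lt P" "rt P" "pev P" "pcoev P" "lt Q" "rt Q" "pev Q" "pcoev Q" f]
  unfolding mates_def by metis

lemma mates_left_unique: "dpair Q \<Longrightarrow> mates P Q f g \<Longrightarrow> mates P Q f' g \<Longrightarrow> f = f'"
  using pairing_eq_left[of "lt Q" "rt Q" "pev Q" "pcoev Q" f "lt P" f'] by (auto simp: mates_def)

lemma mates_right_unique: "dpair P \<Longrightarrow> mates P Q f g \<Longrightarrow> mates P Q f g' \<Longrightarrow> g = g'"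
  using pairing_eq_right[of "lt P" "rt P" "pev P" "pcoev P" g "rt Q" g'] by (auto simp: mates_def)

lemma mates_cmp:
  assumes "dpair P" "dpair Q" "dpair R" "mates P Q f g" "mates Q R f' g'"
  shows "mates P R (f' \<cdot> f) (g \<cdot> g')"
  using mate_cmp[OF assms(1-3), of f f' g g'] assms(4,5) unfolding mates_def by (auto simp: typing)

lemma mates_ide: "dpair P \<Longrightarrow> mates P P \<langle>lt P\<rangle> \<langle>rt P\<rangle>"
  by (auto simp: mates_def typing dual_pair_typ)

lemma mates_inverse:
  assumes P: "dpair P" and Q: "dpair Q" and m: "mates P Q f g" "mates Q P f' g'" and f: "f' \<cdot> f = \<langle>lt P\<rangle>"
  shows "g \<cdot> g' = \<langle>rt P\<rangle>"
  using mates_cmp[OF P Q P m] mates_ide[OF P] mates_right_unique[OF P] unfolding f by blast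

end

context autonomous_category
begin

definition rpair :: "'o \<Rightarrow> ('o, 'm) pair" where
  "rpair X = (X, rdual C X, evr C X, coevr C X)"

definition lpair :: "'o \<Rightarrow> ('o, 'm) pair" where
  "lpair X = (ldual C X, X, evl C X, coevl C X)"

lemma rpair_simps [simp]: "lt (rpair X) = X" "rt (rpair X) = rdual C X" "pev (rpair X) = evr C X"
  "pcoev (rpair X) = coevr C X"
  by (simp_all add: rpair_def)

lemma lpair_simps [simp]: "lt (lpair X) = ldual C X" "rt (lpair X) = X" "pev (lpair X) = evl C X"
  "pcoev (lpair X) = coevl C X"
  by (simp_all add: lpair_def)

lemma dpair_rpair: "X \<in> Ob C \<Longrightarrow> dpair (rpair X)" by (simp add: rdual_pair)

lemma dpair_lpair: "X \<in> Ob C \<Longrightarrow> dpair (lpair X)" by (simp add: ldual_pair)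

lemma mates_rdual_mor: "f \<in> hom C X Y \<Longrightarrow> mates (rpair X) (rpair Y) f (rdual_mor C f)"
  using rdual_mor_pairing[of f X Y] by (auto simp: mates_def typing)

end

section \<open>Coinvariance under duality\<close>

context bimonad
begin

text \<open>Transposing along the two pairings, \<open>1\<close> and \<open>2\<close> turn the sides
  of both equations into the same two morphisms from \<open>M \<otimes> Z\<close> to
  \<open>A\<close>. For \<delta> equal to \<open>\<tau> \<one> X\<close> the equation for
  \<open>f\<close> is that of a left integral.\<close>

lemma coinvariant_into_dual:
  assumes P: "dpair P" and S: "dpair S" and m: "mates P S f g"
    and \<delta>: "\<delta> \<in> hom C (lt P) (A \<otimes>\<^sub>o lt P)" and \<rho>: "\<rho> \<in> hom C (rt P) (rt P \<otimes>\<^sub>o A)"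
    and R: "pev P \<otimes> \<langle>A\<rangle> \<cdot> \<langle>lt P\<rangle> \<otimes> \<rho> = \<langle>A\<rangle> \<otimes> pev P \<cdot> \<delta> \<otimes> \<langle>rt P\<rangle>"
  shows "\<rho> \<cdot> g = \<langle>rt P\<rangle> \<otimes> \<eta> \<one> \<cdot> g \<longleftrightarrow> \<langle>A\<rangle> \<otimes> f \<cdot> \<delta> = \<eta> \<one> \<otimes> f"
proof -
  obtain M N e c W Z e' c' where PS: "P = (M, N, e, c)" "S = (W, Z, e', c')" by (metis prod_cases4)
  note d = P[unfolded PS, simplified] and d' = S[unfolded PS, simplified]
  note R = R[unfolded PS, simplified]
  note [simp] = typing dual_pair_typ[OF d] dual_pair_typ[OF d'] PS
  have [simp]: "\<delta> \<in> Ar C" "Dom C \<delta> = M" "Cod C \<delta> = A \<otimes>\<^sub>o M" "\<rho> \<in> Ar C" "Dom C \<rho> = N" "Cod C \<rho> = N \<otimes>\<^sub>o A"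
    using \<delta> \<rho> by auto
  have [simp]: "f \<in> Ar C" "Dom C f = M" "Cod C f = W" "g \<in> Ar C" "Dom C g = Z" "Cod C g = N"
    using mates_typ[OF m] by auto
  have m: "e \<cdot> \<langle>M\<rangle> \<otimes> g = e' \<cdot> f \<otimes> \<langle>Z\<rangle>" using m by (simp add: mates_def)
  have 1: "e \<otimes> \<langle>A\<rangle> \<cdot> \<langle>M\<rangle> \<otimes> (\<rho> \<cdot> g) = \<langle>A\<rangle> \<otimes> e' \<cdot> (\<langle>A\<rangle> \<otimes> f \<cdot> \<delta>) \<otimes> \<langle>Z\<rangle>"
  proof -
    have "e \<otimes> \<langle>A\<rangle> \<cdot> \<langle>M\<rangle> \<otimes> (\<rho> \<cdot> g) = (e \<otimes> \<langle>A\<rangle> \<cdot> \<langle>M\<rangle> \<otimes> \<rho>) \<cdot> \<langle>M\<rangle> \<otimes> g"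
      by (simp add: whisker_left cmp_cmp)
    also have "\<dots> = \<langle>A\<rangle> \<otimes> e \<cdot> \<langle>A \<otimes>\<^sub>o M\<rangle> \<otimes> g \<cdot> \<delta> \<otimes> \<langle>Z\<rangle>"
      unfolding R by (simp add: interchange_simps)
    also have "\<dots> = \<langle>A\<rangle> \<otimes> (e \<cdot> \<langle>M\<rangle> \<otimes> g) \<cdot> \<delta> \<otimes> \<langle>Z\<rangle>"
      by (simp add: whisker_left regroup_simps cmp_cmp)
    also have "\<dots> = \<langle>A\<rangle> \<otimes> e' \<cdot> (\<langle>A\<rangle> \<otimes> f \<cdot> \<delta>) \<otimes> \<langle>Z\<rangle>"
      unfolding m by (simp add: whisker_left whisker_right regroup_simps cmp_cmp)
    finally show ?thesis .
  qed
  have 2: "e \<otimes> \<langle>A\<rangle> \<cdot> \<langle>M\<rangle> \<otimes> (\<langle>N\<rangle> \<otimes> \<eta> \<one> \<cdot> g) = \<langle>A\<rangle> \<otimes> e' \<cdot> (\<eta> \<one> \<otimes> f) \<otimes> \<langle>Z\<rangle>"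
  proof -
    have "e \<otimes> \<langle>A\<rangle> \<cdot> \<langle>M\<rangle> \<otimes> (\<langle>N\<rangle> \<otimes> \<eta> \<one> \<cdot> g) = (e \<otimes> \<langle>A\<rangle> \<cdot> \<langle>M \<otimes>\<^sub>o N\<rangle> \<otimes> \<eta> \<one>) \<cdot> \<langle>M\<rangle> \<otimes> g"
      by (simp add: whisker_left regroup_simps cmp_cmp)
    also have "e \<otimes> \<langle>A\<rangle> \<cdot> \<langle>M \<otimes>\<^sub>o N\<rangle> \<otimes> \<eta> \<one> = \<eta> \<one> \<cdot> e"
      using slide_counit[of e "M \<otimes>\<^sub>o N" "\<eta> \<one>" \<one> A] by (simp add: unit_right)
    also have "(\<eta> \<one> \<cdot> e) \<cdot> \<langle>M\<rangle> \<otimes> g = \<eta> \<one> \<cdot> e' \<cdot> f \<otimes> \<langle>Z\<rangle>"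
      using m by (simp add: cmp_cmp)
    also have "\<dots> = (\<langle>A\<rangle> \<otimes> e' \<cdot> \<eta> \<one> \<otimes> \<langle>W \<otimes>\<^sub>o Z\<rangle>) \<cdot> f \<otimes> \<langle>Z\<rangle>"
      using slide_counit'[of e' "W \<otimes>\<^sub>o Z" "\<eta> \<one>" \<one> A] by (simp add: unit_left cmp_cmp)
    also have "\<dots> = \<langle>A\<rangle> \<otimes> e' \<cdot> ((\<eta> \<one> \<otimes> \<langle>W\<rangle>) \<otimes> \<langle>Z\<rangle>) \<cdot> ((\<langle>\<one>\<rangle> \<otimes> f) \<otimes> \<langle>Z\<rangle>)"
      by (simp add: regroup_simps cmp_cmp)
    also have "\<dots> = \<langle>A\<rangle> \<otimes> e' \<cdot> (\<eta> \<one> \<otimes> \<langle>W\<rangle> \<cdot> \<langle>\<one>\<rangle> \<otimes> f) \<otimes> \<langle>Z\<rangle>"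
      by (simp add: whisker_right unit_left)
    also have "\<eta> \<one> \<otimes> \<langle>W\<rangle> \<cdot> \<langle>\<one>\<rangle> \<otimes> f = \<eta> \<one> \<otimes> f"
      using tensor_cmp_ide(1)[of "\<eta> \<one>" f] by simp
    finally show ?thesis .
  qed
  show ?thesis
  proof
    assume "\<rho> \<cdot> g = \<langle>rt P\<rangle> \<otimes> \<eta> \<one> \<cdot> g"
    then have "\<langle>A\<rangle> \<otimes> e' \<cdot> (\<langle>A\<rangle> \<otimes> f \<cdot> \<delta>) \<otimes> \<langle>Z\<rangle> = \<langle>A\<rangle> \<otimes> e' \<cdot> (\<eta> \<one> \<otimes> f) \<otimes> \<langle>Z\<rangle>"
      unfolding 1[symmetric] 2[symmetric] by simp
    then show "\<langle>A\<rangle> \<otimes> f \<cdot> \<delta> = \<eta> \<one> \<otimes> f"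
      by (elim pairing_inject_left[OF d', rotated -1]) simp_all
  next
    assume "\<langle>A\<rangle> \<otimes> f \<cdot> \<delta> = \<eta> \<one> \<otimes> f"
    then have "e \<otimes> \<langle>A\<rangle> \<cdot> \<langle>M\<rangle> \<otimes> (\<rho> \<cdot> g) = e \<otimes> \<langle>A\<rangle> \<cdot> \<langle>M\<rangle> \<otimes> (\<langle>N\<rangle> \<otimes> \<eta> \<one> \<cdot> g)"
      unfolding 1 2 by simp
    then have "\<rho> \<cdot> g = \<langle>N\<rangle> \<otimes> \<eta> \<one> \<cdot> g"
      by (elim pairing_inject_right[OF d, rotated -1]) simp_all
    then show "\<rho> \<cdot> g = \<langle>rt P\<rangle> \<otimes> \<eta> \<one> \<cdot> g" by simp
  qed
qed

text \<open>The companion for morphisms leaving the dual: the equation of a right integral, relative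
  to \<rho>, transposes to coinvariance in the left comodule. This is how coinvariants of a free
  left Hopf module come to control right integrals.\<close>

lemma coinvariant_out_of_dual:
  assumes P: "dpair P" and S: "dpair S" and m: "mates S P d f"
    and \<delta>: "\<delta> \<in> hom C (lt P) (A \<otimes>\<^sub>o lt P)" and \<rho>: "\<rho> \<in> hom C (rt P) (rt P \<otimes>\<^sub>o A)"
    and R: "pev P \<otimes> \<langle>A\<rangle> \<cdot> \<langle>lt P\<rangle> \<otimes> \<rho> = \<langle>A\<rangle> \<otimes> pev P \<cdot> \<delta> \<otimes> \<langle>rt P\<rangle>"
  shows "f \<otimes> \<langle>A\<rangle> \<cdot> \<rho> = f \<otimes> \<eta> \<one> \<longleftrightarrow> \<delta> \<cdot> d = \<eta> \<one> \<otimes> \<langle>lt P\<rangle> \<cdot> d"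
proof -
  obtain M N e c V W e' c' where PS: "P = (M, N, e, c)" "S = (V, W, e', c')" by (metis prod_cases4)
  note d = P[unfolded PS, simplified] and d' = S[unfolded PS, simplified]
  note R = R[unfolded PS, simplified]
  note [simp] = typing dual_pair_typ[OF d] dual_pair_typ[OF d'] PS
  have [simp]: "\<delta> \<in> Ar C" "Dom C \<delta> = M" "Cod C \<delta> = A \<otimes>\<^sub>o M" "\<rho> \<in> Ar C" "Dom C \<rho> = N" "Cod C \<rho> = N \<otimes>\<^sub>o A"
    using \<delta> \<rho> by auto
  have [simp]: "d \<in> Ar C" "Dom C d = V" "Cod C d = M" "f \<in> Ar C" "Dom C f = N" "Cod C f = W"
    using mates_typ[OF m] by auto
  have m: "e \<cdot> d \<otimes> \<langle>N\<rangle> = e' \<cdot> \<langle>V\<rangle> \<otimes> f" using m by (simp add: mates_def)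
  have 1: "\<langle>A\<rangle> \<otimes> e \<cdot> (\<delta> \<cdot> d) \<otimes> \<langle>N\<rangle> = e' \<otimes> \<langle>A\<rangle> \<cdot> \<langle>V\<rangle> \<otimes> (f \<otimes> \<langle>A\<rangle> \<cdot> \<rho>)"
  proof -
    have "\<langle>A\<rangle> \<otimes> e \<cdot> (\<delta> \<cdot> d) \<otimes> \<langle>N\<rangle> = (\<langle>A\<rangle> \<otimes> e \<cdot> \<delta> \<otimes> \<langle>N\<rangle>) \<cdot> d \<otimes> \<langle>N\<rangle>"
      by (simp add: whisker_right cmp_cmp)
    also have "\<dots> = e \<otimes> \<langle>A\<rangle> \<cdot> d \<otimes> \<langle>N \<otimes>\<^sub>o A\<rangle> \<cdot> \<langle>V\<rangle> \<otimes> \<rho>"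
      unfolding R[symmetric] by (simp add: interchange_simps)
    also have "\<dots> = (e \<cdot> d \<otimes> \<langle>N\<rangle>) \<otimes> \<langle>A\<rangle> \<cdot> \<langle>V\<rangle> \<otimes> \<rho>"
      by (simp add: whisker_right regroup_simps cmp_cmp)
    also have "\<dots> = e' \<otimes> \<langle>A\<rangle> \<cdot> \<langle>V\<rangle> \<otimes> (f \<otimes> \<langle>A\<rangle> \<cdot> \<rho>)"
      unfolding m by (simp add: whisker_left whisker_right regroup_simps cmp_cmp)
    finally show ?thesis .
  qed
  have 2: "\<langle>A\<rangle> \<otimes> e \<cdot> (\<eta> \<one> \<otimes> \<langle>M\<rangle> \<cdot> d) \<otimes> \<langle>N\<rangle> = e' \<otimes> \<langle>A\<rangle> \<cdot> \<langle>V\<rangle> \<otimes> (f \<otimes> \<eta> \<one>)"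
  proof -
    have "\<langle>A\<rangle> \<otimes> e \<cdot> (\<eta> \<one> \<otimes> \<langle>M\<rangle> \<cdot> d) \<otimes> \<langle>N\<rangle> = (\<langle>A\<rangle> \<otimes> e \<cdot> \<eta> \<one> \<otimes> \<langle>M \<otimes>\<^sub>o N\<rangle>) \<cdot> d \<otimes> \<langle>N\<rangle>"
      by (simp add: whisker_right regroup_simps cmp_cmp)
    also have "\<langle>A\<rangle> \<otimes> e \<cdot> \<eta> \<one> \<otimes> \<langle>M \<otimes>\<^sub>o N\<rangle> = \<eta> \<one> \<cdot> e"
      using slide_counit'[of e "M \<otimes>\<^sub>o N" "\<eta> \<one>" \<one> A] by (simp add: unit_left)
    also have "(\<eta> \<one> \<cdot> e) \<cdot> d \<otimes> \<langle>N\<rangle> = (\<eta> \<one> \<cdot> e') \<cdot> \<langle>V\<rangle> \<otimes> f"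
      using m by (simp add: cmp_cmp)
    also have "\<eta> \<one> \<cdot> e' = e' \<otimes> \<langle>A\<rangle> \<cdot> \<langle>V \<otimes>\<^sub>o W\<rangle> \<otimes> \<eta> \<one>"
      using slide_counit[of e' "V \<otimes>\<^sub>o W" "\<eta> \<one>" \<one> A] by (simp add: unit_right)
    also have "(e' \<otimes> \<langle>A\<rangle> \<cdot> \<langle>V \<otimes>\<^sub>o W\<rangle> \<otimes> \<eta> \<one>) \<cdot> \<langle>V\<rangle> \<otimes> f = e' \<otimes> \<langle>A\<rangle> \<cdot> \<langle>V\<rangle> \<otimes> (\<langle>W\<rangle> \<otimes> \<eta> \<one> \<cdot> f \<otimes> \<langle>\<one>\<rangle>)"
      by (simp add: whisker_left regroup_simps cmp_cmp)
    also have "\<langle>W\<rangle> \<otimes> \<eta> \<one> \<cdot> f \<otimes> \<langle>\<one>\<rangle> = f \<otimes> \<eta> \<one>"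
      using tensor_cmp_ide(2)[of f "\<eta> \<one>"] by simp
    finally show ?thesis .
  qed
  show ?thesis
  proof
    assume "f \<otimes> \<langle>A\<rangle> \<cdot> \<rho> = f \<otimes> \<eta> \<one>"
    then have "\<langle>A\<rangle> \<otimes> e \<cdot> (\<delta> \<cdot> d) \<otimes> \<langle>N\<rangle> = \<langle>A\<rangle> \<otimes> e \<cdot> (\<eta> \<one> \<otimes> \<langle>M\<rangle> \<cdot> d) \<otimes> \<langle>N\<rangle>"
      unfolding 1 2 by simp
    then have "\<delta> \<cdot> d = \<eta> \<one> \<otimes> \<langle>M\<rangle> \<cdot> d"
      by (elim pairing_inject_left[OF d, rotated -1]) simp_all
    then show "\<delta> \<cdot> d = \<eta> \<one> \<otimes> \<langle>lt P\<rangle> \<cdot> d" by simp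
  next
    assume "\<delta> \<cdot> d = \<eta> \<one> \<otimes> \<langle>lt P\<rangle> \<cdot> d"
    then have "e' \<otimes> \<langle>A\<rangle> \<cdot> \<langle>V\<rangle> \<otimes> (f \<otimes> \<langle>A\<rangle> \<cdot> \<rho>) = e' \<otimes> \<langle>A\<rangle> \<cdot> \<langle>V\<rangle> \<otimes> (f \<otimes> \<eta> \<one>)"
      unfolding 1[symmetric] 2[symmetric] by simp
    then show "f \<otimes> \<langle>A\<rangle> \<cdot> \<rho> = f \<otimes> \<eta> \<one>"
      by (elim pairing_inject_right[OF d', rotated -1]) simp_all
  qed
qed

end

context category
begin

lemma equalizer_factor:
  assumes "equalizer C E i f g" "h \<in> hom C Z (Dom C f)" "f \<cdot> h = g \<cdot> h"
  obtains k where "k \<in> hom C Z E" "i \<cdot> k = h" "\<And>k'. k' \<in> hom C Z E \<Longrightarrow> i \<cdot> k' = h \<Longrightarrow> k' = k"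
proof -
  have "Z \<in> Ob C" using assms(2) Dom_Ob by (auto simp: hom_def)
  then have "\<exists>!k. k \<in> hom C Z E \<and> i \<cdot> k = h"
    using assms unfolding equalizer_def by blast
  then show thesis using that by blast
qed

end

section \<open>Integrals with a fixed source object\<close>

context bimonad
begin

text \<open>A single component of an integral, with an arbitrary target object. Dependence on
  \<open>X\<close> is left aside and is recovered later from the uniqueness of
  factorizations.\<close>

definition left_integral_at :: "'o \<Rightarrow> 'o \<Rightarrow> 'm \<Rightarrow> bool" where
  "left_integral_at X W c \<longleftrightarrow> c \<in> hom C (\<T>\<^sub>o X) W \<and> \<langle>A\<rangle> \<otimes> c \<cdot> \<tau> \<one> X = \<eta> \<one> \<otimes> c"

definition right_integral_at :: "'o \<Rightarrow> 'o \<Rightarrow> 'm \<Rightarrow> bool" where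
  "right_integral_at X W c \<longleftrightarrow> c \<in> hom C (\<T>\<^sub>o X) W \<and> c \<otimes> \<langle>A\<rangle> \<cdot> \<tau> X \<one> = c \<otimes> \<eta> \<one>"

text \<open>The test targets are single objects and not functors. Duality delivers universality in
  this form, and it makes the value at each \<open>X\<close> unique up to isomorphism.\<close>

definition universal_left_at :: "'o \<Rightarrow> 'o \<Rightarrow> 'm \<Rightarrow> bool" where
  "universal_left_at X I l \<longleftrightarrow> left_integral_at X I l \<and>
    (\<forall>W c. left_integral_at X W c \<longrightarrow> (\<exists>!f. f \<in> hom C I W \<and> f \<cdot> l = c))"

definition universal_right_at :: "'o \<Rightarrow> 'o \<Rightarrow> 'm \<Rightarrow> bool" where
  "universal_right_at X I l \<longleftrightarrow> right_integral_at X I l \<and>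
    (\<forall>W c. right_integral_at X W c \<longrightarrow> (\<exists>!f. f \<in> hom C I W \<and> f \<cdot> l = c))"

end

context hopf_monad
begin

text \<open>The last equation says that \<rho> is the transpose of the free left coaction
  \<open>\<tau> \<one> X\<close>. It determines \<rho>, so no explicit formula is carried
  along.\<close>

definition dual_coaction :: "'o \<Rightarrow> ('o, 'm) pair \<Rightarrow> 'm \<Rightarrow> bool" where
  "dual_coaction X P \<rho> \<longleftrightarrow> X \<in> Ob C \<and> dpair P \<and> lt P = \<T>\<^sub>o X \<and> \<rho> \<in> hom C (rt P) (rt P \<otimes>\<^sub>o A) \<and>
    pev P \<otimes> \<langle>A\<rangle> \<cdot> \<langle>lt P\<rangle> \<otimes> \<rho> = \<langle>A\<rangle> \<otimes> pev P \<cdot> \<tau> \<one> X \<otimes> \<langle>rt P\<rangle>"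

lemma dual_coactionD:
  assumes "dual_coaction X P \<rho>"
  shows "X \<in> Ob C" "dpair P" "lt P = \<T>\<^sub>o X" "\<rho> \<in> Ar C" "Dom C \<rho> = rt P" "Cod C \<rho> = rt P \<otimes>\<^sub>o A"
    "pev P \<otimes> \<langle>A\<rangle> \<cdot> \<langle>lt P\<rangle> \<otimes> \<rho> = \<langle>A\<rangle> \<otimes> pev P \<cdot> \<tau> \<one> X \<otimes> \<langle>rt P\<rangle>"
  using assms by (auto simp: dual_coaction_def hom_def)

lemma coinvariant_iff_left_integral:
  assumes "dual_coaction X P \<rho>" "dpair S" "mates P S c g"
  shows "\<rho> \<cdot> g = \<langle>rt P\<rangle> \<otimes> \<eta> \<one> \<cdot> g \<longleftrightarrow> left_integral_at X (lt S) c"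
  using coinvariant_into_dual[OF dual_coactionD(2)[OF assms(1)] assms(2,3), of "\<tau> \<one> X" \<rho>]
    dual_coactionD[OF assms(1)] mates_typ[OF assms(3)]
  by (simp add: left_integral_at_def typing)

text \<open>Passing to mates reverses arrows: factorizations of \<open>g\<close> through
  \<open>i\<close> become factorizations of \<open>c\<close> through \<open>l\<close>, and
  coinvariance becomes the integral equation. The test object \<open>W\<close> is replaced by its
  right dual.\<close>

lemma universal_left_of_equalizer:
  assumes \<rho>: "dual_coaction X P \<rho>" and Q: "dpair Q" and m: "mates P Q l i"
    and eq: "equalizer C (rt Q) i \<rho> (\<langle>rt P\<rangle> \<otimes> \<eta> \<one>)"
  shows "universal_left_at X (lt Q) l"
  unfolding universal_left_at_def
proof (intro conjI allI impI)
  note P = dual_coactionD(2)[OF \<rho>]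
  note [simp] = typing dual_pair_typ[OF P] dual_pair_typ[OF Q] dual_coactionD(1-6)[OF \<rho>] mates_typ[OF m]
  show "left_integral_at X (lt Q) l"
    using coinvariant_iff_left_integral[OF \<rho> Q m] eq by (auto simp: equalizer_def)
  fix W c assume c: "left_integral_at X W c"
  then have c_hom: "c \<in> hom C (lt P) W" by (simp add: left_integral_at_def)
  then have W: "W \<in> Ob C" using Cod_Ob by auto
  note S = dpair_rpair[OF W]
  obtain g where g: "mates P (rpair W) c g" using mates_right[OF P S] c_hom by auto
  have "\<rho> \<cdot> g = \<langle>rt P\<rangle> \<otimes> \<eta> \<one> \<cdot> g"
    using coinvariant_iff_left_integral[OF \<rho> S g] c by simp
  then obtain k where k: "k \<in> hom C (rdual C W) (rt Q)" "i \<cdot> k = g"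
    and uk: "\<And>k'. k' \<in> hom C (rdual C W) (rt Q) \<Longrightarrow> i \<cdot> k' = g \<Longrightarrow> k' = k"
    using equalizer_factor[OF eq, of g "rdual C W"] mates_typ[OF g] by (auto simp: hom_def)
  obtain f where f: "mates Q (rpair W) f k" using mates_left[OF Q S] k by auto
  show "\<exists>!f. f \<in> hom C (lt Q) W \<and> f \<cdot> l = c"
  proof (rule ex1I)
    have "mates P (rpair W) (f \<cdot> l) g" using mates_cmp[OF P Q S m f] k by simp
    then show "f \<in> hom C (lt Q) W \<and> f \<cdot> l = c"
      using mates_left_unique[OF S _ g] mates_typ[OF f] by (simp add: hom_def)
    fix f' assume f': "f' \<in> hom C (lt Q) W \<and> f' \<cdot> l = c"
    obtain k' where k': "mates Q (rpair W) f' k'" using mates_right[OF Q S] f' by auto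
    have "i \<cdot> k' = g" using mates_cmp[OF P Q S m k'] f' mates_right_unique[OF P g] by simp
    then have "k' = k" using uk mates_typ[OF k'] by (simp add: hom_def)
    then show "f' = f" using mates_left_unique[OF S] f k' by blast
  qed
qed

text \<open>The converse lets an arbitrary universal integral be used later, not only one built from
  coinvariants. The test object now lies on the right of its pair, so its left dual is
  taken.\<close>

lemma equalizer_of_universal_left:
  assumes \<rho>: "dual_coaction X P \<rho>" and Q: "dpair Q" and m: "mates P Q l i"
    and l: "universal_left_at X (lt Q) l"
  shows "equalizer C (rt Q) i \<rho> (\<langle>rt P\<rangle> \<otimes> \<eta> \<one>)"
  unfolding equalizer_def
proof (intro conjI ballI impI)
  note P = dual_coactionD(2)[OF \<rho>]
  note [simp] = typing dual_pair_typ[OF P] dual_pair_typ[OF Q] dual_coactionD(1-6)[OF \<rho>] mates_typ[OF m]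
  show "\<rho> \<cdot> i = \<langle>rt P\<rangle> \<otimes> \<eta> \<one> \<cdot> i"
    using coinvariant_iff_left_integral[OF \<rho> Q m] l by (simp add: universal_left_at_def)
  fix Z g assume Z: "Z \<in> Ob C" and g: "g \<in> hom C Z (Dom C \<rho>)" and eq: "\<rho> \<cdot> g = \<langle>rt P\<rangle> \<otimes> \<eta> \<one> \<cdot> g"
  note S = dpair_lpair[OF Z]
  obtain c where c: "mates P (lpair Z) c g" using mates_left[OF P S] g by auto
  have "left_integral_at X (ldual C Z) c"
    using coinvariant_iff_left_integral[OF \<rho> S c] eq by simp
  then obtain f where f: "f \<in> hom C (lt Q) (ldual C Z)" "f \<cdot> l = c"
    and uf: "\<And>f'. f' \<in> hom C (lt Q) (ldual C Z) \<Longrightarrow> f' \<cdot> l = c \<Longrightarrow> f' = f"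
    using l unfolding universal_left_at_def by metis
  obtain k where k: "mates Q (lpair Z) f k" using mates_right[OF Q S] f by auto
  show "\<exists>!k. k \<in> hom C Z (rt Q) \<and> i \<cdot> k = g"
  proof (rule ex1I)
    have "mates P (lpair Z) c (i \<cdot> k)" using mates_cmp[OF P Q S m k] f by simp
    then show "k \<in> hom C Z (rt Q) \<and> i \<cdot> k = g"
      using mates_right_unique[OF P _ c] mates_typ[OF k] by (simp add: hom_def)
    fix k' assume k': "k' \<in> hom C Z (rt Q) \<and> i \<cdot> k' = g"
    obtain f' where f': "mates Q (lpair Z) f' k'" using mates_left[OF Q S] k' by auto
    have "f' \<cdot> l = c" using mates_cmp[OF P Q S m f'] k' mates_left_unique[OF S _ c] by simp
    then have "f' = f" using uf mates_typ[OF f'] by (simp add: hom_def)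
    then show "k' = k" using mates_right_unique[OF Q] k f' by blast
  qed
qed (use dual_coactionD(1-6)[OF \<rho>] dual_pair_typ[OF Q] mates_typ[OF m] dual_pair_typ[OF dual_coactionD(2)[OF \<rho>]]
    in \<open>simp_all add: typing\<close>)

text \<open>The right dual of the free left Hopf module on \<open>X\<close> is a right Hopf module, whose coinvariants
  classify the left integrals out of \<open>T X\<close>.\<close>

lemma dual_free_hopf_module:
  assumes X: "X \<in> Ob C"
  obtains q \<rho> where "dual_coaction X (rpair (\<T>\<^sub>o X)) \<rho>"
    "right_hopf_module C T (rdual C (\<T>\<^sub>o X)) q \<rho>" "q \<in> hom C (\<T>\<^sub>o (rdual C (\<T>\<^sub>o X))) (rdual C (\<T>\<^sub>o X))"
    "evr C (\<T>\<^sub>o X) \<cdot> \<mu> X \<otimes> q \<cdot> \<tau> (\<T>\<^sub>o X) (rdual C (\<T>\<^sub>o X)) = \<epsilon> \<cdot> \<T> (evr C (\<T>\<^sub>o X))"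
proof -
  note [simp] = typing X
  let ?M = "\<T>\<^sub>o X" and ?N = "rdual C (\<T>\<^sub>o X)"
  obtain q where q: "q \<in> hom C (\<T>\<^sub>o ?N) ?N" "evr C ?M \<cdot> \<mu> X \<otimes> q \<cdot> \<tau> ?M ?N = \<epsilon> \<cdot> \<T> (evr C ?M)"
    using dual_action_exists[OF free_module[OF X]] by blast
  have d: "dual_pair ?M ?N (evr C ?M) (coevr C ?M)" by (intro rdual_pair) simp
  obtain \<rho> where \<rho>: "\<rho> \<in> hom C ?N (?N \<otimes>\<^sub>o A)" "evr C ?M \<otimes> \<langle>A\<rangle> \<cdot> \<langle>?M\<rangle> \<otimes> \<rho> = \<langle>A\<rangle> \<otimes> evr C ?M \<cdot> \<tau> \<one> X \<otimes> \<langle>?N\<rangle>"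
    using pairing_surject_right[OF d, of "\<langle>A\<rangle> \<otimes> evr C ?M \<cdot> \<tau> \<one> X \<otimes> \<langle>?N\<rangle>" ?N A] by auto
  have "dual_coaction X (rpair ?M) \<rho>"
    using \<rho> d by (simp add: dual_coaction_def)
  with dual_hopf_module[OF d free_hopf_module(2)[OF X] q \<rho>] q show thesis using that by blast
qed

lemma universal_left_exists:
  assumes adm: "right_hopf_modules_admit_preserved_coinvariants C T" and X: "X \<in> Ob C"
  shows "\<exists>I l. universal_left_at X I l"
proof -
  obtain q \<rho> where \<rho>: "dual_coaction X (rpair (\<T>\<^sub>o X)) \<rho>"
    and h: "right_hopf_module C T (rdual C (\<T>\<^sub>o X)) q \<rho>"
    using dual_free_hopf_module[OF X] by metis
  obtain E i where eq: "equalizer C E i \<rho> (\<langle>rdual C (\<T>\<^sub>o X)\<rangle> \<otimes> \<eta> \<one>)"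
    using adm h unfolding right_hopf_modules_admit_preserved_coinvariants_def by blast
  then have E: "E \<in> Ob C" and i: "i \<in> hom C E (rdual C (\<T>\<^sub>o X))"
    using dual_coactionD(5)[OF \<rho>] by (auto simp: equalizer_def)
  obtain l where "mates (rpair (\<T>\<^sub>o X)) (lpair E) l i"
    using mates_left[OF dual_coactionD(2)[OF \<rho>] dpair_lpair[OF E]] i by auto
  from universal_left_of_equalizer[OF \<rho> dpair_lpair[OF E] this] eq show ?thesis by auto
qed

text \<open>The unit \<open>\<eta> X\<close> is coinvariant and hence factors as
  \<open>i \<cdot> j\<close>. By the unit law of \<mu>, the morphism \<open>\<T> j\<close> is a
  right inverse of the decomposition isomorphism \<open>\<mu> X \<cdot> \<T> i\<close>, so it is an
  isomorphism; conservativity then applies to \<open>j\<close>.\<close>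

lemma free_coinvariants:
  assumes adm: "right_hopf_modules_admit_preserved_coinvariants C T" and cons: "conservative C T"
    and X: "X \<in> Ob C"
  shows "equalizer C X (\<eta> X) (\<tau> X \<one>) (\<langle>\<T>\<^sub>o X\<rangle> \<otimes> \<eta> \<one>)"
proof -
  note [simp] = typing X
  note h = free_hopf_module(1)[OF X]
  obtain E i where eq: "equalizer C E i (\<tau> X \<one>) (\<langle>\<T>\<^sub>o X\<rangle> \<otimes> \<eta> \<one>)"
    and Teq: "equalizer C (\<T>\<^sub>o E) (\<T> i) (\<T> (\<tau> X \<one>)) (\<T> (\<langle>\<T>\<^sub>o X\<rangle> \<otimes> \<eta> \<one>))"
    using adm h unfolding right_hopf_modules_admit_preserved_coinvariants_def by blast
  obtain \<psi> where \<psi>: "\<psi> \<in> hom C (\<T>\<^sub>o X) (\<T>\<^sub>o E)" "(\<mu> X \<cdot> \<T> i) \<cdot> \<psi> = \<langle>\<T>\<^sub>o X\<rangle>" "\<psi> \<cdot> (\<mu> X \<cdot> \<T> i) = \<langle>\<T>\<^sub>o E\<rangle>"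
    using hopf_module_decomposition[OF h eq Teq] by blast
  have [simp]: "i \<in> Ar C" "Dom C i = E" "Cod C i = \<T>\<^sub>o X" "E \<in> Ob C"
    using eq by (auto simp: equalizer_def)
  have [simp]: "\<psi> \<in> Ar C" "Dom C \<psi> = \<T>\<^sub>o X" "Cod C \<psi> = \<T>\<^sub>o E" using \<psi> by auto
  have "\<langle>\<T>\<^sub>o X\<rangle> \<otimes> \<eta> \<one> \<cdot> \<eta> X \<otimes> \<langle>\<one>\<rangle> = \<eta> X \<otimes> \<eta> \<one>"
    using tensor_cmp_ide(2)[of "\<eta> X" "\<eta> \<one>"] by simp
  then have "\<tau> X \<one> \<cdot> \<eta> X = \<langle>\<T>\<^sub>o X\<rangle> \<otimes> \<eta> \<one> \<cdot> \<eta> X"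
    using T2_eta[of X \<one>] by (simp add: unit_right)
  moreover have "\<eta> X \<in> hom C X (Dom C (\<tau> X \<one>))" by simp
  ultimately obtain j where j: "j \<in> hom C X E" "i \<cdot> j = \<eta> X"
    using equalizer_factor[OF eq] by metis
  have [simp]: "j \<in> Ar C" "Dom C j = X" "Cod C j = E" using j by auto
  have *: "(\<mu> X \<cdot> \<T> i) \<cdot> \<T> j = \<langle>\<T>\<^sub>o X\<rangle>"
    using arg_cong[OF j(2), of \<T>] mu_eta_right[of X] by (simp add: functor_simps cmp_cmp)
  have "\<psi> \<cdot> (\<mu> X \<cdot> \<T> i) \<cdot> \<T> j = (\<psi> \<cdot> (\<mu> X \<cdot> \<T> i)) \<cdot> \<T> j" by (simp add: cmp_cmp)
  then have "\<T> j = \<psi>" unfolding \<psi>(3) * by (simp add: interchange_simps)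
  then have "iso C (\<T> j)"
    unfolding iso_def using \<psi> by (intro conjI bexI[of _ "\<mu> X \<cdot> \<T> i"]) simp_all
  then have "iso C j" using cons unfolding conservative_def by simp
  from equalizer_transport[OF eq j(1) this] show ?thesis using j(2) by simp
qed

text \<open>The mate of a linear map is linear for the dual actions. \<open>D\<close> and
  \<open>D'\<close> characterize these actions, so the square is compared after pairing and in front
  of the operator of \<open>lt P\<close>, where both sides become \<epsilon> after the image of one
  pairing.\<close>

lemma dual_action_natural:
  assumes P: "dpair P" and P': "dpair P'" and m: "mates P P' f g"
    and r: "monad_module C T (lt P) r" and r': "r' \<in> hom C (\<T>\<^sub>o (lt P')) (lt P')" and f: "f \<cdot> r = r' \<cdot> \<T> f"
    and q: "q \<in> hom C (\<T>\<^sub>o (rt P)) (rt P)" and q': "q' \<in> hom C (\<T>\<^sub>o (rt P')) (rt P')"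
    and D: "pev P \<cdot> r \<otimes> q \<cdot> \<tau> (lt P) (rt P) = \<epsilon> \<cdot> \<T> (pev P)"
    and D': "pev P' \<cdot> r' \<otimes> q' \<cdot> \<tau> (lt P') (rt P') = \<epsilon> \<cdot> \<T> (pev P')"
  shows "g \<cdot> q' = q \<cdot> \<T> g"
proof (rule pairing_eq_right[OF P])
  note [simp] = typing dual_pair_typ[OF P] dual_pair_typ[OF P'] mates_typ[OF m]
  have [simp]: "r \<in> Ar C" "Dom C r = \<T>\<^sub>o (lt P)" "Cod C r = lt P" using r by (auto simp: monad_module_def)
  have [simp]: "r' \<in> Ar C" "Dom C r' = \<T>\<^sub>o (lt P')" "Cod C r' = lt P'"
    "q \<in> Ar C" "Dom C q = \<T>\<^sub>o (rt P)" "Cod C q = rt P"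
    "q' \<in> Ar C" "Dom C q' = \<T>\<^sub>o (rt P')" "Cod C q' = rt P'" using r' q q' by auto
  have m: "pev P' \<cdot> f \<otimes> \<langle>rt P'\<rangle> = pev P \<cdot> \<langle>lt P\<rangle> \<otimes> g" using m by (simp add: mates_def)
  show "g \<cdot> q' \<in> hom C (\<T>\<^sub>o (rt P')) (rt P)" "q \<cdot> \<T> g \<in> hom C (\<T>\<^sub>o (rt P')) (rt P)" by simp_all
  obtain k where k: "k \<in> hom C (lt P \<otimes>\<^sub>o \<T>\<^sub>o (rt P')) (\<T>\<^sub>o (lt P \<otimes>\<^sub>o rt P'))"
    "fuse r (lt P) (rt P') \<cdot> k = \<langle>lt P \<otimes>\<^sub>o \<T>\<^sub>o (rt P')\<rangle>"
    using fuse_iso[OF r, of "rt P'"] by auto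
  have "(pev P \<cdot> \<langle>lt P\<rangle> \<otimes> (g \<cdot> q')) \<cdot> fuse r (lt P) (rt P') = (pev P \<cdot> \<langle>lt P\<rangle> \<otimes> g) \<cdot> r \<otimes> q' \<cdot> \<tau> (lt P) (rt P')"
    by (simp add: fuse_def interchange_simps)
  also have "\<dots> = pev P' \<cdot> (f \<cdot> r) \<otimes> q' \<cdot> \<tau> (lt P) (rt P')"
    unfolding m[symmetric] by (simp add: interchange_simps)
  also have "\<dots> = (pev P' \<cdot> r' \<otimes> q' \<cdot> \<tau> (lt P') (rt P')) \<cdot> \<T> (f \<otimes> \<langle>rt P'\<rangle>)"
    unfolding f by (simp add: functor_simps cmp_cmp) (simp add: interchange_simps)
  also have "\<dots> = \<epsilon> \<cdot> \<T> (pev P' \<cdot> f \<otimes> \<langle>rt P'\<rangle>)"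
    unfolding D' by (simp add: functor_simps cmp_cmp)
  also have "\<dots> = (\<epsilon> \<cdot> \<T> (pev P)) \<cdot> \<T> (\<langle>lt P\<rangle> \<otimes> g)"
    unfolding m by (simp add: functor_simps cmp_cmp)
  also have "\<dots> = pev P \<cdot> r \<otimes> q \<cdot> \<langle>\<T>\<^sub>o (lt P)\<rangle> \<otimes> \<T> g \<cdot> \<tau> (lt P) (rt P')"
    unfolding D[symmetric] by (simp add: functor_simps cmp_cmp)
  also have "\<dots> = (pev P \<cdot> \<langle>lt P\<rangle> \<otimes> (q \<cdot> \<T> g)) \<cdot> fuse r (lt P) (rt P')"
    by (simp add: fuse_def interchange_simps)
  finally show "pev P \<cdot> \<langle>lt P\<rangle> \<otimes> (g \<cdot> q') = pev P \<cdot> \<langle>lt P\<rangle> \<otimes> (q \<cdot> \<T> g)"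
    using k(1) by (elim right_inverse_cancel[OF _ k(2)]) simp_all
qed

end

section \<open>From left integrals to right integrals\<close>

context category
begin

lemma equalizer_unique:
  assumes eq: "equalizer C E i f g" and eq': "equalizer C E' i' f g"
  obtains u where "u \<in> hom C E' E" "iso C u" "i \<cdot> u = i'"
proof -
  note [simp] = typing
  have [simp]: "E \<in> Ob C" "i \<in> Ar C" "Dom C i = E" "Cod C i = Dom C f" "f \<cdot> i = g \<cdot> i"
    "E' \<in> Ob C" "i' \<in> Ar C" "Dom C i' = E'" "Cod C i' = Dom C f" "f \<cdot> i' = g \<cdot> i'"
    using eq eq' by (auto simp: equalizer_def)
  obtain u where u: "u \<in> hom C E' E" "i \<cdot> u = i'"
    using equalizer_factor[OF eq, of i' E'] by auto
  obtain v where v: "v \<in> hom C E E'" "i' \<cdot> v = i"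
    using equalizer_factor[OF eq', of i E] by auto
  have [simp]: "u \<in> Ar C" "Dom C u = E'" "Cod C u = E" "v \<in> Ar C" "Dom C v = E" "Cod C v = E'"
    using u v by auto
  have "i \<cdot> u \<cdot> v = (i \<cdot> u) \<cdot> v" by (simp add: cmp_cmp)
  then have "i \<cdot> u \<cdot> v = i \<cdot> \<langle>E\<rangle>" using u v by (simp add: cmp_ide)
  moreover obtain k where k: "\<And>k'. k' \<in> hom C E E \<Longrightarrow> i \<cdot> k' = i \<Longrightarrow> k' = k"
    using equalizer_factor[OF eq, of i E] by auto
  ultimately have "u \<cdot> v = k" "\<langle>E\<rangle> = k" by (auto intro!: k simp: cmp_ide)
  then have 1: "u \<cdot> v = \<langle>E\<rangle>" by simp
  have "i' \<cdot> v \<cdot> u = (i' \<cdot> v) \<cdot> u" by (simp add: cmp_cmp)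
  then have "i' \<cdot> v \<cdot> u = i' \<cdot> \<langle>E'\<rangle>" using u v by (simp add: cmp_ide)
  moreover obtain k' where k': "\<And>k. k \<in> hom C E' E' \<Longrightarrow> i' \<cdot> k = i' \<Longrightarrow> k = k'"
    using equalizer_factor[OF eq', of i' E'] by auto
  ultimately have "v \<cdot> u = k'" "\<langle>E'\<rangle> = k'" by (auto intro!: k' simp: cmp_ide)
  then have 2: "v \<cdot> u = \<langle>E'\<rangle>" by simp
  have "iso C u" unfolding iso_def using v 1 2 by (intro conjI bexI[of _ v]) simp_all
  with u that show thesis by blast
qed

end

lemma (in endofunctor) fmor_iso:
  assumes "iso C u"
  shows "iso C (fmor F u)"
proof -
  obtain v where uv: "u \<in> Ar C" "v \<in> hom C (Cod C u) (Dom C u)"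
      "v \<cdot> u = \<langle>Dom C u\<rangle>" "u \<cdot> v = \<langle>Cod C u\<rangle>"
    using assms by (auto simp: iso_def)
  have u: "u \<in> hom C (Dom C u) (Cod C u)" using uv(1) by (simp add: hom_def)
  have "fmor F v \<cdot> fmor F u = \<langle>fob F (Dom C u)\<rangle>" "fmor F u \<cdot> fmor F v = \<langle>fob F (Cod C u)\<rangle>"
    using uv u by (simp_all add: fmor_ide Dom_Ob Cod_Ob flip: fmor_cmp)
  then show ?thesis
    unfolding iso_def using fmor_hom[OF u] fmor_hom[OF uv(2)] by (auto simp: hom_def intro!: bexI)
qed

context hopf_monad
begin

text \<open>Here \<open>P\<close> pairs \<open>Y\<close> with \<open>X\<close> and \<open>Q\<close> pairs the value \<open>I\<close> of a left integral on \<open>Y\<close> with \<open>J\<close>.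
  The comparison \<open>\<kappa> : T J \<rightarrow> X\<close> is the canonical map from \<open>T J\<close> to the right dual of \<open>T Y\<close> followed by
  the mate of the unit of \<open>T\<close>.\<close>

definition comparison :: "('o, 'm) pair \<Rightarrow> ('o, 'm) pair \<Rightarrow> 'm \<Rightarrow> 'm \<Rightarrow> bool" where
  "comparison P Q l \<kappa> \<longleftrightarrow> (\<exists>t q i.
    mates P (rpair (\<T>\<^sub>o (lt P))) (\<eta> (lt P)) t \<and> mates (rpair (\<T>\<^sub>o (lt P))) Q l i \<and>
    q \<in> hom C (\<T>\<^sub>o (rdual C (\<T>\<^sub>o (lt P)))) (rdual C (\<T>\<^sub>o (lt P))) \<and>
    evr C (\<T>\<^sub>o (lt P)) \<cdot> \<mu> (lt P) \<otimes> q \<cdot> \<tau> (\<T>\<^sub>o (lt P)) (rdual C (\<T>\<^sub>o (lt P))) = \<epsilon> \<cdot> \<T> (evr C (\<T>\<^sub>o (lt P))) \<and>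
    \<kappa> = t \<cdot> q \<cdot> \<T> i)"

text \<open>The comparison is composed of three maps, and each contributes one square:
  \<open>1\<close> for the coinvariants, \<open>2\<close> for the dual actions, \<open>3\<close> for
  the mates of the unit. All three use \<open>n\<close>, the dual of \<open>\<T> v\<close>.\<close>

lemma comparison_natural:
  assumes c: "comparison P Q l \<kappa>" "comparison P' Q' l' \<kappa>'"
    and d: "dpair P" "dpair Q" "dpair P'" "dpair Q'"
    and m: "mates P' P v u" "mates Q' Q w j" and w: "w \<cdot> l' = l \<cdot> \<T> v"
  shows "\<kappa>' \<cdot> \<T> j = u \<cdot> \<kappa>"
proof -
  let ?Y = "lt P" and ?Y' = "lt P'"
  let ?R = "rpair (\<T>\<^sub>o ?Y)" and ?R' = "rpair (\<T>\<^sub>o ?Y')"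
  obtain t q i where t: "mates P ?R (\<eta> ?Y) t" and i: "mates ?R Q l i"
    and q: "q \<in> hom C (\<T>\<^sub>o (rt ?R)) (rt ?R)" "pev ?R \<cdot> \<mu> ?Y \<otimes> q \<cdot> \<tau> (lt ?R) (rt ?R) = \<epsilon> \<cdot> \<T> (pev ?R)"
    and \<kappa>: "\<kappa> = t \<cdot> q \<cdot> \<T> i"
    using c(1) by (auto simp: comparison_def)
  obtain t' q' i' where t': "mates P' ?R' (\<eta> ?Y') t'" and i': "mates ?R' Q' l' i'"
    and q': "q' \<in> hom C (\<T>\<^sub>o (rt ?R')) (rt ?R')" "pev ?R' \<cdot> \<mu> ?Y' \<otimes> q' \<cdot> \<tau> (lt ?R') (rt ?R') = \<epsilon> \<cdot> \<T> (pev ?R')"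
    and \<kappa>': "\<kappa>' = t' \<cdot> q' \<cdot> \<T> i'"
    using c(2) by (auto simp: comparison_def)
  note [simp] = typing mates_typ[OF t] mates_typ[OF i] mates_typ[OF t'] mates_typ[OF i'] mates_typ[OF m(1)] mates_typ[OF m(2)]
    dual_pair_typ(1,2)[OF d(1)] dual_pair_typ(1,2)[OF d(2)] dual_pair_typ(1,2)[OF d(3)] dual_pair_typ(1,2)[OF d(4)]
  have [simp]: "q \<in> Ar C" "Dom C q = \<T>\<^sub>o (rdual C (\<T>\<^sub>o ?Y))" "Cod C q = rdual C (\<T>\<^sub>o ?Y)"
    "q' \<in> Ar C" "Dom C q' = \<T>\<^sub>o (rdual C (\<T>\<^sub>o ?Y'))" "Cod C q' = rdual C (\<T>\<^sub>o ?Y')"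
    using q(1) q'(1) by auto
  have R: "dpair ?R" "dpair ?R'" by (intro dpair_rpair; simp)+
  define n where "n = rdual_mor C (\<T> v)"
  have n: "mates ?R' ?R (\<T> v) n"
    unfolding n_def by (intro mates_rdual_mor) simp
  note [simp] = mates_typ[OF n]
  have 1: "i' \<cdot> j = n \<cdot> i"
    using mates_cmp[OF R(2) d(4) d(2) i' m(2)] mates_cmp[OF R(2) R(1) d(2) n i] mates_right_unique[OF R(2)]
    unfolding w by blast
  have 2: "q' \<cdot> \<T> n = n \<cdot> q"
  proof (rule dual_action_natural[OF R(2) R(1) n _ _ _ q'(1) q(1) q'(2) q(2), symmetric])
    show "monad_module C T (lt ?R') (\<mu> ?Y')" using free_module by simp
    show "\<T> v \<cdot> \<mu> ?Y' = \<mu> ?Y \<cdot> \<T> (\<T> v)" by (rule mu_natural[symmetric]) simp_all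
  qed simp
  have 3: "t' \<cdot> n = u \<cdot> t"
    using mates_cmp[OF d(3) R(2) R(1) t' n] mates_cmp[OF d(3) d(1) R(1) m(1) t] mates_right_unique[OF d(3)]
      eta_natural[of v ?Y' ?Y] by auto
  have "\<kappa>' \<cdot> \<T> j = t' \<cdot> q' \<cdot> \<T> (i' \<cdot> j)"
    by (simp add: \<kappa>' cmp_cmp functor_simps)
  also have "\<dots> = t' \<cdot> (q' \<cdot> \<T> n) \<cdot> \<T> i"
    unfolding 1 by (simp add: cmp_cmp functor_simps)
  also have "\<dots> = (t' \<cdot> n) \<cdot> q \<cdot> \<T> i"
    unfolding 2 by (simp add: cmp_cmp)
  also have "\<dots> = u \<cdot> \<kappa>"
    unfolding 3 by (simp add: \<kappa> cmp_cmp)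
  finally show ?thesis .
qed

text \<open>By universality of \<open>l\<close>, the object \<open>J\<close> is the coinvariants of
  the dual Hopf module \<open>?N\<close>, so \<phi> identifies \<open>\<T>\<^sub>o J\<close> with
  \<open>?N\<close>. Right integrals on \<open>J\<close> thus become integral maps out of
  \<open>?N\<close>; these are mates of coinvariant maps into \<open>\<T>\<^sub>o Y\<close>, and
  such maps factor through \<open>\<eta> Y\<close>.\<close>

lemma comparison_universal:
  assumes adm: "right_hopf_modules_admit_preserved_coinvariants C T"
    and coinv: "equalizer C (lt P) (\<eta> (lt P)) (\<tau> \<one> (lt P)) (\<eta> \<one> \<otimes> \<langle>\<T>\<^sub>o (lt P)\<rangle>)"
    and P: "dpair P" and Q: "dpair Q" and l: "universal_left_at (lt P) (lt Q) l"
  shows "\<exists>\<kappa>. comparison P Q l \<kappa> \<and> universal_right_at (rt Q) (rt P) \<kappa>"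
proof -
  obtain Y X e0 c0 J I e1 c1 where PQ: "P = (Y, X, e0, c0)" "Q = (I, J, e1, c1)" by (metis prod_cases4)
  note [simp] = typing dual_pair_typ(1,2)[OF P, unfolded PQ, simplified] dual_pair_typ(1,2)[OF Q, unfolded PQ, simplified]
  let ?N = "rdual C (\<T>\<^sub>o Y)" and ?R = "rpair (\<T>\<^sub>o Y)"
  obtain q \<rho> where \<rho>: "dual_coaction Y ?R \<rho>" and h: "right_hopf_module C T ?N q \<rho>"
    and q: "q \<in> hom C (\<T>\<^sub>o ?N) ?N" "evr C (\<T>\<^sub>o Y) \<cdot> \<mu> Y \<otimes> q \<cdot> \<tau> (\<T>\<^sub>o Y) ?N = \<epsilon> \<cdot> \<T> (evr C (\<T>\<^sub>o Y))"
    using dual_free_hopf_module[of Y] by (metis \<open>Y \<in> Ob C\<close>)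
  note R = dual_coactionD(2)[OF \<rho>]
  have [simp]: "\<rho> \<in> Ar C" "Dom C \<rho> = ?N" "Cod C \<rho> = ?N \<otimes>\<^sub>o A"
    using dual_coactionD(4-6)[OF \<rho>] by auto
  have [simp]: "q \<in> Ar C" "Dom C q = \<T>\<^sub>o ?N" "Cod C q = ?N" using q(1) by auto
  have "l \<in> hom C (\<T>\<^sub>o Y) I" using l by (simp add: universal_left_at_def left_integral_at_def PQ)
  then obtain i where i: "mates ?R Q l i" using mates_right[OF R Q] by (auto simp: PQ)
  obtain t where t: "mates P ?R (\<eta> Y) t" using mates_right[OF P R, of "\<eta> Y"] by (auto simp: PQ)
  note [simp] = mates_typ[OF i, unfolded PQ, simplified] mates_typ[OF t, unfolded PQ, simplified]
  have eq: "equalizer C J i \<rho> (\<langle>?N\<rangle> \<otimes> \<eta> \<one>)"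
    using equalizer_of_universal_left[OF \<rho> Q i] l by (simp add: PQ)
  obtain E i0 where eq0: "equalizer C E i0 \<rho> (\<langle>?N\<rangle> \<otimes> \<eta> \<one>)"
    and Teq0: "equalizer C (\<T>\<^sub>o E) (\<T> i0) (\<T> \<rho>) (\<T> (\<langle>?N\<rangle> \<otimes> \<eta> \<one>))"
    using adm h unfolding right_hopf_modules_admit_preserved_coinvariants_def by blast
  \<comment> \<open>Preservation by \<open>T\<close> is available for the chosen equalizer
    \<open>i0\<close> only; the isomorphism \<open>u\<close> carries it over to the equalizer
    \<open>i\<close> coming from \<open>l\<close>.\<close>
  obtain u where u: "u \<in> hom C J E" "iso C u" "i0 \<cdot> u = i"
    using equalizer_unique[OF eq0 eq] by blast
  have "\<T> i0 \<cdot> \<T> u = \<T> i"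
    using u eq0 fmor_cmp[of u J E i0 ?N] by (auto simp: equalizer_def)
  then have Teq: "equalizer C (\<T>\<^sub>o J) (\<T> i) (\<T> \<rho>) (\<T> (\<langle>?N\<rangle> \<otimes> \<eta> \<one>))"
    using equalizer_transport[OF Teq0 _ fmor_iso[OF u(2)], of "\<T>\<^sub>o J"] u(1) by auto
  define \<phi> where "\<phi> = q \<cdot> \<T> i"
  obtain \<psi> where \<psi>: "\<psi> \<in> hom C ?N (\<T>\<^sub>o J)" "\<phi> \<cdot> \<psi> = \<langle>?N\<rangle>" "\<psi> \<cdot> \<phi> = \<langle>\<T>\<^sub>o J\<rangle>"
    using hopf_module_decomposition[OF h eq Teq] unfolding \<phi>_def by blast
  have [simp]: "\<psi> \<in> Ar C" "Dom C \<psi> = ?N" "Cod C \<psi> = \<T>\<^sub>o J"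
    "\<phi> \<in> Ar C" "Dom C \<phi> = \<T>\<^sub>o J" "Cod C \<phi> = ?N"
    using \<psi> by (auto simp: \<phi>_def)
  have \<rho>\<phi>: "\<rho> \<cdot> \<phi> = \<phi> \<otimes> \<langle>A\<rangle> \<cdot> \<tau> J \<one>"
    unfolding \<phi>_def by (rule hopf_action_coinvariant(2)[OF h]) (use eq in \<open>auto simp: equalizer_def\<close>)
  \<comment> \<open>The inverse of a colinear isomorphism is colinear; this direction transports an
    integral on \<open>J\<close> to \<open>?N\<close>.\<close>
  have \<rho>\<psi>: "\<psi> \<otimes> \<langle>A\<rangle> \<cdot> \<rho> = \<tau> J \<one> \<cdot> \<psi>"
  proof -
    have "\<psi> \<otimes> \<langle>A\<rangle> \<cdot> \<rho> = \<psi> \<otimes> \<langle>A\<rangle> \<cdot> \<rho> \<cdot> \<phi> \<cdot> \<psi>"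
      unfolding \<psi>(2) by (simp add: interchange_simps)
    also have "\<dots> = \<psi> \<otimes> \<langle>A\<rangle> \<cdot> (\<rho> \<cdot> \<phi>) \<cdot> \<psi>" by (simp add: cmp_cmp)
    also have "\<dots> = (\<psi> \<cdot> \<phi>) \<otimes> \<langle>A\<rangle> \<cdot> \<tau> J \<one> \<cdot> \<psi>"
      unfolding \<rho>\<phi> by (simp add: interchange_simps)
    finally show ?thesis unfolding \<psi>(3) by (simp add: interchange_simps)
  qed
  have out: "f \<otimes> \<langle>A\<rangle> \<cdot> \<rho> = f \<otimes> \<eta> \<one> \<longleftrightarrow> \<tau> \<one> Y \<cdot> d = \<eta> \<one> \<otimes> \<langle>\<T>\<^sub>o Y\<rangle> \<cdot> d"
    if "dpair S" "mates S ?R d f" for S d f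
    using coinvariant_out_of_dual[OF R that, of "\<tau> \<one> Y" \<rho>] dual_coactionD(7)[OF \<rho>] by (simp add: PQ)
  define \<kappa> where "\<kappa> = t \<cdot> \<phi>"
  have [simp]: "\<kappa> \<in> Ar C" "Dom C \<kappa> = \<T>\<^sub>o J" "Cod C \<kappa> = X" by (simp_all add: \<kappa>_def)
  have "comparison P Q l \<kappa>"
    unfolding comparison_def
    by (intro exI[of _ t] exI[of _ q] exI[of _ i]) (use t i q in \<open>simp add: PQ \<kappa>_def \<phi>_def\<close>)
  moreover have "universal_right_at J X \<kappa>"
    unfolding universal_right_at_def
  proof (intro conjI allI impI)
    \<comment> \<open>\<open>t\<close> is the mate of \<open>\<eta> Y\<close>, and
      \<open>coinv\<close> contains the coinvariance of that unit.\<close>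
    have "t \<otimes> \<langle>A\<rangle> \<cdot> \<rho> = t \<otimes> \<eta> \<one>"
      using out[OF P t] coinv by (simp add: equalizer_def PQ)
    then have "t \<otimes> \<langle>A\<rangle> \<cdot> \<rho> \<cdot> \<phi> = (t \<otimes> \<eta> \<one>) \<cdot> \<phi> \<otimes> \<langle>\<one>\<rangle>"
      by (simp add: unit_right flip: cmp_cmp)
    then have "(t \<cdot> \<phi>) \<otimes> \<langle>A\<rangle> \<cdot> \<tau> J \<one> = (t \<cdot> \<phi>) \<otimes> \<eta> \<one>"
      unfolding \<rho>\<phi> by (simp add: cmp_tensor cmp_tensor_cmp cmp_ide ide_cmp)
    then show "right_integral_at J X \<kappa>"
      by (simp add: right_integral_at_def \<kappa>_def)
    fix W c assume c: "right_integral_at J W c"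
    then have [simp]: "c \<in> Ar C" "Dom C c = \<T>\<^sub>o J" "Cod C c = W" and ci: "c \<otimes> \<langle>A\<rangle> \<cdot> \<tau> J \<one> = c \<otimes> \<eta> \<one>"
      by (auto simp: right_integral_at_def)
    have W [simp]: "W \<in> Ob C" using Cod_Ob[of c] by simp
    note S = dpair_lpair[OF W]
    define c' where "c' = c \<cdot> \<psi>"
    have [simp]: "c' \<in> Ar C" "Dom C c' = ?N" "Cod C c' = W" by (simp_all add: c'_def)
    have c'\<phi>: "c' \<cdot> \<phi> = c" using \<psi>(3) by (simp add: c'_def cmp_cmp cmp_ide)
    have "c' \<otimes> \<langle>A\<rangle> \<cdot> \<rho> = c \<otimes> \<langle>A\<rangle> \<cdot> \<psi> \<otimes> \<langle>A\<rangle> \<cdot> \<rho>"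
      by (simp add: c'_def whisker_right cmp_cmp)
    also have "\<dots> = (c \<otimes> \<langle>A\<rangle> \<cdot> \<tau> J \<one>) \<cdot> \<psi>"
      unfolding \<rho>\<psi> by (simp add: cmp_cmp)
    also have "\<dots> = c \<otimes> \<eta> \<one> \<cdot> \<psi> \<otimes> \<langle>\<one>\<rangle>"
      unfolding ci by (simp add: unit_right)
    also have "\<dots> = c' \<otimes> \<eta> \<one>"
      by (simp add: c'_def cmp_tensor cmp_ide)
    finally have c': "c' \<otimes> \<langle>A\<rangle> \<cdot> \<rho> = c' \<otimes> \<eta> \<one>" .
    obtain d where d: "mates (lpair W) ?R d c'" using mates_left[OF S R, of c'] by auto
    have "\<tau> \<one> Y \<cdot> d = \<eta> \<one> \<otimes> \<langle>\<T>\<^sub>o Y\<rangle> \<cdot> d" using out[OF S d] c' by simp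
    \<comment> \<open>The equalizer property of \<open>\<eta> Y\<close> gives the factorization
      \<open>d'\<close>; its mate \<open>w\<close> factors \<open>c'\<close> through
      \<open>t\<close>.\<close>
    then obtain d' where d': "d' \<in> hom C (ldual C W) Y" "\<eta> Y \<cdot> d' = d"
      and ud: "\<And>d''. d'' \<in> hom C (ldual C W) Y \<Longrightarrow> \<eta> Y \<cdot> d'' = d \<Longrightarrow> d'' = d'"
      using equalizer_factor[OF coinv, of d "ldual C W"] mates_typ[OF d] by (auto simp: PQ hom_def)
    obtain w where w: "mates (lpair W) P d' w" using mates_right[OF S P, of d'] d' by (auto simp: PQ)
    have wt: "w \<cdot> t = c'"
      using mates_cmp[OF S P R w t] d' mates_right_unique[OF S d] by simp
    note [simp] = mates_typ[OF w, unfolded PQ, simplified]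
    show "\<exists>!w. w \<in> hom C X W \<and> w \<cdot> \<kappa> = c"
    proof (rule ex1I)
      have "w \<cdot> \<kappa> = (w \<cdot> t) \<cdot> \<phi>" by (simp add: \<kappa>_def cmp_cmp)
      then show "w \<in> hom C X W \<and> w \<cdot> \<kappa> = c" unfolding wt c'\<phi> by simp
      fix w' assume w': "w' \<in> hom C X W \<and> w' \<cdot> \<kappa> = c"
      then have [simp]: "w' \<in> Ar C" "Dom C w' = X" "Cod C w' = W" by auto
      have "w' \<cdot> t = w' \<cdot> t \<cdot> \<phi> \<cdot> \<psi>" unfolding \<psi>(2) by (simp add: cmp_ide)
      also have "\<dots> = (w' \<cdot> \<kappa>) \<cdot> \<psi>" by (simp add: \<kappa>_def cmp_cmp)
      finally have w't: "w' \<cdot> t = c'" using w' by (simp add: c'_def)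
      obtain d'' where d'': "mates (lpair W) P d'' w'" using mates_left[OF S P, of w'] by (auto simp: PQ)
      have "\<eta> Y \<cdot> d'' = d"
        using mates_cmp[OF S P R d'' t] d mates_left_unique[OF R] unfolding w't by blast
      then have "d'' = d'" using ud mates_typ[OF d''] by (simp add: PQ)
      then show "w' = w" using d'' w mates_right_unique[OF S] by blast
    qed
  qed
  ultimately show ?thesis by (auto simp: PQ)
qed

end

section \<open>Functoriality of universal integrals\<close>

context autonomous_category
begin

lemma ldual_mor_typ [typing]:
  assumes "f \<in> Ar C"
  shows "ldual_mor C f \<in> Ar C" "Dom C (ldual_mor C f) = ldual C (Cod C f)"
    "Cod C (ldual_mor C f) = ldual C (Dom C f)"
  using assms by (simp_all add: ldual_mor_def Let_def typing)

lemma mates_ldual_mor: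
  assumes "f \<in> hom C X Y"
  shows "mates (lpair Y) (lpair X) (ldual_mor C f) f"
proof -
  have f: "f \<in> Ar C" "Dom C f = X" "Cod C f = Y" using assms by (auto simp: hom_def)
  then have ob: "X \<in> Ob C" "Y \<in> Ob C" using Dom_Ob Cod_Ob by auto
  have "ldual_mor C f = (evl C Y \<cdot> \<langle>ldual C Y\<rangle> \<otimes> f) \<otimes> \<langle>ldual C X\<rangle> \<cdot> \<langle>ldual C Y\<rangle> \<otimes> coevl C X"
    using f ob by (simp add: ldual_mor_def Let_def typing whisker_right cmp_cmp tensor_assoc)
  then have "evl C X \<cdot> ldual_mor C f \<otimes> \<langle>X\<rangle> = evl C Y \<cdot> \<langle>ldual C Y\<rangle> \<otimes> f"
    using pairing_transpose_left[OF ldual_pair, of X "evl C Y \<cdot> \<langle>ldual C Y\<rangle> \<otimes> f" "ldual C Y" \<one>] f ob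
    by (simp add: typing unit_left)
  then show ?thesis using f ob by (simp add: mates_def typing)
qed

lemma ldual_mor_cmp:
  assumes "f \<in> hom C X Y" "g \<in> hom C Y Z"
  shows "ldual_mor C (g \<cdot> f) = ldual_mor C f \<cdot> ldual_mor C g"
proof -
  have ob: "dpair (lpair X)" "dpair (lpair Y)" "dpair (lpair Z)"
    using assms Dom_Ob Cod_Ob by (auto simp: hom_def intro!: ldual_pair)
  show ?thesis
    using mates_cmp[OF ob(3,2,1) mates_ldual_mor[OF assms(2)] mates_ldual_mor[OF assms(1)]]
      mates_ldual_mor[OF cmp_hom[OF assms]] mates_left_unique[OF ob(1)] by blast
qed

lemma ldual_mor_ide: "X \<in> Ob C \<Longrightarrow> ldual_mor C \<langle>X\<rangle> = \<langle>ldual C X\<rangle>"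
  using mates_ldual_mor[OF ide_hom, of X] mates_ide[OF dpair_lpair, of X]
    mates_left_unique[OF dpair_lpair, of X] by auto

lemma endofunctor_rshriek:
  assumes "endofunctor C K"
  shows "endofunctor C (rshriek C K)"
proof -
  interpret K: endofunctor C K by (rule assms)
  note [typing] = K.fob_Ob
  have K [typing]: "fmor K f \<in> Ar C" "Dom C (fmor K f) = fob K (Dom C f)" "Cod C (fmor K f) = fob K (Cod C f)"
    if "f \<in> Ar C" for f
    using K.fmor_hom[of f "Dom C f" "Cod C f"] that by (auto simp: hom_def)
  show ?thesis
  proof
    fix X assume "X \<in> Ob C"
    then show "fob (rshriek C K) X \<in> Ob C" by (simp add: rshriek_def typing)
    show "fmor (rshriek C K) \<langle>X\<rangle> = \<langle>fob (rshriek C K) X\<rangle>"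
      using \<open>X \<in> Ob C\<close> by (simp add: rshriek_def typing ldual_mor_ide rdual_mor_ide K.fmor_ide)
  next
    fix f X Y assume "f \<in> hom C X Y"
    then show "fmor (rshriek C K) f \<in> hom C (fob (rshriek C K) X) (fob (rshriek C K) Y)"
      by (auto simp add: rshriek_def typing)
    fix g Z assume "g \<in> hom C Y Z"
    then show "fmor (rshriek C K) (g \<cdot> f) = fmor (rshriek C K) g \<cdot> fmor (rshriek C K) f"
      using \<open>f \<in> hom C X Y\<close> ldual_mor_cmp[of f X Y g Z]
        K.fmor_cmp[of "ldual_mor C g" "ldual C Z" "ldual C Y" "ldual_mor C f" "ldual C X"]
      by (auto simp: rshriek_def typing intro!: rdual_mor_cmp)
  qed
qed

end

section \<open>From componentwise universality to functors\<close>

context hopf_monad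
begin

lemma left_integral_at_cmp:
  assumes "left_integral_at X W c" "X \<in> Ob C" "g \<in> hom C W V"
  shows "left_integral_at X V (g \<cdot> c)"
proof -
  note [simp] = typing assms(2)
  have [simp]: "c \<in> Ar C" "Dom C c = \<T>\<^sub>o X" "Cod C c = W" "g \<in> Ar C" "Dom C g = W" "Cod C g = V"
    and c: "\<langle>A\<rangle> \<otimes> c \<cdot> \<tau> \<one> X = \<eta> \<one> \<otimes> c"
    using assms by (auto simp: left_integral_at_def)
  have "\<langle>A\<rangle> \<otimes> (g \<cdot> c) \<cdot> \<tau> \<one> X = \<langle>A\<rangle> \<otimes> g \<cdot> (\<langle>A\<rangle> \<otimes> c \<cdot> \<tau> \<one> X)"
    by (simp add: whisker_left cmp_cmp)
  also have "\<dots> = \<eta> \<one> \<otimes> (g \<cdot> c)"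
    unfolding c by (simp add: interchange_simps)
  finally show ?thesis by (simp add: left_integral_at_def)
qed

lemma left_integral_at_precomp:
  assumes c: "left_integral_at Y W c" and f: "f \<in> hom C X Y"
  shows "left_integral_at X W (c \<cdot> \<T> f)"
proof -
  note [simp] = typing
  have [simp]: "f \<in> Ar C" "Dom C f = X" "Cod C f = Y" "X \<in> Ob C" "Y \<in> Ob C"
    using f Dom_Ob Cod_Ob by (auto simp: hom_def)
  have [simp]: "c \<in> Ar C" "Dom C c = \<T>\<^sub>o Y" "Cod C c = W" and c: "\<langle>A\<rangle> \<otimes> c \<cdot> \<tau> \<one> Y = \<eta> \<one> \<otimes> c"
    using c by (auto simp: left_integral_at_def)
  have n: "\<langle>A\<rangle> \<otimes> \<T> f \<cdot> \<tau> \<one> X = \<tau> \<one> Y \<cdot> \<T> f"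
    using T2_natural[of "\<langle>\<one>\<rangle>" f \<one> Y] by (simp add: unit_left functor_simps)
  have "\<langle>A\<rangle> \<otimes> (c \<cdot> \<T> f) \<cdot> \<tau> \<one> X = \<langle>A\<rangle> \<otimes> c \<cdot> (\<langle>A\<rangle> \<otimes> \<T> f \<cdot> \<tau> \<one> X)"
    by (simp add: whisker_left cmp_cmp)
  also have "\<dots> = (\<langle>A\<rangle> \<otimes> c \<cdot> \<tau> \<one> Y) \<cdot> \<T> f"
    unfolding n by (simp add: cmp_cmp)
  also have "\<dots> = \<eta> \<one> \<otimes> c \<cdot> \<langle>\<one>\<rangle> \<otimes> \<T> f"
    unfolding c by (simp add: unit_left)
  also have "\<dots> = \<eta> \<one> \<otimes> (c \<cdot> \<T> f)" by (simp add: cmp_tensor cmp_ide)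
  finally show ?thesis by (simp add: left_integral_at_def)
qed

lemma universal_left_at_typ:
  assumes "universal_left_at X I l"
  shows "l \<in> hom C (\<T>\<^sub>o X) I" "I \<in> Ob C"
  using assms Cod_Ob[of l] by (auto simp: universal_left_at_def left_integral_at_def hom_def)

lemma universal_left_cancel:
  assumes l: "universal_left_at X I l" and X: "X \<in> Ob C"
    and "f \<in> hom C I W" "g \<in> hom C I W" "f \<cdot> l = g \<cdot> l"
  shows "f = g"
proof -
  have "left_integral_at X W (f \<cdot> l)"
    using left_integral_at_cmp[OF _ X] l assms(3) by (auto simp: universal_left_at_def)
  then show ?thesis using l assms(3-) unfolding universal_left_at_def by metis
qed

lemma universal_left_iso:
  assumes l: "universal_left_at X I l" and l': "universal_left_at X I' l'" and X: "X \<in> Ob C"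
  obtains u where "u \<in> hom C I I'" "iso C u" "u \<cdot> l = l'"
proof -
  note [simp] = typing universal_left_at_typ(2)[OF l] universal_left_at_typ(2)[OF l']
  obtain u where u: "u \<in> hom C I I'" "u \<cdot> l = l'" using l l' unfolding universal_left_at_def by metis
  obtain v where v: "v \<in> hom C I' I" "v \<cdot> l' = l" using l l' unfolding universal_left_at_def by metis
  have [simp]: "u \<in> Ar C" "Dom C u = I" "Cod C u = I'" "v \<in> Ar C" "Dom C v = I'" "Cod C v = I"
    "l \<in> Ar C" "Dom C l = \<T>\<^sub>o X" "Cod C l = I" "l' \<in> Ar C" "Dom C l' = \<T>\<^sub>o X" "Cod C l' = I'"
    using u v universal_left_at_typ(1)[OF l] universal_left_at_typ(1)[OF l'] by auto
  have "v \<cdot> u = \<langle>I\<rangle>"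
    by (rule universal_left_cancel[OF l X, of _ I]) (simp_all add: u v cmp_cmp ide_cmp)
  moreover have "u \<cdot> v = \<langle>I'\<rangle>"
    by (rule universal_left_cancel[OF l' X, of _ I']) (simp_all add: u v cmp_cmp ide_cmp)
  ultimately have "iso C u" unfolding iso_def using v by (intro conjI bexI[of _ v]) simp_all
  with u that show thesis by blast
qed

definition left_universal_functor :: "('o, 'm) endofunctor_data \<Rightarrow> ('o \<Rightarrow> 'm) \<Rightarrow> bool" where
  "left_universal_functor F l \<longleftrightarrow> endofunctor C F \<and> (\<forall>X \<in> Ob C. universal_left_at X (fob F X) (l X)) \<and>
    (\<forall>X Y f. f \<in> hom C X Y \<longrightarrow> fmor F f \<cdot> l X = l Y \<cdot> \<T> f)"

definition right_universal_functor :: "('o, 'm) endofunctor_data \<Rightarrow> ('o \<Rightarrow> 'm) \<Rightarrow> bool" where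
  "right_universal_functor F l \<longleftrightarrow> endofunctor C F \<and> (\<forall>X \<in> Ob C. universal_right_at X (fob F X) (l X)) \<and>
    (\<forall>X Y f. f \<in> hom C X Y \<longrightarrow> fmor F f \<cdot> l X = l Y \<cdot> \<T> f)"

text \<open>The values at the objects are chosen independently of each other. A morphism
  \<open>f\<close> is sent to the factorization of \<open>l Y \<cdot> \<T> f\<close> through
  \<open>l X\<close>, and the functor laws follow by cancelling universal integrals.\<close>

lemma left_universal_functor_exists:
  assumes adm: "right_hopf_modules_admit_preserved_coinvariants C T"
  shows "\<exists>F l. left_universal_functor F l"
proof -
  obtain I l where u: "\<And>X. X \<in> Ob C \<Longrightarrow> universal_left_at X (I X) (l X)"
    using universal_left_exists[OF adm] by metis
  note [simp] = typing universal_left_at_typ(2)[OF u]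
  have l [simp]: "l X \<in> Ar C" "Dom C (l X) = \<T>\<^sub>o X" "Cod C (l X) = I X" if "X \<in> Ob C" for X
    using universal_left_at_typ(1)[OF u[OF that]] by auto
  have "\<exists>m. m \<in> hom C (I X) (I Y) \<and> m \<cdot> l X = l Y \<cdot> \<T> f" if f: "f \<in> hom C X Y" for f X Y
  proof -
    have ob: "X \<in> Ob C" "Y \<in> Ob C" using f Dom_Ob Cod_Ob by (auto simp: hom_def)
    then have "left_integral_at X (I Y) (l Y \<cdot> \<T> f)"
      using left_integral_at_precomp[OF _ f] u by (auto simp: universal_left_at_def)
    then show ?thesis using u[OF ob(1)] unfolding universal_left_at_def by metis
  qed
  \<comment> \<open>The functor may depend on \<open>f\<close> alone, so the chosen factorization
    reads its objects off the domain and codomain of \<open>f\<close>.\<close>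
  then have "\<exists>m. \<forall>X Y f. f \<in> hom C X Y \<longrightarrow> m f \<in> hom C (I X) (I Y) \<and> m f \<cdot> l X = l Y \<cdot> \<T> f"
    by (intro exI[of _ "\<lambda>f. SOME m. m \<in> hom C (I (Dom C f)) (I (Cod C f)) \<and> m \<cdot> l (Dom C f) = l (Cod C f) \<cdot> \<T> f"])
      (auto simp only: hom_def mem_Collect_eq intro: someI2_ex)
  then obtain m where m: "\<And>X Y f. f \<in> hom C X Y \<Longrightarrow> m f \<in> hom C (I X) (I Y)"
    and ml: "\<And>X Y f. f \<in> hom C X Y \<Longrightarrow> m f \<cdot> l X = l Y \<cdot> \<T> f" by blast
  let ?F = "\<lparr>fob = I, fmor = m\<rparr>"
  have "endofunctor C ?F"
  proof
    fix X assume X: "X \<in> Ob C"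
    show "fob ?F X \<in> Ob C" using X by simp
    have i: "\<langle>X\<rangle> \<in> hom C X X" using X by simp
    have "m \<langle>X\<rangle> = \<langle>I X\<rangle>"
    proof (rule universal_left_cancel[OF u[OF X] X])
      show "m \<langle>X\<rangle> \<in> hom C (I X) (I X)" by (rule m[OF i])
      show "m \<langle>X\<rangle> \<cdot> l X = \<langle>I X\<rangle> \<cdot> l X" unfolding ml[OF i] using X by (simp add: functor_simps interchange_simps)
    qed (use X in simp)
    then show "fmor ?F \<langle>X\<rangle> = \<langle>fob ?F X\<rangle>" by simp
  next
    fix f X Y assume f: "f \<in> hom C X Y"
    show "fmor ?F f \<in> hom C (fob ?F X) (fob ?F Y)" using m[OF f] by simp
    fix g Z assume g: "g \<in> hom C Y Z"
    have gf: "g \<cdot> f \<in> hom C X Z" by (rule cmp_hom[OF f g])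
    have [simp]: "X \<in> Ob C" "Y \<in> Ob C" "Z \<in> Ob C" using f g Dom_Ob Cod_Ob by (auto simp: hom_def)
    have [simp]: "f \<in> Ar C" "Dom C f = X" "Cod C f = Y" "g \<in> Ar C" "Dom C g = Y" "Cod C g = Z"
      "m f \<in> Ar C" "Dom C (m f) = I X" "Cod C (m f) = I Y" "m g \<in> Ar C" "Dom C (m g) = I Y" "Cod C (m g) = I Z"
      using f g m[OF f] m[OF g] by auto
    have "m (g \<cdot> f) = m g \<cdot> m f"
    proof (rule universal_left_cancel[OF u, of X])
      have "(m g \<cdot> m f) \<cdot> l X = (m g \<cdot> l Y) \<cdot> \<T> f" using ml[OF f] by (simp add: cmp_cmp)
      also have "\<dots> = m (g \<cdot> f) \<cdot> l X" unfolding ml[OF gf] ml[OF g] by (simp add: functor_simps cmp_cmp)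
      finally show "m (g \<cdot> f) \<cdot> l X = (m g \<cdot> m f) \<cdot> l X" ..
    qed (use m[OF gf] in simp_all)
    then show "fmor ?F (g \<cdot> f) = fmor ?F g \<cdot> fmor ?F f" by simp
  qed
  then have "left_universal_functor ?F l"
    using u ml by (simp add: left_universal_functor_def)
  then show ?thesis by blast
qed

lemma universal_left_integral_of_functor:
  assumes F: "left_universal_functor F l"
  shows "universal_left_integral C T F l"
proof -
  have u: "\<And>X. X \<in> Ob C \<Longrightarrow> universal_left_at X (fob F X) (l X)"
    and e: "endofunctor C F" and nat: "\<And>X Y f. f \<in> hom C X Y \<Longrightarrow> fmor F f \<cdot> l X = l Y \<cdot> \<T> f"
    using F by (auto simp: left_universal_functor_def)
  interpret F: endofunctor C F by (rule e)
  have "left_integral C T F l"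
    using e u nat by (auto simp: left_integral_def nat_trans_def universal_left_at_def left_integral_at_def)
  moreover have "factors_uniquely C F l K c"
    if c: "left_integral C T K c" for K :: "('o, 'm) endofunctor_data" and c
  proof -
    interpret K: endofunctor C K using c by (simp add: left_integral_def)
    have cX: "left_integral_at X (fob K X) (c X)" if "X \<in> Ob C" for X
      using c that by (auto simp: left_integral_def left_integral_at_def nat_trans_def)
    have cnat: "c Y \<cdot> \<T> f = fmor K f \<cdot> c X" if "f \<in> hom C X Y" for f X Y
      using c that Dom_Ob[of f] Cod_Ob[of f] by (auto simp: left_integral_def nat_trans_def hom_def)
    have "\<forall>X \<in> Ob C. \<exists>g. g \<in> hom C (fob F X) (fob K X) \<and> g \<cdot> l X = c X"
      using cX u unfolding universal_left_at_def by blast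
    then obtain g where g: "\<And>X. X \<in> Ob C \<Longrightarrow> g X \<in> hom C (fob F X) (fob K X) \<and> g X \<cdot> l X = c X"
      by metis
    \<comment> \<open>The factorizations are obtained object by object; their naturality is checked
      after the universal integral \<open>l X\<close>, where it reduces to the naturality of
      \<open>l\<close> and \<open>c\<close>.\<close>
    have "g Y \<cdot> fmor F f = fmor K f \<cdot> g X" if f: "f \<in> hom C X Y" for f X Y
    proof -
      note [simp] = typing
      have ob [simp]: "X \<in> Ob C" "Y \<in> Ob C" "f \<in> Ar C" "Dom C f = X" "Cod C f = Y"
        using f Dom_Ob Cod_Ob by (auto simp: hom_def)
      have [simp]: "l X \<in> Ar C" "Dom C (l X) = \<T>\<^sub>o X" "Cod C (l X) = fob F X"
        "l Y \<in> Ar C" "Dom C (l Y) = \<T>\<^sub>o Y" "Cod C (l Y) = fob F Y"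
        "g X \<in> Ar C" "Dom C (g X) = fob F X" "Cod C (g X) = fob K X"
        "g Y \<in> Ar C" "Dom C (g Y) = fob F Y" "Cod C (g Y) = fob K Y"
        "fmor F f \<in> Ar C" "Dom C (fmor F f) = fob F X" "Cod C (fmor F f) = fob F Y"
        "fmor K f \<in> Ar C" "Dom C (fmor K f) = fob K X" "Cod C (fmor K f) = fob K Y"
        using universal_left_at_typ(1)[OF u] g F.fmor_hom[OF f] K.fmor_hom[OF f] by auto
      show ?thesis
      proof (rule universal_left_cancel[OF u[OF ob(1)] ob(1)])
        have "(g Y \<cdot> fmor F f) \<cdot> l X = (g Y \<cdot> l Y) \<cdot> \<T> f"
          using nat[OF f] by (simp add: cmp_cmp)
        also have "\<dots> = fmor K f \<cdot> g X \<cdot> l X"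
          using g cnat[OF f] by simp
        finally show "(g Y \<cdot> fmor F f) \<cdot> l X = (fmor K f \<cdot> g X) \<cdot> l X" by (simp add: cmp_cmp)
      qed simp_all
    qed
    then have "nat_trans C F K g" using g by (auto simp: nat_trans_def)
    moreover have "h X = g X" if "nat_trans C F K h" "\<forall>X \<in> Ob C. c X = h X \<cdot> l X" "X \<in> Ob C" for h X
    proof (rule universal_left_cancel[OF u[OF that(3)] that(3)])
      show "h X \<in> hom C (fob F X) (fob K X)" using that by (simp add: nat_trans_def)
      show "h X \<cdot> l X = g X \<cdot> l X" using that g by simp
    qed (use g that in simp)
    moreover have "\<forall>X \<in> Ob C. c X = g X \<cdot> l X" using g by simp
    ultimately show ?thesis unfolding factors_uniquely_def by blast
  qed
  ultimately show ?thesis by (simp add: universal_left_integral_def)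
qed

text \<open>Only universality and naturality of the comparison are retained, for all dual pairs and
  all universal integrals. In this form a family can be carried to and from the reversed category
  without reference to its construction; \<open>left_comparisons\<close> is the mirror
  image.\<close>

definition right_comparisons :: "(('o, 'm) pair \<Rightarrow> ('o, 'm) pair \<Rightarrow> 'm \<Rightarrow> 'm) \<Rightarrow> bool" where
  "right_comparisons K \<longleftrightarrow>
    (\<forall>P Q l. dpair P \<and> dpair Q \<and> universal_left_at (lt P) (lt Q) l \<longrightarrow> universal_right_at (rt Q) (rt P) (K P Q l)) \<and>
    (\<forall>P Q l P' Q' l' v u w j. dpair P \<and> dpair Q \<and> universal_left_at (lt P) (lt Q) l \<and>
      dpair P' \<and> dpair Q' \<and> universal_left_at (lt P') (lt Q') l' \<and>
      mates P' P v u \<and> mates Q' Q w j \<and> w \<cdot> l' = l \<cdot> \<T> v \<longrightarrow> K P' Q' l' \<cdot> \<T> j = u \<cdot> K P Q l)"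

definition left_comparisons :: "(('o, 'm) pair \<Rightarrow> ('o, 'm) pair \<Rightarrow> 'm \<Rightarrow> 'm) \<Rightarrow> bool" where
  "left_comparisons K \<longleftrightarrow>
    (\<forall>P Q l. dpair P \<and> dpair Q \<and> universal_right_at (rt P) (rt Q) l \<longrightarrow> universal_left_at (lt Q) (lt P) (K P Q l)) \<and>
    (\<forall>P Q l P' Q' l' v u w j. dpair P \<and> dpair Q \<and> universal_right_at (rt P) (rt Q) l \<and>
      dpair P' \<and> dpair Q' \<and> universal_right_at (rt P') (rt Q') l' \<and>
      mates P P' u v \<and> mates Q Q' j w \<and> w \<cdot> l' = l \<cdot> \<T> v \<longrightarrow> K P' Q' l' \<cdot> \<T> j = u \<cdot> K P Q l)"

lemma right_comparisons_exist:
  assumes "right_hopf_modules_admit_preserved_coinvariants C T"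
    and "\<And>Y. Y \<in> Ob C \<Longrightarrow> equalizer C Y (\<eta> Y) (\<tau> \<one> Y) (\<eta> \<one> \<otimes> \<langle>\<T>\<^sub>o Y\<rangle>)"
  shows "\<exists>K. right_comparisons K"
proof -
  define K where "K P Q l = (SOME \<kappa>. comparison P Q l \<kappa> \<and> universal_right_at (rt Q) (rt P) \<kappa>)" for P Q l
  have "comparison P Q l (K P Q l) \<and> universal_right_at (rt Q) (rt P) (K P Q l)"
    if "dpair P" "dpair Q" "universal_left_at (lt P) (lt Q) l" for P Q l
    unfolding K_def using someI_ex[OF comparison_universal[OF assms that]] dual_pair_typ(1)[OF that(1)] by simp
  then have K: "comparison P Q l (K P Q l)" "universal_right_at (rt Q) (rt P) (K P Q l)"
    if "dpair P" "dpair Q" "universal_left_at (lt P) (lt Q) l" for P Q l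
    using that by blast+
  have "right_comparisons K"
    unfolding right_comparisons_def
  proof (intro conjI allI impI; elim conjE)
    fix P Q l assume "dpair P" "dpair Q" "universal_left_at (lt P) (lt Q) l"
    then show "universal_right_at (rt Q) (rt P) (K P Q l)" by (rule K)
    fix P' Q' l' v u w j
    assume "dpair P'" "dpair Q'" "universal_left_at (lt P') (lt Q') l'"
      "mates P' P v u" "mates Q' Q w j" "w \<cdot> l' = l \<cdot> \<T> v"
    with \<open>dpair P\<close> \<open>dpair Q\<close> \<open>universal_left_at (lt P) (lt Q) l\<close>
    show "K P' Q' l' \<cdot> \<T> j = u \<cdot> K P Q l"
      by (intro comparison_natural[OF K(1) K(1)])
  qed
  then show ?thesis by blast
qed

end

section \<open>Reversing the tensor product\<close>

text \<open>Composition is left alone, so the monad, its modules, equalizers and natural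
  transformations are the same as before, while left and right are exchanged for duals, antipodes,
  Hopf modules and integrals.\<close>

definition rev_cat :: "('o, 'm, 'x) autonomous_data_scheme \<Rightarrow> ('o, 'm, 'x) autonomous_data_scheme" where
  "rev_cat C = C\<lparr>tensor_ob := \<lambda>X Y. tensor_ob C Y X, tensor := \<lambda>f g. tensor C g f,
    ldual := rdual C, evl := evr C, coevl := coevr C, rdual := ldual C, evr := evl C, coevr := coevl C\<rparr>"

definition rev_bimonad :: "('o, 'm, 'y) bimonad_data_scheme \<Rightarrow> ('o, 'm, 'y) bimonad_data_scheme" where
  "rev_bimonad T = T\<lparr>T2 := \<lambda>X Y. T2 T Y X\<rparr>"

lemma rev_cat_simps [simp]:
  "Ob (rev_cat C) = Ob C" "Ar (rev_cat C) = Ar C" "Dom (rev_cat C) = Dom C" "Cod (rev_cat C) = Cod C"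
  "ide (rev_cat C) = ide C" "cmp (rev_cat C) = cmp C" "unit_ob (rev_cat C) = unit_ob C"
  "tensor_ob (rev_cat C) X Y = tensor_ob C Y X" "tensor (rev_cat C) f g = tensor C g f"
  "ldual (rev_cat C) = rdual C" "evl (rev_cat C) = evr C" "coevl (rev_cat C) = coevr C"
  "rdual (rev_cat C) = ldual C" "evr (rev_cat C) = evl C" "coevr (rev_cat C) = coevl C"
  by (simp_all add: rev_cat_def)

lemma rev_bimonad_simps [simp]:
  "fob (rev_bimonad T) = fob T" "fmor (rev_bimonad T) = fmor T" "mu (rev_bimonad T) = mu T"
  "eta (rev_bimonad T) = eta T" "T0 (rev_bimonad T) = T0 T" "T2 (rev_bimonad T) X Y = T2 T Y X"
  by (simp_all add: rev_bimonad_def)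

lemma hom_rev [simp]: "hom (rev_cat C) = hom C"
  by (simp add: hom_def fun_eq_iff)

lemma category_rev [simp]: "category (rev_cat C) \<longleftrightarrow> category C"
  by (simp add: category_def)

lemma iso_rev [simp]: "iso (rev_cat C) = iso C"
  by (simp add: iso_def fun_eq_iff)

lemma equalizer_rev [simp]: "equalizer (rev_cat C) = equalizer C"
  by (simp add: equalizer_def fun_eq_iff)

lemma nat_trans_rev [simp]: "nat_trans (rev_cat C) = nat_trans C"
  by (simp add: nat_trans_def fun_eq_iff)

lemma endofunctor_rev [simp]: "endofunctor (rev_cat C) F \<longleftrightarrow> endofunctor C F"
  by (simp add: endofunctor_def endofunctor_axioms_def)

lemma nat_trans_rev_bimonad [simp]: "nat_trans C (rev_bimonad T) F = nat_trans C T F"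
  by (simp add: nat_trans_def fun_eq_iff)

lemma quasi_inverse_rev [simp]: "quasi_inverse (rev_cat C) F G \<longleftrightarrow> quasi_inverse C F G"
  by (simp add: quasi_inverse_def naturally_isomorphic_def)

lemma monad_module_rev [simp]: "monad_module (rev_cat C) (rev_bimonad T) M r \<longleftrightarrow> monad_module C T M r"
  by (simp add: monad_module_def)

lemma right_hopf_module_rev [simp]:
  "right_hopf_module (rev_cat C) (rev_bimonad T) M r \<rho> \<longleftrightarrow> left_hopf_module C T M r \<rho>"
  by (simp add: left_hopf_module_def right_hopf_module_def left_comodule_def right_comodule_def)

lemma admit_preserved_coinvariants_rev [simp]:
  "right_hopf_modules_admit_preserved_coinvariants (rev_cat C) (rev_bimonad T)
    \<longleftrightarrow> left_hopf_modules_admit_preserved_coinvariants C T"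
  by (simp add: right_hopf_modules_admit_preserved_coinvariants_def
      left_hopf_modules_admit_preserved_coinvariants_def)

lemma conservative_rev [simp]: "conservative (rev_cat C) (rev_bimonad T) \<longleftrightarrow> conservative C T"
  by (simp add: conservative_def)

lemma universal_left_integral_rev [simp]:
  "universal_left_integral (rev_cat C) (rev_bimonad T) I l \<longleftrightarrow> universal_right_integral C T I l"
  by (simp add: universal_left_integral_def universal_right_integral_def left_integral_def right_integral_def
      factors_uniquely_def nat_trans_def)

lemma monoidal_category_rev:
  assumes "monoidal_category C"
  shows "monoidal_category (rev_cat C)"
proof -
  interpret monoidal_category C by (rule assms)
  show ?thesis
    by (intro monoidal_category.intro monoidal_category_axioms.intro)
      (simp_all add: category_axioms unit_Ob tensor_Ob tensor_hom tensor_ide interchange tensor_ob_assoc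
        unit_ob_left unit_ob_right tensor_assoc unit_left unit_right)
qed

lemma autonomous_category_rev:
  assumes "autonomous_category C"
  shows "autonomous_category (rev_cat C)"
proof -
  interpret autonomous_category C by (rule assms)
  show ?thesis
    by (intro autonomous_category.intro autonomous_category_axioms.intro monoidal_category_rev monoidal_category_axioms)
      (simp_all add: ldual_Ob rdual_Ob evl_hom coevl_hom evr_hom coevr_hom
        ldual_zigzag1 ldual_zigzag2 rdual_zigzag1 rdual_zigzag2)
qed

context autonomous_category
begin

lemma rdual_mor_rev: "f \<in> Ar C \<Longrightarrow> rdual_mor (rev_cat C) f = ldual_mor C f"
  by (simp add: rdual_mor_def ldual_mor_def Let_def tensor_assoc typing)

lemma ldual_mor_rev: "f \<in> Ar C \<Longrightarrow> ldual_mor (rev_cat C) f = rdual_mor C f"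
  by (simp add: rdual_mor_def ldual_mor_def Let_def tensor_assoc typing)

end

section \<open>The reversed Hopf monad and the mirror statements\<close>

context hopf_monad
begin

lemma left_antipode_rev:
  assumes "right_antipode C T s"
  shows "left_antipode (rev_cat C) (rev_bimonad T) s"
proof -
  have [simp]: "ldual_mor (rev_cat C) (\<T> f) = rdual_mor C (\<T> f)"
    "ldual_mor (rev_cat C) f = rdual_mor C f" if "f \<in> hom C X Y" for f X Y
    using that by (auto simp: ldual_mor_rev typing)
  have [simp]: "ldual_mor (rev_cat C) (\<eta> X) = rdual_mor C (\<eta> X)"
    "ldual_mor (rev_cat C) (\<mu> X) = rdual_mor C (\<mu> X)" if "X \<in> Ob C" for X
    using that by (auto simp: ldual_mor_rev typing)
  show ?thesis using assms by (simp add: left_antipode_def right_antipode_def)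
qed

lemma right_antipode_rev:
  assumes "left_antipode C T s"
  shows "right_antipode (rev_cat C) (rev_bimonad T) s"
proof -
  have [simp]: "rdual_mor (rev_cat C) (\<T> f) = ldual_mor C (\<T> f)"
    "rdual_mor (rev_cat C) f = ldual_mor C f" if "f \<in> hom C X Y" for f X Y
    using that by (auto simp: rdual_mor_rev typing)
  have [simp]: "rdual_mor (rev_cat C) (\<eta> X) = ldual_mor C (\<eta> X)"
    "rdual_mor (rev_cat C) (\<mu> X) = ldual_mor C (\<mu> X)" if "X \<in> Ob C" for X
    using that by (auto simp: rdual_mor_rev typing)
  show ?thesis using assms by (simp add: left_antipode_def right_antipode_def)
qed

lemma hopf_monad_rev: "hopf_monad (rev_cat C) (rev_bimonad T)"
proof -
  have "endofunctor C (rev_bimonad T)"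
    using endofunctor_axioms by (simp add: endofunctor_def endofunctor_axioms_def)
  moreover have "nat_trans C (comp_functor (rev_bimonad T) (rev_bimonad T)) (rev_bimonad T) (\<mu>)"
    "nat_trans C id_functor (rev_bimonad T) \<eta>"
    using mu_nat eta_nat by (simp_all add: nat_trans_def comp_functor_def)
  ultimately have "monad (rev_cat C) (rev_bimonad T)"
    by (intro monad.intro monad_axioms.intro) (simp_all add: mu_assoc mu_eta_left mu_eta_right)
  then have "bimonad (rev_cat C) (rev_bimonad T)"
    by (intro bimonad.intro bimonad_axioms.intro monoidal_category_rev monoidal_category_axioms)
      (simp_all add: T2_hom T2_nat T0_hom T2_coassoc T0_right T0_left T2_mu T0_mu T2_eta T0_eta)
  then show ?thesis
    using ex_left_antipode ex_right_antipode left_antipode_rev right_antipode_rev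
    by (intro hopf_monad.intro hopf_monad_axioms.intro autonomous_category_rev autonomous_category_axioms) auto
qed

text \<open>After reversal a left dual becomes a right dual with the same evaluation and
  coevaluation, so only the two objects of a pair change places. Mates accordingly reverse
  direction.\<close>

abbreviation swap :: "('o, 'm) pair \<Rightarrow> ('o, 'm) pair" where "swap P \<equiv> (rt P, lt P, pev P, pcoev P)"

interpretation rev: hopf_monad "rev_cat C" "rev_bimonad T"
  by (rule hopf_monad_rev)

lemma dual_pair_rev [simp]: "rev.dual_pair L R e c \<longleftrightarrow> dual_pair R L e c"
  by (auto simp: rev.dual_pair_def dual_pair_def)

lemma mates_rev [simp]: "rev.mates P Q f g \<longleftrightarrow> mates (swap Q) (swap P) g f"
  by (auto simp: rev.mates_def mates_def)

lemma universal_left_at_rev [simp]: "rev.universal_left_at = universal_right_at"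
  by (auto simp: fun_eq_iff rev.universal_left_at_def universal_right_at_def
      rev.left_integral_at_def right_integral_at_def)

lemma universal_right_at_rev [simp]: "rev.universal_right_at = universal_left_at"
  by (auto simp: fun_eq_iff rev.universal_right_at_def universal_left_at_def
      rev.right_integral_at_def left_integral_at_def)

lemma left_universal_functor_rev [simp]: "rev.left_universal_functor = right_universal_functor"
  by (simp add: fun_eq_iff rev.left_universal_functor_def right_universal_functor_def)

lemma right_universal_functor_rev [simp]: "rev.right_universal_functor = left_universal_functor"
  by (simp add: fun_eq_iff rev.right_universal_functor_def left_universal_functor_def)

lemma left_comparisons_from_rev:
  assumes "rev.right_comparisons K"
  shows "left_comparisons (\<lambda>P Q. K (swap P) (swap Q))"
  unfolding left_comparisons_def
proof (intro conjI allI impI; elim conjE)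
  fix P Q l assume *: "dpair P" "dpair Q" "universal_right_at (rt P) (rt Q) l"
  then show "universal_left_at (lt Q) (lt P) (K (swap P) (swap Q) l)"
    using assms[unfolded rev.right_comparisons_def, THEN conjunct1, rule_format, of "swap P" "swap Q" l] by simp
  fix P' Q' l' v u w j
  assume "dpair P'" "dpair Q'" "universal_right_at (rt P') (rt Q') l'"
    "mates P P' u v" "mates Q Q' j w" "w \<cdot> l' = l \<cdot> \<T> v"
  with * show "K (swap P') (swap Q') l' \<cdot> \<T> j = u \<cdot> K (swap P) (swap Q) l"
    using assms[unfolded rev.right_comparisons_def, THEN conjunct2, rule_format, of "swap P" "swap Q" l "swap P'" "swap Q'" l' v u w j]
    by simp
qed

lemma left_comparisons_rev:
  assumes "right_comparisons K"
  shows "rev.left_comparisons (\<lambda>P Q. K (swap P) (swap Q))"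
  unfolding rev.left_comparisons_def
proof (intro conjI allI impI; elim conjE)
  fix P Q l assume *: "rev.dpair P" "rev.dpair Q" "rev.universal_right_at (rt P) (rt Q) l"
  then show "rev.universal_left_at (lt Q) (lt P) (K (swap P) (swap Q) l)"
    using assms[unfolded right_comparisons_def, THEN conjunct1, rule_format, of "swap P" "swap Q" l] by simp
  fix P' Q' l' v u w j
  assume "rev.dpair P'" "rev.dpair Q'" "rev.universal_right_at (rt P') (rt Q') l'"
    "rev.mates P P' u v" "rev.mates Q Q' j w" "cmp (rev_cat C) w l' = cmp (rev_cat C) l (fmor (rev_bimonad T) v)"
  with * show "cmp (rev_cat C) (K (swap P') (swap Q') l') (fmor (rev_bimonad T) j) = cmp (rev_cat C) u (K (swap P) (swap Q) l)"
    using assms[unfolded right_comparisons_def, THEN conjunct2, rule_format, of "swap P" "swap Q" l "swap P'" "swap Q'" l' v u w j]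
    by simp
qed

lemmas universal_right_at_typ = rev.universal_left_at_typ[simplified]
lemmas universal_right_cancel = rev.universal_left_cancel[simplified]
lemmas universal_right_iso = rev.universal_left_iso[simplified]

lemma free_left_coinvariants:
  assumes "left_hopf_modules_admit_preserved_coinvariants C T" "conservative C T" "X \<in> Ob C"
  shows "equalizer C X (\<eta> X) (\<tau> \<one> X) (\<eta> \<one> \<otimes> \<langle>\<T>\<^sub>o X\<rangle>)"
  using rev.free_coinvariants[of X] assms by simp

end

section \<open>Auto-equivalences\<close>

lemma quasi_inverse_sym: "quasi_inverse C F G \<Longrightarrow> quasi_inverse C G F"
  by (simp add: quasi_inverse_def)

text \<open>Meant for \<open>lshriek\<close> and the \<open>rshriek\<close> of the reversed
  category. Their dual morphisms bracket a triple tensor product differently, so the two functors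
  are identified on arrows of \<open>C\<close> and not as functions on the whole type.\<close>

lemma quasi_inverse_cong:
  assumes q: "quasi_inverse C F G" and ob: "fob F' = fob F" and mor: "\<And>f. f \<in> Ar C \<Longrightarrow> fmor F' f = fmor F f"
  shows "quasi_inverse C F' G"
proof -
  interpret F: endofunctor C F using q by (simp add: quasi_inverse_def)
  interpret G: endofunctor C G using q by (simp add: quasi_inverse_def)
  have mor': "fmor F' f = fmor F f" if "f \<in> hom C X Y" for f X Y
    using that mor by (simp add: hom_def)
  have "endofunctor C F'"
    by unfold_locales (use F.fob_Ob F.fmor_hom F.fmor_ide F.fmor_cmp in
      \<open>auto simp: ob mor'[OF F.ide_hom] mor' mor'[OF F.cmp_hom]\<close>)
  moreover have "nat_trans C (comp_functor F' G) id_functor \<alpha>"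
    if "nat_trans C (comp_functor F G) id_functor \<alpha>" for \<alpha>
    using that by (simp add: nat_trans_def comp_functor_def ob mor'[OF G.fmor_hom])
  moreover have "nat_trans C (comp_functor G F') id_functor \<alpha>"
    if "nat_trans C (comp_functor G F) id_functor \<alpha>" for \<alpha>
    using that by (simp add: nat_trans_def comp_functor_def ob mor')
  ultimately show ?thesis
    using q unfolding quasi_inverse_def naturally_isomorphic_def by (metis (no_types, lifting))
qed

context hopf_monad
begin

text \<open>The comparison turns the universal left integral on the left dual of \<open>X\<close>
  into a universal right integral on \<open>fob ?G X\<close> with value \<open>X\<close>. Uniqueness
  of the value compares it with \<open>Ir\<close>.\<close>

lemma rshriek_right_inverse:
  assumes Il: "left_universal_functor Il l" and Ir: "right_universal_functor Ir r" and K: "right_comparisons K"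
  shows "naturally_isomorphic C (comp_functor Ir (rshriek C Il)) id_functor"
proof -
  have Il_u: "\<And>X. X \<in> Ob C \<Longrightarrow> universal_left_at X (fob Il X) (l X)" and Il_e: "endofunctor C Il"
    and Il_n: "\<And>X Y f. f \<in> hom C X Y \<Longrightarrow> fmor Il f \<cdot> l X = l Y \<cdot> \<T> f"
    using Il by (auto simp: left_universal_functor_def)
  have Ir_u: "\<And>X. X \<in> Ob C \<Longrightarrow> universal_right_at X (fob Ir X) (r X)" and Ir_e: "endofunctor C Ir"
    and Ir_n: "\<And>X Y f. f \<in> hom C X Y \<Longrightarrow> fmor Ir f \<cdot> r X = r Y \<cdot> \<T> f"
    using Ir by (auto simp: right_universal_functor_def)
  interpret Il: endofunctor C Il by (rule Il_e)
  interpret Ir: endofunctor C Ir by (rule Ir_e)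
  interpret G: endofunctor C "rshriek C Il" by (rule endofunctor_rshriek[OF Il_e])
  note [simp] = typing
  let ?G = "rshriek C Il"
  \<comment> \<open>The pairs are chosen so that \<open>lt (P X)\<close> is the object at which
    \<open>Il\<close> is evaluated and \<open>rt (Q X)\<close> is the value of \<open>?G\<close>;
    thus \<kappa> leads from \<open>\<T>\<^sub>o (fob ?G X)\<close> to \<open>X\<close>.\<close>
  define P where "P X = lpair X" for X
  define Q where "Q X = rpair (fob Il (ldual C X))" for X
  define \<kappa> where "\<kappa> X = K (P X) (Q X) (l (ldual C X))" for X
  have PQ: "dpair (P X)" "dpair (Q X)" "universal_left_at (lt (P X)) (lt (Q X)) (l (ldual C X))"
    "rt (P X) = X" "rt (Q X) = fob ?G X" if "X \<in> Ob C" for X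
    using that Il_u[of "ldual C X"] unfolding P_def Q_def
    by (auto simp: rshriek_def ldual_Ob Il.fob_Ob intro!: ldual_pair rdual_pair)
  have \<kappa>_u: "universal_right_at (fob ?G X) X (\<kappa> X)" if "X \<in> Ob C" for X
    using K[unfolded right_comparisons_def, THEN conjunct1, rule_format, of "P X" "Q X"] PQ[OF that]
    by (simp add: \<kappa>_def)
  have \<kappa>_n: "\<kappa> Y \<cdot> \<T> (fmor ?G f) = f \<cdot> \<kappa> X" if f: "f \<in> hom C X Y" for f X Y
  proof -
    have ob: "X \<in> Ob C" "Y \<in> Ob C" using f Dom_Ob Cod_Ob by (auto simp: hom_def)
    have v: "ldual_mor C f \<in> hom C (ldual C Y) (ldual C X)" using f by simp
    show ?thesis
      unfolding \<kappa>_def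
    proof (rule K[unfolded right_comparisons_def, THEN conjunct2, rule_format], intro conjI PQ ob)
      show "mates (P Y) (P X) (ldual_mor C f) f" unfolding P_def by (rule mates_ldual_mor[OF f])
      show "mates (Q Y) (Q X) (fmor Il (ldual_mor C f)) (fmor ?G f)"
        unfolding Q_def using mates_rdual_mor[OF Il.fmor_hom[OF v]] by (simp add: rshriek_def)
      show "fmor Il (ldual_mor C f) \<cdot> l (ldual C Y) = l (ldual C X) \<cdot> \<T> (ldual_mor C f)"
        by (rule Il_n[OF v])
    qed
  qed
  have "\<forall>X \<in> Ob C. \<exists>u. u \<in> hom C (fob Ir (fob ?G X)) X \<and> iso C u \<and> u \<cdot> r (fob ?G X) = \<kappa> X"
    using universal_right_iso[OF Ir_u \<kappa>_u] G.fob_Ob by metis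
  then obtain \<beta> where \<beta>: "\<And>X. X \<in> Ob C \<Longrightarrow> \<beta> X \<in> hom C (fob Ir (fob ?G X)) X"
    and \<beta>_iso: "\<And>X. X \<in> Ob C \<Longrightarrow> iso C (\<beta> X)" and \<beta>_r: "\<And>X. X \<in> Ob C \<Longrightarrow> \<beta> X \<cdot> r (fob ?G X) = \<kappa> X"
    by metis
  have "\<beta> Y \<cdot> fmor Ir (fmor ?G f) = f \<cdot> \<beta> X" if f: "f \<in> hom C X Y" for f X Y
  proof -
    have ob: "X \<in> Ob C" "Y \<in> Ob C" using f Dom_Ob Cod_Ob by (auto simp: hom_def)
    note Gf = G.fmor_hom[OF f]
    note h = \<beta>[OF ob(1)] \<beta>[OF ob(2)] f Ir.fmor_hom[OF Gf]
      universal_right_at_typ(1)[OF Ir_u[OF G.fob_Ob[OF ob(1)]]] universal_right_at_typ(1)[OF Ir_u[OF G.fob_Ob[OF ob(2)]]]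
    show ?thesis
    \<comment> \<open>Naturality is tested after a universal integral, where \<beta> becomes
      \<kappa>, whose naturality is known.\<close>
    proof (rule universal_right_cancel[OF Ir_u[OF G.fob_Ob[OF ob(1)]] G.fob_Ob[OF ob(1)]])
      have "(\<beta> Y \<cdot> fmor Ir (fmor ?G f)) \<cdot> r (fob ?G X) = (\<beta> Y \<cdot> r (fob ?G Y)) \<cdot> \<T> (fmor ?G f)"
        using h Gf Ir_n[OF Gf] by (auto simp: cmp_cmp)
      also have "\<dots> = f \<cdot> \<beta> X \<cdot> r (fob ?G X)"
        using ob \<kappa>_n[OF f] by (simp add: \<beta>_r)
      also have "\<dots> = (f \<cdot> \<beta> X) \<cdot> r (fob ?G X)"
        using h by (auto simp: cmp_cmp)
      finally show "(\<beta> Y \<cdot> fmor Ir (fmor ?G f)) \<cdot> r (fob ?G X) = (f \<cdot> \<beta> X) \<cdot> r (fob ?G X)" .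
    qed (use h in auto)
  qed
  then show ?thesis
    unfolding naturally_isomorphic_def nat_trans_def
    by (intro exI[of _ \<beta>]) (auto simp: comp_functor_def id_functor_def \<beta>_iso \<beta>[unfolded hom_iff] hom_iff)
qed

text \<open>The mirror comparison yields an isomorphism \<theta> from \<open>fob Il (J X)\<close> to
  the left dual of \<open>X\<close>. Its inverse has as mate the required isomorphism from the right
  dual of \<open>fob Il (J X)\<close>, which is \<open>rshriek C Il\<close> at
  \<open>fob Ir X\<close>, to \<open>X\<close>.\<close>

lemma rshriek_left_inverse:
  assumes Il: "left_universal_functor Il l" and Ir: "right_universal_functor Ir r" and K: "left_comparisons K"
  shows "naturally_isomorphic C (comp_functor (rshriek C Il) Ir) id_functor"
proof -
  have Il_u: "\<And>X. X \<in> Ob C \<Longrightarrow> universal_left_at X (fob Il X) (l X)" and Il_e: "endofunctor C Il"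
    and Il_n: "\<And>X Y f. f \<in> hom C X Y \<Longrightarrow> fmor Il f \<cdot> l X = l Y \<cdot> \<T> f"
    using Il by (auto simp: left_universal_functor_def)
  have Ir_u: "\<And>X. X \<in> Ob C \<Longrightarrow> universal_right_at X (fob Ir X) (r X)" and Ir_e: "endofunctor C Ir"
    and Ir_n: "\<And>X Y f. f \<in> hom C X Y \<Longrightarrow> fmor Ir f \<cdot> r X = r Y \<cdot> \<T> f"
    using Ir by (auto simp: right_universal_functor_def)
  interpret Il: endofunctor C Il by (rule Il_e)
  interpret Ir: endofunctor C Ir by (rule Ir_e)
  note [simp] = typing
  define J where "J X = ldual C (fob Ir X)" for X
  define j where "j f = ldual_mor C (fmor Ir f)" for f
  define R where "R X = rpair (fob Il (J X))" for X
  define \<kappa> where "\<kappa> X = K (lpair X) (lpair (fob Ir X)) (r X)" for X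
  have J: "J X \<in> Ob C" if "X \<in> Ob C" for X using that by (simp add: J_def Ir.fob_Ob)
  have j: "j f \<in> hom C (J Y) (J X)" if "f \<in> hom C X Y" for f X Y
    using Ir.fmor_hom[OF that] by (auto simp: j_def J_def)
  have PQ: "dpair (lpair X)" "dpair (lpair (fob Ir X))" "dpair (R X)"
     "universal_right_at (rt (lpair X)) (rt (lpair (fob Ir X))) (r X)" if "X \<in> Ob C" for X
    using that Ir_u J unfolding R_def by (auto simp: Ir.fob_Ob Il.fob_Ob intro!: ldual_pair rdual_pair)
  have \<kappa>_u: "universal_left_at (J X) (ldual C X) (\<kappa> X)" if "X \<in> Ob C" for X
    using K[unfolded left_comparisons_def, THEN conjunct1, rule_format, of "lpair X" "lpair (fob Ir X)"] PQ[OF that]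
    by (simp add: \<kappa>_def J_def)
  have \<kappa>_n: "\<kappa> X \<cdot> \<T> (j f) = ldual_mor C f \<cdot> \<kappa> Y" if f: "f \<in> hom C X Y" for f X Y
  proof -
    have ob: "X \<in> Ob C" "Y \<in> Ob C" using f Dom_Ob Cod_Ob by (auto simp: hom_def)
    show ?thesis
      unfolding \<kappa>_def j_def
      by (rule K[unfolded left_comparisons_def, THEN conjunct2, rule_format, where v = f and w = "fmor Ir f"])
        (intro conjI PQ ob Ir.fob_Ob mates_ldual_mor[OF f] mates_ldual_mor[OF Ir.fmor_hom[OF f]] Ir_n[OF f])
  qed
  have "\<forall>X \<in> Ob C. \<exists>u. u \<in> hom C (fob Il (J X)) (ldual C X) \<and> iso C u \<and> u \<cdot> l (J X) = \<kappa> X"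
    using universal_left_iso[OF Il_u \<kappa>_u] J by metis
  then obtain \<theta> where \<theta>: "\<And>X. X \<in> Ob C \<Longrightarrow> \<theta> X \<in> hom C (fob Il (J X)) (ldual C X)"
    and \<theta>_iso: "\<And>X. X \<in> Ob C \<Longrightarrow> iso C (\<theta> X)" and \<theta>_l: "\<And>X. X \<in> Ob C \<Longrightarrow> \<theta> X \<cdot> l (J X) = \<kappa> X"
    by metis
  have "\<forall>X \<in> Ob C. \<exists>v. v \<in> hom C (ldual C X) (fob Il (J X)) \<and> v \<cdot> \<theta> X = \<langle>fob Il (J X)\<rangle> \<and> \<theta> X \<cdot> v = \<langle>ldual C X\<rangle>"
    using \<theta> \<theta>_iso unfolding iso_def by (metis hom_iff)
  \<comment> \<open>The inverse of \<theta> is needed explicitly: taking mates reverses direction,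
    and it is the mate of \<omega> that ends in \<open>X\<close>. The mate of \<theta> becomes the
    inverse of \<alpha>.\<close>
  then obtain \<omega> where \<omega>: "\<And>X. X \<in> Ob C \<Longrightarrow> \<omega> X \<in> hom C (ldual C X) (fob Il (J X))"
    and \<omega>\<theta>: "\<And>X. X \<in> Ob C \<Longrightarrow> \<omega> X \<cdot> \<theta> X = \<langle>fob Il (J X)\<rangle>"
    and \<theta>\<omega>: "\<And>X. X \<in> Ob C \<Longrightarrow> \<theta> X \<cdot> \<omega> X = \<langle>ldual C X\<rangle>" by metis
  have "\<forall>X \<in> Ob C. \<exists>a. mates (lpair X) (R X) (\<omega> X) a"
    using mates_right PQ \<omega> by (simp add: R_def)
  then obtain \<alpha> where \<alpha>: "\<And>X. X \<in> Ob C \<Longrightarrow> mates (lpair X) (R X) (\<omega> X) (\<alpha> X)" by metis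
  have "\<forall>X \<in> Ob C. \<exists>a. mates (R X) (lpair X) (\<theta> X) a"
    using mates_right PQ \<theta> by (simp add: R_def)
  then obtain \<alpha>' where \<alpha>': "\<And>X. X \<in> Ob C \<Longrightarrow> mates (R X) (lpair X) (\<theta> X) (\<alpha>' X)" by metis
  have \<alpha>_iso: "iso C (\<alpha> X)" if X: "X \<in> Ob C" for X
  proof -
    have "\<alpha> X \<cdot> \<alpha>' X = \<langle>X\<rangle>"
      using mates_inverse[OF PQ(1,3)[OF X] \<alpha>[OF X] \<alpha>'[OF X]] \<theta>\<omega>[OF X] by simp
    moreover have "\<alpha>' X \<cdot> \<alpha> X = \<langle>rt (R X)\<rangle>"
      using mates_inverse[OF PQ(3,1)[OF X] \<alpha>'[OF X] \<alpha>[OF X]] \<omega>\<theta>[OF X] by (simp add: R_def)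
    ultimately show ?thesis
      unfolding iso_def using mates_typ[OF \<alpha>[OF X]] mates_typ[OF \<alpha>'[OF X]]
      by (intro conjI bexI[of _ "\<alpha>' X"]) simp_all
  qed
  have "\<alpha> Y \<cdot> rdual_mor C (fmor Il (j f)) = f \<cdot> \<alpha> X" if f: "f \<in> hom C X Y" for f X Y
  proof -
    have ob: "X \<in> Ob C" "Y \<in> Ob C" using f Dom_Ob Cod_Ob by (auto simp: hom_def)
    let ?v = "ldual_mor C f"
    have v: "?v \<in> hom C (ldual C Y) (ldual C X)" using f by simp
    note Ij = Il.fmor_hom[OF j[OF f]]
    note h = \<theta>[OF ob(1)] \<theta>[OF ob(2)] \<omega>[OF ob(1)] \<omega>[OF ob(2)] f v Ij j[OF f]
      universal_left_at_typ(1)[OF Il_u[OF J[OF ob(1)]]] universal_left_at_typ(1)[OF Il_u[OF J[OF ob(2)]]]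
    have "\<theta> X \<cdot> fmor Il (j f) = ?v \<cdot> \<theta> Y"
    proof (rule universal_left_cancel[OF Il_u[OF J[OF ob(2)]] J[OF ob(2)]])
      have "(\<theta> X \<cdot> fmor Il (j f)) \<cdot> l (J Y) = (\<theta> X \<cdot> l (J X)) \<cdot> \<T> (j f)"
        using h Il_n[OF j[OF f]] by (auto simp: cmp_cmp)
      also have "\<dots> = ?v \<cdot> \<theta> Y \<cdot> l (J Y)"
        using ob \<kappa>_n[OF f] by (simp add: \<theta>_l)
      also have "\<dots> = (?v \<cdot> \<theta> Y) \<cdot> l (J Y)"
        using h by (auto simp: cmp_cmp)
      finally show "(\<theta> X \<cdot> fmor Il (j f)) \<cdot> l (J Y) = (?v \<cdot> \<theta> Y) \<cdot> l (J Y)" .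
    qed (use h in auto)
    \<comment> \<open>Composing the naturality square of \<theta> with \<omega> on both sides gives
      the square of \<omega>, whose mate is the one wanted.\<close>
    then have "\<omega> X \<cdot> (\<theta> X \<cdot> fmor Il (j f)) \<cdot> \<omega> Y = \<omega> X \<cdot> (?v \<cdot> \<theta> Y) \<cdot> \<omega> Y" by simp
    moreover have "\<omega> X \<cdot> (\<theta> X \<cdot> fmor Il (j f)) \<cdot> \<omega> Y = (\<omega> X \<cdot> \<theta> X) \<cdot> fmor Il (j f) \<cdot> \<omega> Y"
      "\<omega> X \<cdot> (?v \<cdot> \<theta> Y) \<cdot> \<omega> Y = \<omega> X \<cdot> ?v \<cdot> \<theta> Y \<cdot> \<omega> Y"
      using h by (auto simp: cmp_cmp)
    ultimately have eq: "fmor Il (j f) \<cdot> \<omega> Y = \<omega> X \<cdot> ?v"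
      using h by (auto simp: \<omega>\<theta>[OF ob(1)] \<theta>\<omega>[OF ob(2)] ide_cmp cmp_ide)
    have m: "mates (R Y) (R X) (fmor Il (j f)) (rdual_mor C (fmor Il (j f)))"
      unfolding R_def by (rule mates_rdual_mor[OF Ij])
    show ?thesis
      using mates_cmp[OF PQ(1)[OF ob(2)] PQ(3)[OF ob(2)] PQ(3)[OF ob(1)] \<alpha>[OF ob(2)] m]
        mates_cmp[OF PQ(1)[OF ob(2)] PQ(1)[OF ob(1)] PQ(3)[OF ob(1)] mates_ldual_mor[OF f] \<alpha>[OF ob(1)]]
        mates_right_unique[OF PQ(1)[OF ob(2)]]
      unfolding eq by blast
  qed
  moreover have "\<alpha> X \<in> hom C (fob (rshriek C Il) (fob Ir X)) X" if "X \<in> Ob C" for X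
    using mates_typ[OF \<alpha>[OF that]] by (simp add: rshriek_def R_def J_def)
  ultimately show ?thesis
    unfolding naturally_isomorphic_def nat_trans_def
    by (intro exI[of _ \<alpha>]) (simp del: hom_iff add: comp_functor_def id_functor_def \<alpha>_iso rshriek_def j_def)
qed

lemma quasi_inverse_rshriek:
  assumes "left_universal_functor Il l" "right_universal_functor Ir r" "right_comparisons K" "left_comparisons K'"
  shows "quasi_inverse C (rshriek C Il) Ir"
  using rshriek_right_inverse[OF assms(1-3)] rshriek_left_inverse[OF assms(1,2,4)] assms(1,2)
    endofunctor_rshriek[of Il]
  by (simp add: quasi_inverse_def left_universal_functor_def right_universal_functor_def)

interpretation rev: hopf_monad "rev_cat C" "rev_bimonad T"
  by (rule hopf_monad_rev)

text \<open>Each family of comparisons serves twice. \<open>K\<close> and the mirror image of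
  \<open>K'\<close> show that \<open>rshriek C Il\<close> and \<open>Ir\<close> are quasi-inverse;
  in the reversed category the same argument runs with \<open>Il\<close> and \<open>Ir\<close>
  exchanged, \<open>K'\<close> and the mirror image of \<open>K\<close> taking these roles.\<close>

lemma integrals_quasi_inverse:
  assumes l: "left_hopf_modules_admit_preserved_coinvariants C T"
    and r: "right_hopf_modules_admit_preserved_coinvariants C T" and cons: "conservative C T"
  shows "\<exists>(I\<^sub>l :: ('o, 'm) endofunctor_data) (I\<^sub>r :: ('o, 'm) endofunctor_data) \<Lambda>\<^sub>l \<Lambda>\<^sub>r.
        auto_equivalence C I\<^sub>l \<and> auto_equivalence C I\<^sub>r \<and>
        universal_left_integral C T I\<^sub>l \<Lambda>\<^sub>l \<and> universal_right_integral C T I\<^sub>r \<Lambda>\<^sub>r \<and>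
        quasi_inverse C (rshriek C I\<^sub>l) I\<^sub>r \<and> quasi_inverse C (lshriek C I\<^sub>r) I\<^sub>l"
proof -
  obtain Il \<Lambda>l where Il: "left_universal_functor Il \<Lambda>l"
    using left_universal_functor_exists[OF r] by blast
  obtain Ir \<Lambda>r where Ir: "right_universal_functor Ir \<Lambda>r"
    using rev.left_universal_functor_exists l by auto
  obtain K where K: "right_comparisons K"
    using right_comparisons_exist[OF r] free_left_coinvariants[OF l cons] by blast
  obtain K' where K': "rev.right_comparisons K'"
    using rev.right_comparisons_exist l free_coinvariants[OF r cons] by auto
  have q1: "quasi_inverse C (rshriek C Il) Ir"
    by (rule quasi_inverse_rshriek[OF Il Ir K left_comparisons_from_rev[OF K']])
  have "quasi_inverse C (rshriek (rev_cat C) Ir) Il"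
    using rev.quasi_inverse_rshriek[OF _ _ K' left_comparisons_rev[OF K]] Il Ir by simp
  moreover have "fmor (lshriek C Ir) f = fmor (rshriek (rev_cat C) Ir) f" if "f \<in> Ar C" for f
  proof -
    interpret Ir: endofunctor C Ir using Ir by (simp add: right_universal_functor_def)
    have "fmor Ir (rdual_mor C f) \<in> Ar C"
      using Ir.fmor_hom[of "rdual_mor C f"] that by (simp add: typing hom_def)
    then show ?thesis using that by (simp add: lshriek_def rshriek_def ldual_mor_rev rdual_mor_rev)
  qed
  ultimately have q2: "quasi_inverse C (lshriek C Ir) Il"
    by (elim quasi_inverse_cong) (simp_all add: lshriek_def rshriek_def)
  \<comment> \<open>The two quasi-inverse statements, read backwards, supply the quasi-inverses:
    \<open>lshriek C Ir\<close> for \<open>Il\<close> and \<open>rshriek C Il\<close> for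
    \<open>Ir\<close>.\<close>
  have "auto_equivalence C Il" "auto_equivalence C Ir"
    using quasi_inverse_sym[OF q1] quasi_inverse_sym[OF q2]
    unfolding auto_equivalence_def by (auto simp: quasi_inverse_def[of C Il] quasi_inverse_def[of C Ir])
  moreover have "universal_left_integral C T Il \<Lambda>l"
    by (rule universal_left_integral_of_functor[OF Il])
  moreover have "universal_right_integral C T Ir \<Lambda>r"
    using rev.universal_left_integral_of_functor[of Ir \<Lambda>r] Ir by simp
  ultimately show ?thesis using q1 q2 by blast
qed

lemma admit_preserved_coinvariants_of_equalizers:
  assumes "has_equalizers C" "preserves_equalizers C T"
  shows "right_hopf_modules_admit_preserved_coinvariants C T"
  unfolding right_hopf_modules_admit_preserved_coinvariants_def
proof (intro allI impI)
  fix M r \<rho> assume "right_hopf_module C T M r \<rho>"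
  then have M: "M \<in> Ob C" "\<rho> \<in> hom C M (M \<otimes>\<^sub>o A)"
    by (auto simp: right_hopf_module_def right_comodule_def)
  moreover from M have "\<langle>M\<rangle> \<otimes> \<eta> \<one> \<in> hom C M (M \<otimes>\<^sub>o A)" by (simp add: typing)
  moreover from M have "M \<otimes>\<^sub>o A \<in> Ob C" by (simp add: typing)
  ultimately show "\<exists>E i. equalizer C E i \<rho> (\<langle>M\<rangle> \<otimes> \<eta> \<one>) \<and>
      equalizer C (\<T>\<^sub>o E) (\<T> i) (\<T> \<rho>) (\<T> (\<langle>M\<rangle> \<otimes> \<eta> \<one>))"
    using assms unfolding has_equalizers_def preserves_equalizers_def by metis
qed

end

theorem theorem5p3:
  fixes C :: "('o, 'm) autonomous_data" and T :: "('o, 'm) bimonad_data"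
  assumes "autonomous_category C" and "hopf_monad C T"
  shows "(has_equalizers C \<and> preserves_equalizers C T \<longrightarrow>
      left_hopf_modules_admit_preserved_coinvariants C T \<and>
      right_hopf_modules_admit_preserved_coinvariants C T) \<and>
      (left_hopf_modules_admit_preserved_coinvariants C T \<and>
      right_hopf_modules_admit_preserved_coinvariants C T \<and> conservative C T \<longrightarrow>
      (\<exists>(I\<^sub>l :: ('o, 'm) endofunctor_data) (I\<^sub>r :: ('o, 'm) endofunctor_data) \<Lambda>\<^sub>l \<Lambda>\<^sub>r.
        auto_equivalence C I\<^sub>l \<and> auto_equivalence C I\<^sub>r \<and>
        universal_left_integral C T I\<^sub>l \<Lambda>\<^sub>l \<and> universal_right_integral C T I\<^sub>r \<Lambda>\<^sub>r \<and>
        quasi_inverse C (rshriek C I\<^sub>l) I\<^sub>r \<and> quasi_inverse C (lshriek C I\<^sub>r) I\<^sub>l))"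
proof -
  interpret hopf_monad C T by (rule assms(2))
  have "left_hopf_modules_admit_preserved_coinvariants C T \<and> right_hopf_modules_admit_preserved_coinvariants C T"
    if e: "has_equalizers C" "preserves_equalizers C T"
  proof -
    \<comment> \<open>Equalizers involve only composition, so both assumptions survive reversal, and
      the right-handed statement for the reversed monad is the left-handed one for
      \<open>T\<close>.\<close>
    have "has_equalizers (rev_cat C)" "preserves_equalizers (rev_cat C) (rev_bimonad T)"
      using e by (simp_all add: has_equalizers_def preserves_equalizers_def)
    from hopf_monad.admit_preserved_coinvariants_of_equalizers[OF hopf_monad_rev this]
      admit_preserved_coinvariants_of_equalizers[OF e]
    show ?thesis by simp
  qed
  then show ?thesis using integrals_quasi_inverse by blast
qed

end
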